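(* Let $F_2$ be the free group on $\gamma_1,\gamma_2$. The algebra $\mathbb C[X_{SO(4,\mathbb C)}(F_2)]$ is the quotient of the polynomial ring in the $17$ generators $$a_{i,j,k}\ (i,j,k\in\{1,2\},\ j\le k),\qquad b_{j,k}\ (j,k\in\{1,2\},\ j\le k),\qquad c_{i,j,k}\ (i,j,k\in\{1,2\})$$ (mapped respectively to $\tau_{i,j}\tau_{i,k}$, $\tau_{12,j}\tau_{12,k}$, and $\tau_{1,i}\tau_{2,j}\tau_{12,k}$ in $\mathbb C[X_{SO(4,\mathbb C)}(F_2)]$) by the ideal generated by $$a_{i,j,k}a_{i,j',k'}-a_{i,j,j'}a_{i,k,k'},\quad b_{j,k}b_{j',k'}-b_{j,j'}b_{k,k'},\quad c_{i,j,k}c_{i',j',k'}-a_{1,i,i'}a_{2,j,j'}b_{k,k'},$$ $$a_{1,j,k}c_{i,j',k'}-a_{1,i,k}c_{j,j',k'},\quad a_{2,j,k}c_{i,j',k'}-a_{2,j',k}c_{i,j,k'},\quad b_{j,k}c_{i,j',k'}-b_{j,k'}c_{i,j',k},$$ for all values of the indices in $\{1,2\}$, where $a_{i,2,1}=a_{i,1,2}$ and $b_{2,1}=b_{1,2}$.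
   Context: For a reductive algebraic group $G$ over $\mathbb C$, $X_G(F_2)=Hom(F_2,G)//G=G^2//G$ is the categorical quotient by simultaneous conjugation. There is an epimorphism $SL(2,\mathbb C)\times SL(2,\mathbb C)\to SO(4,\mathbb C)$ with kernel $\{(I,I),(-I,-I)\}$, given by the action on $\mathbb C^2\otimes\mathbb C^2$, $(A,B)\cdot(u\otimes v)=Au\otimes Bv$, which preserves the nondegenerate symmetric form $(u_1\otimes u_2,v_1\otimes v_2)=\det(u_1,v_1)\det(u_2,v_2)$. It induces an identification $$\mathbb C[X_{SO(4,\mathbb C)}(F_2)]=\mathbb C[X_{SL(2,\mathbb C)}(F_2)\times X_{SL(2,\mathbb C)}(F_2)]^{\mathbb Z/2\times\mathbb Z/2},$$ where $(\varepsilon_1,\varepsilon_2)\in\{\pm1\}^2$ sends the class of $\rho=(\rho_1,\rho_2)$ to the class of $\rho'$ with $\rho'(\gamma_i)=(\varepsilon_i\rho_1(\gamma_i),\varepsilon_i\rho_2(\gamma_i))$. Recall $\mathbb C[X_{SL(2,\mathbb C)}(F_2)]=\mathbb C[\tau_1,\tau_2,\tau_{12}]$ is a polynomial ring, where $\tau_1,\tau_2,\tau_{12}$ are the functions $[\rho]\mapsto\mathrm{tr}\,\rho(\gamma_1),\ \mathrm{tr}\,\rho(\gamma_2),\ \mathrm{tr}\,\rho(\gamma_1\gamma_2)$. For $j=1,2$, $\tau_{1,j},\tau_{2,j},\tau_{12,j}$ denote the functions $\tau_1,\tau_2,\tau_{12}$ on the $j$-th factor of $X_{SL(2,\mathbb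 C)}(F_2)\times X_{SL(2,\mathbb C)}(F_2)$. *)

theory Defs
  imports
    "HOL-Analysis.Analysis"
    "HOL-Algebra.QuotRing"
    "HOL-Library.Poly_Mapping"
begin

type_synonym ('v, 'a) mpoly = "('v \<Rightarrow>\<^sub>0 nat) \<Rightarrow>\<^sub>0 'a"

definition Const :: "'a \<Rightarrow> ('v, 'a::zero) mpoly" where
  "Const c = Poly_Mapping.single 0 c"

definition Var :: "'v \<Rightarrow> ('v, 'a::zero_neq_one) mpoly" where
  "Var v = Poly_Mapping.single (Poly_Mapping.single v 1) 1"

definition mpoly_eval :: "('v \<Rightarrow> 'a) \<Rightarrow> ('v, 'a::comm_semiring_1) mpoly \<Rightarrow> 'a" where
  "mpoly_eval x p =
     (\<Sum>m\<in>Poly_Mapping.keys p. Poly_Mapping.lookup p m *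
        (\<Prod>v\<in>Poly_Mapping.keys m. x v ^ Poly_Mapping.lookup m v))"

definition mpoly_ring :: "'v set \<Rightarrow> ('v, 'a::comm_ring_1) mpoly ring" where
  "mpoly_ring V =
     \<lparr> carrier = {p. \<forall>m\<in>Poly_Mapping.keys p. Poly_Mapping.keys m \<subseteq> V},
       mult = (*), one = 1, zero = 0, add = (+) \<rparr>"

text \<open>A homomorphism from the free group on \<open>\<gamma>\<^sub>1, \<gamma>\<^sub>2\<close> to a matrix group \<open>G\<close> is given by the pair
  \<open>(\<rho>(\<gamma>\<^sub>1), \<rho>(\<gamma>\<^sub>2)) \<in> G \<times> G\<close>.\<close>

type_synonym 'n rep = "(complex^'n^'n) \<times> (complex^'n^'n)"

fun entry :: "'n::finite rep \<Rightarrow> ('n \<times> 'n) + ('n \<times> 'n) \<Rightarrow> complex" where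
  "entry (A, B) (Inl (i, j)) = A $ i $ j"
| "entry (A, B) (Inr (i, j)) = B $ i $ j"

text \<open>Regular functions on a Zariski closed set \<open>X\<close> of pairs of matrices are the restrictions to \<open>X\<close>
  of polynomials in the matrix entries.  They are represented as extensional functions on \<open>X\<close>.
  For \<open>X = G \<times> G\<close> with \<open>G\<close> closed in the special linear group no inverse of the determinant
  has to be adjoined.\<close>

definition regular_functions :: "'n::finite rep set \<Rightarrow> ('n rep \<Rightarrow> complex) set" where
  "regular_functions X = {restrict (\<lambda>\<rho>. mpoly_eval (entry \<rho>) p) X |p. True}"

definition conjugate :: "complex^'n^'n \<Rightarrow> 'n rep \<Rightarrow> 'n::finite rep" where
  "conjugate g \<rho> = (g ** fst \<rho> ** matrix_inv g, g ** snd \<rho> ** matrix_inv g)"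

text \<open>The coordinate ring of the categorical quotient of \<open>G \<times> G\<close> by simultaneous conjugation, that is,
  the ring of conjugation invariant regular functions on \<open>G \<times> G\<close>.\<close>

definition character_ring :: "(complex^'n^'n) set \<Rightarrow> ('n::finite rep \<Rightarrow> complex) ring" where
  "character_ring G =
     \<lparr> carrier = {f \<in> regular_functions (G \<times> G).
                    \<forall>g\<in>G. \<forall>\<rho>\<in>G \<times> G. f (conjugate g \<rho>) = f \<rho>},
       mult = (\<lambda>f h. restrict (\<lambda>\<rho>. f \<rho> * h \<rho>) (G \<times> G)),
       one = restrict (\<lambda>\<rho>. 1) (G \<times> G),
       zero = restrict (\<lambda>\<rho>. 0) (G \<times> G),
       add = (\<lambda>f h. restrict (\<lambda>\<rho>. f \<rho> + h \<rho>) (G \<times> G)) \<rparr>"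

definition SL2 :: "(complex^2^2) set" where
  "SL2 = {A. det A = 1}"

definition SO4 :: "(complex^4^4) set" where
  "SO4 = {M. rotation_matrix M}"

text \<open>\<open>\<complex>\<^sup>2 \<otimes> \<complex>\<^sup>2\<close> is \<open>complex^(2 \<times> 2)\<close>, with \<open>e\<^sub>i \<otimes> e\<^sub>j\<close> the standard basis vector at \<open>(i, j)\<close>.\<close>

definition tensor :: "complex^2 \<Rightarrow> complex^2 \<Rightarrow> complex^(2 \<times> 2)" where
  "tensor u v = (\<chi> p. u $ fst p * v $ snd p)"

definition kronecker :: "complex^2^2 \<Rightarrow> complex^2^2 \<Rightarrow> complex^(2 \<times> 2)^(2 \<times> 2)" where
  "kronecker A B = (\<chi> p q. A $ fst p $ fst q * B $ snd p $ snd q)"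

lemma sum_2x2:
  fixes f :: "2 \<times> 2 \<Rightarrow> 'a::comm_monoid_add"
  shows "(\<Sum>p\<in>UNIV. f p) = f (1, 1) + f (1, 2) + (f (2, 1) + f (2, 2))"
proof -
  have "(\<Sum>p\<in>UNIV. f p) = (\<Sum>i\<in>UNIV. \<Sum>j\<in>UNIV. f (i, j))"
    by (simp add: sum.cartesian_product)
  then show ?thesis
    by (simp add: sum_2)
qed

lemma kronecker_tensor: "kronecker A B *v tensor u v = tensor (A *v u) (B *v v)"
  by (simp add: vec_eq_iff kronecker_def tensor_def matrix_vector_mult_def
      sum_2x2 sum_2 algebra_simps)

definition det2 :: "complex^2 \<Rightarrow> complex^2 \<Rightarrow> complex" where
  "det2 u v = det (vector [u, v] :: complex^2^2)"

lemma det2_eq: "det2 u v = u $ 1 * v $ 2 - u $ 2 * v $ 1"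
  by (simp add: det2_def det_2)

definition tensor_form :: "complex^(2 \<times> 2) \<Rightarrow> complex^(2 \<times> 2) \<Rightarrow> complex" where
  "tensor_form x y =
     (\<Sum>p\<in>UNIV. \<Sum>q\<in>UNIV. x $ p * y $ q *
        (det2 (axis (fst p) 1) (axis (fst q) 1) * det2 (axis (snd p) 1) (axis (snd q) 1)))"

lemma tensor_form_eq:
  "tensor_form x y =
     x $ (1, 1) * y $ (2, 2) - x $ (1, 2) * y $ (2, 1)
     - x $ (2, 1) * y $ (1, 2) + x $ (2, 2) * y $ (1, 1)"
  by (simp add: tensor_form_def det2_eq axis_def sum_2x2)

lemma tensor_form_tensor:
  "tensor_form (tensor u1 u2) (tensor v1 v2) = det2 u1 v1 * det2 u2 v2"
  by (simp add: tensor_form_eq tensor_def det2_eq algebra_simps)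

text \<open>\<open>P\<close> identifies \<open>\<complex>\<^sup>4\<close>, with the standard symmetric form \<open>\<Sum> x\<^sub>i y\<^sub>i\<close>, with \<open>\<complex>\<^sup>2 \<otimes> \<complex>\<^sup>2\<close>:
  the columns of \<open>P\<close> are an orthonormal basis.\<close>

definition tensor_isometry :: "complex^4^(2 \<times> 2) \<Rightarrow> bool" where
  "tensor_isometry P \<longleftrightarrow>
     (\<forall>x y. tensor_form (P *v x) (P *v y) = (\<Sum>i\<in>UNIV. x $ i * y $ i))"

lemma tensor_isometry_exists: "\<exists>P. tensor_isometry P"
proof -
  define s :: complex where "s = complex_of_real (1 / sqrt 2)"
  have s: "s * s = 1 / 2"
    by (simp add: s_def flip: of_real_mult)
  define P :: "complex^4^(2 \<times> 2)" where
    "P = (\<chi> p. s *s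
       (if p = (1, 1) then vector [1, \<i>, 0, 0]
        else if p = (1, 2) then vector [0, 0, 1, \<i>]
        else if p = (2, 1) then vector [0, 0, - 1, \<i>]
        else vector [1, - \<i>, 0, 0]))"
  have v4: "(vector [a, b, c, d] :: complex^4) $ 1 = a"
    "(vector [a, b, c, d] :: complex^4) $ 2 = b"
    "(vector [a, b, c, d] :: complex^4) $ 3 = c"
    "(vector [a, b, c, d] :: complex^4) $ 4 = d" for a b c d
    by (simp_all add: vector_def)
  have "tensor_form (P *v x) (P *v y) = 2 * (s * s) * (\<Sum>i\<in>UNIV. x $ i * y $ i)" for x y
    by (simp add: tensor_form_eq P_def matrix_vector_mult_def sum_4 v4 algebra_simps)
  then show ?thesis
    unfolding tensor_isometry_def s by auto
qed

definition tensor_hom :: "complex^4^(2 \<times> 2) \<Rightarrow> complex^2^2 \<Rightarrow> complex^2^2 \<Rightarrow> complex^4^4" where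
  "tensor_hom P A B = matrix_inv P ** kronecker A B ** P"

text \<open>The representation into SO(4) induced by a pair \<open>(\<rho> 1, \<rho> 2)\<close> of representations into SL(2);
  only the values of \<open>\<rho>\<close> at \<open>1\<close> and \<open>2\<close> matter.\<close>

definition induced_rep :: "complex^4^(2 \<times> 2) \<Rightarrow> (nat \<Rightarrow> 2 rep) \<Rightarrow> 4 rep" where
  "induced_rep P \<rho> =
     (tensor_hom P (fst (\<rho> 1)) (fst (\<rho> 2)), tensor_hom P (snd (\<rho> 1)) (snd (\<rho> 2)))"

definition tau :: "nat \<Rightarrow> 2 rep \<Rightarrow> complex" where
  "tau i \<rho> = (if i = 1 then trace (fst \<rho>) else trace (snd \<rho>))"

definition tau12 :: "2 rep \<Rightarrow> complex" where
  "tau12 \<rho> = trace (fst \<rho> ** snd \<rho>)"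

datatype gen = Gen_a nat nat nat | Gen_b nat nat | Gen_c nat nat nat

definition gens :: "gen set" where
  "gens = {Gen_a i j k |i j k. i \<in> {1, 2} \<and> j \<in> {1, 2} \<and> k \<in> {1, 2} \<and> j \<le> k}
        \<union> {Gen_b j k |j k. j \<in> {1, 2} \<and> k \<in> {1, 2} \<and> j \<le> k}
        \<union> {Gen_c i j k |i j k. i \<in> {1, 2} \<and> j \<in> {1, 2} \<and> k \<in> {1, 2}}"

lemma card_gens: "card gens = 17"
proof -
  have *: "gens = {Gen_a 1 1 1, Gen_a 1 1 2, Gen_a 1 2 2, Gen_a 2 1 1, Gen_a 2 1 2, Gen_a 2 2 2,
      Gen_b 1 1, Gen_b 1 2, Gen_b 2 2,
      Gen_c 1 1 1, Gen_c 1 1 2, Gen_c 1 2 1, Gen_c 1 2 2,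
      Gen_c 2 1 1, Gen_c 2 1 2, Gen_c 2 2 1, Gen_c 2 2 2}"
    by (auto simp: gens_def)
  show ?thesis unfolding * by simp
qed

fun gen_value :: "gen \<Rightarrow> (nat \<Rightarrow> 2 rep) \<Rightarrow> complex" where
  "gen_value (Gen_a i j k) \<rho> = tau i (\<rho> j) * tau i (\<rho> k)"
| "gen_value (Gen_b j k) \<rho> = tau12 (\<rho> j) * tau12 (\<rho> k)"
| "gen_value (Gen_c i j k) \<rho> = tau 1 (\<rho> i) * tau 2 (\<rho> j) * tau12 (\<rho> k)"

text \<open>The use of \<open>min\<close> and \<open>max\<close> encodes \<open>a\<^sub>i\<^sub>,\<^sub>2\<^sub>,\<^sub>1 = a\<^sub>i\<^sub>,\<^sub>1\<^sub>,\<^sub>2\<close> and \<open>b\<^sub>2\<^sub>,\<^sub>1 = b\<^sub>1\<^sub>,\<^sub>2\<close>.\<close>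

definition var_a :: "nat \<Rightarrow> nat \<Rightarrow> nat \<Rightarrow> (gen, complex) mpoly" where
  "var_a i j k = Var (Gen_a i (min j k) (max j k))"

definition var_b :: "nat \<Rightarrow> nat \<Rightarrow> (gen, complex) mpoly" where
  "var_b j k = Var (Gen_b (min j k) (max j k))"

definition var_c :: "nat \<Rightarrow> nat \<Rightarrow> nat \<Rightarrow> (gen, complex) mpoly" where
  "var_c i j k = Var (Gen_c i j k)"

definition relations :: "(gen, complex) mpoly set" where
  "relations =
     (\<Union>i\<in>{1, 2}. \<Union>j\<in>{1, 2}. \<Union>k\<in>{1, 2}. \<Union>i'\<in>{1, 2}. \<Union>j'\<in>{1, 2}. \<Union>k'\<in>{1, 2}.
       {var_a i j k * var_a i j' k' - var_a i j j' * var_a i k k',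
        var_b j k * var_b j' k' - var_b j j' * var_b k k',
        var_c i j k * var_c i' j' k' - var_a 1 i i' * var_a 2 j j' * var_b k k',
        var_a 1 j k * var_c i j' k' - var_a 1 i k * var_c j j' k',
        var_a 2 j k * var_c i j' k' - var_a 2 j' k * var_c i j k',
        var_b j k * var_c i j' k' - var_b j k' * var_c i j' k})"

definition relation_ideal :: "(gen, complex) mpoly set" where
  "relation_ideal = Idl\<^bsub>mpoly_ring gens\<^esub> relations"

end

theory Submission
  imports Defs "HOL-Library.Multiset" "HOL-Computational_Algebra.Polynomial"
begin

text \<open>
  Write \<open>(A\<^sub>j, B\<^sub>j)\<close>, \<open>j = 1, 2\<close>, for two pairs of matrices in SL(2), and
  \<open>x\<^sub>j = tr A\<^sub>j\<close>, \<open>y\<^sub>j = tr B\<^sub>j\<close>, \<open>z\<^sub>j = tr (A\<^sub>j B\<^sub>j)\<close>.  Every pair of matrices in SO(4) has the form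
  \<open>(A\<^sub>1 \<otimes> A\<^sub>2, B\<^sub>1 \<otimes> B\<^sub>2)\<close> in a suitable basis (\<open>tensor_hom_surj\<close>).  So an invariant function on pairs in
  SO(4) becomes a polynomial in the entries of \<open>A\<^sub>1, B\<^sub>1, A\<^sub>2, B\<^sub>2\<close> that is invariant under conjugation of
  each pair \<open>(A\<^sub>j, B\<^sub>j)\<close> and under \<open>A\<^sub>j \<mapsto> \<epsilon>\<^sub>1 A\<^sub>j\<close>, \<open>B\<^sub>j \<mapsto> \<epsilon>\<^sub>2 B\<^sub>j\<close> for signs \<open>\<epsilon>\<^sub>1, \<epsilon>\<^sub>2\<close> common to both \<open>j\<close>.
  The theorem follows from three facts about such polynomials.

  \<^item> They are polynomials in \<open>x\<^sub>1, y\<^sub>1, z\<^sub>1, x\<^sub>2, y\<^sub>2, z\<^sub>2\<close>.  For a single pair this is a theorem of Fricke and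
    Vogt.  A generic pair is conjugate to the normal form \<open>vogt_pair x y z \<zeta>\<close> for \<^emph>\<open>either\<close> root \<open>\<zeta>\<close> of
    \<open>\<zeta>\<^sup>2 + z \<zeta> + 1\<close>.  On the normal form a polynomial in the entries reduces to \<open>U + V \<zeta>\<close> with \<open>U\<close>, \<open>V\<close>
    polynomials in \<open>x, y, z\<close>, and as an invariant takes the same value for both roots, \<open>V\<close> vanishes
    there.  Since the variety of pairs is irreducible, the invariant equals \<open>U\<close> everywhere.  Proved
    with additional parameters (\<open>fricke_vogt\<close>), this can be applied to one factor after the other
    (\<open>fricke_vogt_product\<close>).

  \<^item> A polynomial in the six traces is invariant under the signs iff it only contains monomials
    whose degrees in the \<open>x\<^sub>j\<close>, in the \<open>y\<^sub>j\<close> and in the \<open>z\<^sub>j\<close> have the same parity.  If the three degrees are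
    even, the monomial is a product of images of generators \<open>a\<close> and \<open>b\<close>; if they are odd, one
    factor \<open>c\<close> is needed in addition (\<open>sign_invariants\<close>).

  \<^item> The relations say that indices of the same letter may be exchanged between generators, and that
    a product of two generators \<open>c\<close> can be rewritten by \<open>a\<close> and \<open>b\<close>.  So modulo the ideal a monomial in
    the generators is equal to a normal form that depends only on the multisets of indices, that
    is, on its image.  Different images are different monomials in the traces, hence linearly
    independent as functions, and the ideal is the whole kernel (\<open>kernel_eq_relation_ideal\<close>).

  Conversely the images of the generators are regular functions on pairs in SO(4): by \<open>det A\<^sub>2 = 1\<close>, a product of
  two entries of \<open>A\<^sub>1\<close> is a quadratic polynomial in the entries of \<open>A\<^sub>1 \<otimes> A\<^sub>2\<close> (\<open>gen_value_descends\<close>).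
\<close>

section \<open>Polynomials and their evaluation\<close>

lemma mpoly_eval_superset:
  assumes "finite K" "Poly_Mapping.keys p \<subseteq> K"
  shows "mpoly_eval x p = (\<Sum>m\<in>K. Poly_Mapping.lookup p m *
            (\<Prod>v\<in>Poly_Mapping.keys m. x v ^ Poly_Mapping.lookup m v))"
  unfolding mpoly_eval_def
  by (rule sum.mono_neutral_left) (use assms in \<open>auto simp: in_keys_iff\<close>)

lemma mpoly_eval_add: "mpoly_eval x (p + q) = mpoly_eval x p + mpoly_eval x q"
proof -
  let ?K = "Poly_Mapping.keys p \<union> Poly_Mapping.keys q"
  have "Poly_Mapping.keys (p + q) \<subseteq> ?K"
    by (rule keys_add)
  then show ?thesis
    by (simp add: mpoly_eval_superset[of ?K] lookup_add algebra_simps sum.distrib)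
qed

lemma mpoly_eval_0 [simp]: "mpoly_eval x 0 = 0"
  by (simp add: mpoly_eval_def)

lemma mpoly_eval_sum: "mpoly_eval x (\<Sum>i\<in>I. p i) = (\<Sum>i\<in>I. mpoly_eval x (p i))"
  by (induction I rule: infinite_finite_induct) (auto simp: mpoly_eval_add)

definition monom_eval :: "('v \<Rightarrow> 'a::comm_semiring_1) \<Rightarrow> ('v \<Rightarrow>\<^sub>0 nat) \<Rightarrow> 'a" where
  "monom_eval x m = (\<Prod>v\<in>Poly_Mapping.keys m. x v ^ Poly_Mapping.lookup m v)"

lemma monom_eval_superset:
  assumes "finite K" "Poly_Mapping.keys m \<subseteq> K"
  shows "monom_eval x m = (\<Prod>v\<in>K. x v ^ Poly_Mapping.lookup m v)"
  unfolding monom_eval_def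
  by (rule prod.mono_neutral_left) (use assms in \<open>auto simp: in_keys_iff\<close>)

lemma monom_eval_add: "monom_eval x (m + n) = monom_eval x m * monom_eval x n"
proof -
  let ?K = "Poly_Mapping.keys m \<union> Poly_Mapping.keys n"
  have "Poly_Mapping.keys (m + n) \<subseteq> ?K"
    by (rule keys_add)
  then show ?thesis
    by (simp add: monom_eval_superset[of ?K] lookup_add power_add prod.distrib)
qed

lemma mpoly_eval_single:
  "mpoly_eval x (Poly_Mapping.single m c) = c * monom_eval x m"
  by (simp add: mpoly_eval_def monom_eval_def)

lemma sum_monomials:
  fixes p :: "'b \<Rightarrow>\<^sub>0 'a::comm_monoid_add"
  shows "p = (\<Sum>m\<in>Poly_Mapping.keys p. Poly_Mapping.single m (Poly_Mapping.lookup p m))"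
proof (rule poly_mapping_eqI)
  fix k
  show "Poly_Mapping.lookup p k = Poly_Mapping.lookup
      (\<Sum>m\<in>Poly_Mapping.keys p. Poly_Mapping.single m (Poly_Mapping.lookup p m)) k"
    by (cases "k \<in> Poly_Mapping.keys p")
      (auto simp: lookup_sum lookup_single when_def in_keys_iff)
qed

lemma mpoly_eval_mult: "mpoly_eval x (p * q) = mpoly_eval x p * mpoly_eval x q"
proof -
  have "p * q = (\<Sum>m\<in>Poly_Mapping.keys p. \<Sum>n\<in>Poly_Mapping.keys q.
      Poly_Mapping.single (m + n) (Poly_Mapping.lookup p m * Poly_Mapping.lookup q n))"
    by (subst sum_monomials[of p], subst sum_monomials[of q])
      (simp add: sum_product mult_single)
  then have "mpoly_eval x (p * q) = (\<Sum>m\<in>Poly_Mapping.keys p. \<Sum>n\<in>Poly_Mapping.keys q.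
      (Poly_Mapping.lookup p m * monom_eval x m) * (Poly_Mapping.lookup q n * monom_eval x n))"
    by (simp add: mpoly_eval_sum mpoly_eval_single monom_eval_add ac_simps)
  also have "\<dots> = mpoly_eval x p * mpoly_eval x q"
    by (simp add: sum_product mpoly_eval_def monom_eval_def)
  finally show ?thesis .
qed

lemma mpoly_eval_Const [simp]: "mpoly_eval x (Const c) = c"
  by (simp add: Const_def mpoly_eval_single monom_eval_def)

lemma mpoly_eval_Var [simp]: "mpoly_eval x (Var v) = x v"
  by (simp add: Var_def mpoly_eval_single monom_eval_def)

lemma Const_1: "Const 1 = 1"
  by (simp add: Const_def)

lemma mpoly_eval_1 [simp]: "mpoly_eval x 1 = 1"
  using mpoly_eval_Const[of x 1] by (simp add: Const_1)

lemma mpoly_eval_uminus: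
  "mpoly_eval x (- p) = - mpoly_eval x (p :: ('v, 'a::comm_ring_1) mpoly)"
  using mpoly_eval_add[of x p "- p"] by (simp add: eq_neg_iff_add_eq_0 add.commute)

lemma mpoly_eval_diff:
  "mpoly_eval x (p - q) = mpoly_eval x p - mpoly_eval x (q :: ('v, 'a::comm_ring_1) mpoly)"
  using mpoly_eval_add[of x p "- q"] by (simp add: mpoly_eval_uminus)

abbreviation polys_in :: "'v set \<Rightarrow> ('v, 'a::comm_ring_1) mpoly set" where
  "polys_in V \<equiv> carrier (mpoly_ring V)"

lemma polys_in_iff: "p \<in> polys_in V \<longleftrightarrow> (\<forall>m\<in>Poly_Mapping.keys p. Poly_Mapping.keys m \<subseteq> V)"
  by (simp add: mpoly_ring_def)

lemma polys_in_add: "p \<in> polys_in V \<Longrightarrow> q \<in> polys_in V \<Longrightarrow> p + q \<in> polys_in V"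
  using keys_add[of p q] by (auto simp: polys_in_iff)

lemma polys_in_uminus: "p \<in> polys_in V \<Longrightarrow> - p \<in> polys_in V"
  by (auto simp: polys_in_iff)

lemma polys_in_diff: "p \<in> polys_in V \<Longrightarrow> q \<in> polys_in V \<Longrightarrow> p - q \<in> polys_in V"
  using polys_in_add[of p V "- q"] polys_in_uminus[of q V] by simp

lemma polys_in_mult: "p \<in> polys_in V \<Longrightarrow> q \<in> polys_in V \<Longrightarrow> p * q \<in> polys_in V"
proof -
  assume pq: "p \<in> polys_in V" "q \<in> polys_in V"
  show ?thesis
    unfolding polys_in_iff
  proof
    fix k assume "k \<in> Poly_Mapping.keys (p * q)"
    then obtain m n where "m \<in> Poly_Mapping.keys p" "n \<in> Poly_Mapping.keys q" "k = m + n"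
      using keys_mult[of p q] by auto
    then show "Poly_Mapping.keys k \<subseteq> V"
      using pq keys_add[of m n] unfolding polys_in_iff by blast
  qed
qed

lemma polys_in_Const [simp]: "Const c \<in> polys_in V"
  by (simp add: polys_in_iff Const_def)

lemma polys_in_Var: "v \<in> V \<Longrightarrow> Var v \<in> polys_in V"
  by (auto simp: polys_in_iff Var_def)

lemma polys_in_0 [simp]: "0 \<in> polys_in V"
  by (simp add: polys_in_iff)

lemma polys_in_1 [simp]: "1 \<in> polys_in V"
  by (simp add: polys_in_iff)

text \<open>Induction over monomials as products of variables, by the total degree.\<close>

lemma monomial_induct [consumes 1, case_names one Var]:
  fixes m :: "'v \<Rightarrow>\<^sub>0 nat"
  assumes "Poly_Mapping.keys m \<subseteq> V"
    and one: "Q (1 :: ('v, 'a::comm_ring_1) mpoly)"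
    and Var: "\<And>v p. v \<in> V \<Longrightarrow> Q p \<Longrightarrow> Q (Var v * p)"
  shows "Q (Poly_Mapping.single m 1)"
proof -
  have "d = (\<Sum>v\<in>Poly_Mapping.keys m. Poly_Mapping.lookup m v) \<Longrightarrow> Poly_Mapping.keys m \<subseteq> V
        \<Longrightarrow> Q (Poly_Mapping.single m 1)" for d
  proof (induction d arbitrary: m)
    case 0
    then have "m = 0"
      by (intro poly_mapping_eqI) (auto simp: in_keys_iff)
    then show ?case using one by simp
  next
    case (Suc d)
    then obtain v where v: "v \<in> Poly_Mapping.keys m"
      by (metis all_not_in_conv nat.distinct(1) sum.empty)
    define n where "n = m - Poly_Mapping.single v 1"
    have m: "m = Poly_Mapping.single v 1 + n"
      using v by (intro poly_mapping_eqI)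
        (auto simp: n_def lookup_add lookup_minus lookup_single when_def in_keys_iff)
    have sub: "Poly_Mapping.keys n \<subseteq> Poly_Mapping.keys m"
      by (auto simp: n_def lookup_minus in_keys_iff)
    have "(\<Sum>v\<in>Poly_Mapping.keys n. Poly_Mapping.lookup n v)
        = (\<Sum>v\<in>Poly_Mapping.keys m. Poly_Mapping.lookup n v)"
      by (rule sum.mono_neutral_left) (use sub in \<open>auto simp: in_keys_iff\<close>)
    moreover have "Suc d = (\<Sum>w\<in>Poly_Mapping.keys m. (if w = v then 1 else 0) + Poly_Mapping.lookup n w)"
      unfolding Suc.prems(1)
      by (rule sum.cong) (auto simp: m lookup_add lookup_single when_def)
    then have "d = (\<Sum>v\<in>Poly_Mapping.keys m. Poly_Mapping.lookup n v)"
      using v by (simp add: sum.distrib)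
    ultimately have "Q (Poly_Mapping.single n 1)"
      using Suc.IH[of n] sub Suc.prems(2) by auto
    then have "Q (Var v * Poly_Mapping.single n 1)"
      using Var v Suc.prems(2) by blast
    then show ?case
      by (simp add: Var_def mult_single m)
  qed
  then show ?thesis
    using assms(1) by blast
qed

lemma single_eq_Const_mult:
  "Poly_Mapping.single m c = Const c * Poly_Mapping.single m (1::'a::comm_ring_1)"
  by (simp add: Const_def mult_single)

text \<open>The carrier of a polynomial ring is reached from constants and variables by ring operations, so a
statement that is compatible with these need not mention coefficients or exponents.\<close>

lemma polys_in_induct [consumes 1, case_names Const Var add mult]:
  fixes p :: "('v, 'a::comm_ring_1) mpoly"
  assumes p: "p \<in> polys_in V"
    and Const: "\<And>c. Q (Const c)" and Var: "\<And>v. v \<in> V \<Longrightarrow> Q (Var v)"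
    and add: "\<And>p q. Q p \<Longrightarrow> Q q \<Longrightarrow> Q (p + q)"
    and mult: "\<And>p q. Q p \<Longrightarrow> Q q \<Longrightarrow> Q (p * q)"
  shows "Q p"
proof -
  have zero: "Q 0"
    using Const[of 0] by (simp add: Const_def)
  have one: "Q 1"
    using Const[of 1] by (simp add: Const_1)
  have "Q (\<Sum>m\<in>K. Poly_Mapping.single m (Poly_Mapping.lookup p m))"
    if "K \<subseteq> Poly_Mapping.keys p" for K
    using finite_subset[OF that finite_keys] that
  proof (induction K rule: finite_induct)
    case empty
    show ?case using zero by simp
  next
    case (insert m K)
    have "Q (Poly_Mapping.single m 1)"
      by (rule monomial_induct[of m V]) (use p insert one mult Var in \<open>auto simp: polys_in_iff\<close>)
    then have "Q (Poly_Mapping.single m (Poly_Mapping.lookup p m))"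
      by (subst single_eq_Const_mult) (intro mult Const)
    then show ?case
      using insert by (simp add: add)
  qed
  then show ?thesis
    by (subst sum_monomials) auto
qed

lemma mpoly_ring_simps [simp]:
  "mult (mpoly_ring V) = (*)" "one (mpoly_ring V) = 1" "zero (mpoly_ring V) = 0"
  "add (mpoly_ring V) = (+)"
  by (simp_all add: mpoly_ring_def)

lemma cring_mpoly_ring: "cring (mpoly_ring V :: ('v, 'a::comm_ring_1) mpoly ring)"
proof (rule cringI)
  show "abelian_group (mpoly_ring V :: ('v, 'a) mpoly ring)"
  proof (rule abelian_groupI)
    fix p :: "('v, 'a) mpoly" assume "p \<in> polys_in V"
    then show "\<exists>q\<in>polys_in V. q \<oplus>\<^bsub>mpoly_ring V\<^esub> p = \<zero>\<^bsub>mpoly_ring V\<^esub>"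
      by (intro bexI[of _ "- p"]) (auto intro: polys_in_uminus)
  qed (auto intro: polys_in_add simp: algebra_simps)
  show "Group.comm_monoid (mpoly_ring V :: ('v, 'a) mpoly ring)"
    by (rule comm_monoidI) (auto intro: polys_in_mult simp: algebra_simps)
qed (auto simp: algebra_simps)

section \<open>Algebras of polynomial functions\<close>

text \<open>The algebra of functions generated by \<open>S\<close>.  Working with functions on an arbitrary set rather than
with formal polynomials makes substitutions ordinary compositions (\<open>alg_compose\<close>), and the set may
carry further parameters.\<close>

inductive_set alg :: "('x \<Rightarrow> complex) set \<Rightarrow> ('x \<Rightarrow> complex) set" for S where
  const: "(\<lambda>_. c) \<in> alg S"
| gen: "f \<in> S \<Longrightarrow> f \<in> alg S"
| add: "f \<in> alg S \<Longrightarrow> g \<in> alg S \<Longrightarrow> (\<lambda>x. f x + g x) \<in> alg S"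
| mult: "f \<in> alg S \<Longrightarrow> g \<in> alg S \<Longrightarrow> (\<lambda>x. f x * g x) \<in> alg S"

lemma alg_uminus: "f \<in> alg S \<Longrightarrow> (\<lambda>x. - f x) \<in> alg S"
  using alg.mult[OF alg.const[of "-1"]] by fastforce

lemma alg_diff: "f \<in> alg S \<Longrightarrow> g \<in> alg S \<Longrightarrow> (\<lambda>x. f x - g x) \<in> alg S"
  using alg.add[OF _ alg_uminus] by fastforce

lemmas alg_intros = alg.const alg.add alg.mult alg_uminus alg_diff

lemma alg_compose:
  assumes "f \<in> alg S" "\<And>s. s \<in> S \<Longrightarrow> (\<lambda>x. s (\<phi> x)) \<in> alg T"
  shows "(\<lambda>x. f (\<phi> x)) \<in> alg T"
  using assms(1) by induction (auto intro: alg_intros assms(2))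

lemma mpoly_eval_in_alg:
  assumes "p \<in> polys_in V" "\<And>v. v \<in> V \<Longrightarrow> (\<lambda>x. e x v) \<in> alg S"
  shows "(\<lambda>x. mpoly_eval (e x) p) \<in> alg S"
  using assms(1) by (induction rule: polys_in_induct)
   (auto intro: alg_intros assms(2) simp: mpoly_eval_add mpoly_eval_mult)

lemma alg_eq_mpoly_eval:
  assumes "f \<in> alg S" "\<And>s. s \<in> S \<Longrightarrow> \<exists>v\<in>V. s = (\<lambda>x. e x v)"
  shows "\<exists>p\<in>polys_in V. f = (\<lambda>x. mpoly_eval (e x) p)"
  using assms(1)
proof induction
  case (const c)
  show ?case by (intro bexI[of _ "Const c"]) auto
next
  case (gen f)
  then obtain v where "v \<in> V" "f = (\<lambda>x. e x v)" using assms(2) by blast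
  then show ?case by (intro bexI[of _ "Var v"]) (auto intro: polys_in_Var)
next
  case (add f g)
  then obtain p q where "p \<in> polys_in V" "q \<in> polys_in V" 
   "f = (\<lambda>x. mpoly_eval (e x) p)" "g = (\<lambda>x. mpoly_eval (e x) q)" by blast
  then show ?case by (intro bexI[of _ "p + q"]) (auto simp: mpoly_eval_add intro: polys_in_add)
next
  case (mult f g)
  then obtain p q where "p \<in> polys_in V" "q \<in> polys_in V" 
   "f = (\<lambda>x. mpoly_eval (e x) p)" "g = (\<lambda>x. mpoly_eval (e x) q)" by blast
  then show ?case by (intro bexI[of _ "p * q"]) (auto simp: mpoly_eval_mult intro: polys_in_mult)
qed

section \<open>The ideal of relations\<close>

lemma var_in_polys:
  "i \<in> {1, 2} \<Longrightarrow> j \<in> {1, 2} \<Longrightarrow> k \<in> {1, 2} \<Longrightarrow> var_a i j k \<in> polys_in gens"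
  "j \<in> {1, 2} \<Longrightarrow> k \<in> {1, 2} \<Longrightarrow> var_b j k \<in> polys_in gens"
  "i \<in> {1, 2} \<Longrightarrow> j \<in> {1, 2} \<Longrightarrow> k \<in> {1, 2} \<Longrightarrow> var_c i j k \<in> polys_in gens"
  unfolding var_a_def var_b_def var_c_def
  by (intro polys_in_Var; auto simp: gens_def)+

lemma relations_subset: "relations \<subseteq> polys_in gens"
  unfolding relations_def
  by (intro UN_least insert_subsetI empty_subsetI polys_in_diff polys_in_mult var_in_polys) simp_all

interpretation gens_ring: cring "mpoly_ring gens :: (gen, complex) mpoly ring"
  by (rule cring_mpoly_ring)

lemma ideal_relation_ideal: "ideal relation_ideal (mpoly_ring gens)"
  unfolding relation_ideal_def by (rule gens_ring.genideal_ideal[OF relations_subset])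

lemma relations_in_ideal: "r \<in> relations \<Longrightarrow> r \<in> relation_ideal"
  unfolding relation_ideal_def using gens_ring.genideal_self[OF relations_subset] by blast

lemma relation_ideal_add: "p \<in> relation_ideal \<Longrightarrow> q \<in> relation_ideal \<Longrightarrow> p + q \<in> relation_ideal"
  using additive_subgroup.a_closed[OF ideal.axioms(1)[OF ideal_relation_ideal]] by simp

lemma relation_ideal_mult: "p \<in> relation_ideal \<Longrightarrow> q \<in> polys_in gens \<Longrightarrow> q * p \<in> relation_ideal"
  using ideal.I_l_closed[OF ideal_relation_ideal] by simp

lemma relation_ideal_0: "0 \<in> relation_ideal"
  using additive_subgroup.zero_closed[OF ideal.axioms(1)[OF ideal_relation_ideal]] by simp

lemma relation_ideal_uminus:
  assumes "p \<in> relation_ideal" shows "- p \<in> relation_ideal"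
proof -
  have "Const (- 1) * p = - p"
    by (simp add: Const_def single_uminus)
  then show ?thesis
    using relation_ideal_mult[OF assms, of "Const (- 1)"] by simp
qed

definition rel_cong :: "(gen, complex) mpoly \<Rightarrow> (gen, complex) mpoly \<Rightarrow> bool" (infix \<open>\<asymp>\<close> 50) where
  "p \<asymp> q \<longleftrightarrow> p - q \<in> relation_ideal"

lemma rel_cong_refl [simp]: "p \<asymp> p"
  by (simp add: rel_cong_def relation_ideal_0)

lemma rel_cong_trans [trans]: "p \<asymp> q \<Longrightarrow> q \<asymp> r \<Longrightarrow> p \<asymp> r"
  using relation_ideal_add[of "p - q" "q - r"] by (simp add: rel_cong_def)

lemma rel_cong_mult_left: "p \<asymp> q \<Longrightarrow> r \<in> polys_in gens \<Longrightarrow> r * p \<asymp> r * q"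
  using relation_ideal_mult[of "p - q" r] by (simp add: rel_cong_def algebra_simps)

lemma rel_cong_add: "p \<asymp> q \<Longrightarrow> p' \<asymp> q' \<Longrightarrow> p + p' \<asymp> q + q'"
  using relation_ideal_add[of "p - q" "p' - q'"] by (simp add: rel_cong_def algebra_simps)

lemma rel_cong_sum: "(\<And>i. i \<in> K \<Longrightarrow> f i \<asymp> g i) \<Longrightarrow> (\<Sum>i\<in>K. f i) \<asymp> (\<Sum>i\<in>K. g i)"
  by (induction K rule: infinite_finite_induct) (auto intro: rel_cong_add)

lemma toric_relations:
  assumes "i \<in> {1, 2}" "j \<in> {1, 2}" "k \<in> {1, 2}" "i' \<in> {1, 2}" "j' \<in> {1, 2}" "k' \<in> {1, 2}"
  shows "var_a i j k * var_a i j' k' \<asymp> var_a i j j' * var_a i k k'"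
    and "var_b j k * var_b j' k' \<asymp> var_b j j' * var_b k k'"
    and "var_c i j k * var_c i' j' k' \<asymp> var_a 1 i i' * var_a 2 j j' * var_b k k'"
    and "var_a 1 j k * var_c i j' k' \<asymp> var_a 1 i k * var_c j j' k'"
    and "var_a 2 j k * var_c i j' k' \<asymp> var_a 2 j' k * var_c i j k'"
    and "var_b j k * var_c i j' k' \<asymp> var_b j k' * var_c i j' k"
  unfolding rel_cong_def
  by (rule relations_in_ideal, unfold relations_def,
      rule UN_I[OF assms(1)], rule UN_I[OF assms(2)], rule UN_I[OF assms(3)],
      rule UN_I[OF assms(4)], rule UN_I[OF assms(5)], rule UN_I[OF assms(6)], blast)+

lemma var_commute: "var_a i j k = var_a i k j" "var_b j k = var_b k j"
  by (simp_all add: var_a_def var_b_def min.commute max.commute)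

text \<open>A word \<open>js\<close> of indices belonging to one of the three letters is read off in consecutive pairs, each
contributing a generator \<open>a j k\<close>; what remains is one index \<open>j\<close>, entering through \<open>d j\<close>, or
nothing, entering through \<open>e\<close>.  Nesting three of these for the three letters gives \<open>normal_form\<close>.\<close>

fun chain :: "(nat \<Rightarrow> nat \<Rightarrow> 'r::comm_monoid_mult) \<Rightarrow> (nat \<Rightarrow> 'r) \<Rightarrow> 'r \<Rightarrow> nat list \<Rightarrow> 'r" where
  "chain a d e (j # k # js) = a j k * chain a d e js"
| "chain a d e [j] = d j"
| "chain a d e [] = e"

lemma chain_mult: "x * chain a d e js = chain a (\<lambda>j. x * d j) (x * e) js"
  by (induction a d e js rule: chain.induct) (simp, metis mult.left_commute, simp_all)

lemma chain_append_even:
  "even (length js) \<Longrightarrow> chain a d e (js @ ks) = chain a (\<lambda>_. 1) 1 js * chain a d e ks"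
  by (induction a "\<lambda>_::nat. 1 :: 'a" "1 :: 'a" js rule: chain.induct) (simp_all add: mult.assoc)

lemma chain_in_polys:
  assumes "set js \<subseteq> {1, 2}" "\<And>j k. j \<in> {1, 2} \<Longrightarrow> k \<in> {1, 2} \<Longrightarrow> a j k \<in> polys_in gens"
    and "\<And>j. j \<in> {1, 2} \<Longrightarrow> d j \<in> polys_in gens" "e \<in> polys_in gens"
  shows "chain a d e js \<in> polys_in gens"
  using assms by (induction a d e js rule: chain.induct) (auto intro!: polys_in_mult)

lemma chain_cong:
  assumes "set js \<subseteq> {1, 2}" "\<And>j k. j \<in> {1, 2} \<Longrightarrow> k \<in> {1, 2} \<Longrightarrow> a j k \<in> polys_in gens"
    and "\<And>j. j \<in> {1, 2} \<Longrightarrow> d j \<asymp> d' j" "e \<asymp> e'"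
  shows "chain a d e js \<asymp> chain a d' e' js"
  using assms by (induction a d e js rule: chain.induct) (auto intro!: rel_cong_mult_left)

text \<open>Two neighbouring indices of the word lie in the same pair, in consecutive pairs, or in the last pair and
the remainder.  The symmetry of \<open>a\<close>, the relation \<open>aa\<close> and the relation \<open>ad\<close> respectively allow to
exchange them.\<close>

lemma chain_swap:
  assumes "set (us @ x # y # vs) \<subseteq> {1, 2}"
    and a: "\<And>j k. j \<in> {1, 2} \<Longrightarrow> k \<in> {1, 2} \<Longrightarrow> a j k \<in> polys_in gens"
    and d: "\<And>j. j \<in> {1, 2} \<Longrightarrow> d j \<in> polys_in gens" and e: "e \<in> polys_in gens"
    and sym: "\<And>j k. a j k = a k j"
    and aa: "\<And>j k l m. j \<in> {1, 2} \<Longrightarrow> k \<in> {1, 2} \<Longrightarrow> l \<in> {1, 2} \<Longrightarrow> m \<in> {1, 2}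
        \<Longrightarrow> a j k * a l m \<asymp> a j l * a k m"
    and ad: "\<And>j k l. j \<in> {1, 2} \<Longrightarrow> k \<in> {1, 2} \<Longrightarrow> l \<in> {1, 2} \<Longrightarrow> a j k * d l \<asymp> a j l * d k"
  shows "chain a d e (us @ x # y # vs) \<asymp> chain a d e (us @ y # x # vs)"
  using assms(1)
proof (induction "length us" arbitrary: us rule: less_induct)
  case less
  consider "us = []" | u where "us = [u]" | u v us' where "us = u # v # us'"
    by (metis list.exhaust)
  then show ?case
  proof cases
    case 1
    then show ?thesis by (simp add: sym[of x y])
  next
    case 2
    show ?thesis
    proof (cases vs)
      case Nil
      then show ?thesis using 2 less.prems by (auto intro!: ad)
    next
      case (Cons v vs')
      have "chain a d e vs' \<in> polys_in gens"
        using less.prems Cons by (intro chain_in_polys a d e) auto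
      moreover have "a u x * a y v \<asymp> a u y * a x v"
        using less.prems 2 Cons by (intro aa) auto
      ultimately have "chain a d e vs' * (a u x * a y v) \<asymp> chain a d e vs' * (a u y * a x v)"
        by (intro rel_cong_mult_left)
      then show ?thesis
        by (simp add: 2 Cons ac_simps)
    qed
  next
    case 3
    then show ?thesis
      using less by (auto intro!: rel_cong_mult_left a)
  qed
qed

text \<open>Rearrangements are generated by transpositions of neighbours.\<close>

lemma mset_eq_swap_induct:
  assumes "mset xs = mset ys" "set xs \<subseteq> V"
    and refl: "\<And>xs. R xs xs" and trans: "\<And>xs ys zs. R xs ys \<Longrightarrow> R ys zs \<Longrightarrow> R xs zs"
    and swap: "\<And>us x y vs. set (us @ x # y # vs) \<subseteq> V \<Longrightarrow> R (us @ x # y # vs) (us @ y # x # vs)"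
  shows "R xs ys"
proof -
  have "R (ws @ xs) (ws @ ys)" if "mset xs = mset ys" "set (ws @ xs) \<subseteq> V" for ws
    using that
  proof (induction xs arbitrary: ws ys)
    case Nil
    then show ?case by (simp add: refl)
  next
    case (Cons x xs)
    then have "x \<in> set ys"
      by (metis list.set_intros(1) mset_eq_setD)
    then obtain us vs where ys: "ys = us @ x # vs"
      by (meson split_list)
    have m: "mset xs = mset (us @ vs)"
      using Cons.prems(1) by (simp add: ys)
    have s: "set ys \<subseteq> V"
      using Cons.prems mset_eq_setD[OF Cons.prems(1)] by auto
    have "R (ws @ x # xs) (ws @ x # us @ vs)"
      using Cons.IH[OF m, of "ws @ [x]"] Cons.prems(2) by simp
    moreover have "R (ws @ x # us @ vs) (ws @ us @ x # vs)"
    proof -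
      have "R (ws @ x # us' @ vs) (ws @ us' @ x # vs)" if "set (ws @ x # us' @ vs) \<subseteq> V" for us'
        using that
      proof (induction us' arbitrary: vs rule: rev_induct)
        case Nil
        show ?case by (simp add: refl)
      next
        case (snoc u us)
        have "R (ws @ us @ x # u # vs) (ws @ us @ u # x # vs)"
          using swap[of "ws @ us" x u vs] snoc.prems by simp
        moreover have "R (ws @ x # us @ u # vs) (ws @ us @ x # u # vs)"
          using snoc.IH[of "u # vs"] snoc.prems by auto
        ultimately show ?case
          using trans by simp
      qed
      then show ?thesis
        using s Cons.prems(2) ys by auto
    qed
    ultimately show ?case
      using trans ys by blast
  qed
  from this[of "[]"] show ?thesis
    using assms(1,2) by simp
qed

text \<open>The words \<open>js\<close>, \<open>ks\<close>, \<open>ls\<close> list the indices of the factors \<open>\<tau>\<^sub>1\<close>, \<open>\<tau>\<^sub>2\<close>, \<open>\<tau>\<^sub>1\<^sub>2\<close> of a product of traces; the three indices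
left over from words of odd length form one generator \<open>c\<close>.  Words of lengths of
different parity, which do not come from monomials in the generators, get the value \<open>0\<close>.\<close>

definition normal_form :: "nat list \<Rightarrow> nat list \<Rightarrow> nat list \<Rightarrow> (gen, complex) mpoly" where
  "normal_form js ks ls =
     chain (var_a 1)
       (\<lambda>j. chain (var_a 2) (\<lambda>k. chain var_b (\<lambda>l. var_c j k l) 0 ls) 0 ks)
       (chain (var_a 2) (\<lambda>_. 0) (chain var_b (\<lambda>_. 0) 1 ls) ks) js"

lemma normal_form_in_polys:
  assumes "set js \<subseteq> {1, 2}" "set ks \<subseteq> {1, 2}" "set ls \<subseteq> {1, 2}"
  shows "normal_form js ks ls \<in> polys_in gens"
  unfolding normal_form_def
  by (intro chain_in_polys assms var_in_polys polys_in_0 polys_in_1) auto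

lemma chain_perm:
  assumes "mset js = mset js'" "set js \<subseteq> {1, 2}"
    and a: "\<And>j k. j \<in> {1, 2} \<Longrightarrow> k \<in> {1, 2} \<Longrightarrow> a j k \<in> polys_in gens"
    and d: "\<And>j. j \<in> {1, 2} \<Longrightarrow> d j \<in> polys_in gens" and e: "e \<in> polys_in gens"
    and sym: "\<And>j k. a j k = a k j"
    and aa: "\<And>j k l m. j \<in> {1, 2} \<Longrightarrow> k \<in> {1, 2} \<Longrightarrow> l \<in> {1, 2} \<Longrightarrow> m \<in> {1, 2}
        \<Longrightarrow> a j k * a l m \<asymp> a j l * a k m"
    and ad: "\<And>j k l. j \<in> {1, 2} \<Longrightarrow> k \<in> {1, 2} \<Longrightarrow> l \<in> {1, 2} \<Longrightarrow> a j k * d l \<asymp> a j l * d k"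
  shows "chain a d e js \<asymp> chain a d e js'"
proof (rule mset_eq_swap_induct[where R = "\<lambda>js js'. chain a d e js \<asymp> chain a d e js'"])
  show "chain a d e (us @ x # y # vs) \<asymp> chain a d e (us @ y # x # vs)"
    if "set (us @ x # y # vs) \<subseteq> {1, 2}" for us x y vs
    by (rule chain_swap) (fact that a d e sym aa ad)+
qed (fact assms rel_cong_refl rel_cong_trans)+

lemma normal_form_perm:
  assumes "mset js = mset js'" "mset ks = mset ks'" "mset ls = mset ls'"
    and s: "set js \<subseteq> {1, 2}" "set ks \<subseteq> {1, 2}" "set ls \<subseteq> {1, 2}"
  shows "normal_form js ks ls \<asymp> normal_form js' ks' ls'"
proof -
  have s': "set js' \<subseteq> {1, 2}" "set ks' \<subseteq> {1, 2}" "set ls' \<subseteq> {1, 2}"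
    using assms mset_eq_setD by metis+
  note closed = polys_in_0 polys_in_1 var_in_polys
  have "normal_form js ks ls \<asymp> normal_form js ks ls'"
    unfolding normal_form_def
    by (intro chain_cong chain_perm s assms closed var_commute rel_cong_refl toric_relations)
      auto
  also have "\<dots> \<asymp> normal_form js ks' ls'"
    unfolding normal_form_def
  proof (intro chain_cong chain_perm chain_in_polys s s' assms closed var_commute toric_relations)
    fix i j k l :: nat assume *: "i \<in> {1, 2}" "j \<in> {1, 2}" "k \<in> {1, 2}" "l \<in> {1, 2}"
    show "var_a 2 j k * chain var_b (var_c i l) 0 ls' \<asymp> var_a 2 j l * chain var_b (var_c i k) 0 ls'"
      unfolding chain_mult
      by (intro chain_cong s' closed) (use * toric_relations(5)[of i k j i l] in \<open>auto simp: var_commute\<close>)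
  qed auto
  also have "\<dots> \<asymp> normal_form js' ks' ls'"
    unfolding normal_form_def
  proof (intro chain_cong chain_perm chain_in_polys s s' assms closed var_commute toric_relations)
    fix j k l :: nat assume *: "j \<in> {1, 2}" "k \<in> {1, 2}" "l \<in> {1, 2}"
    show "var_a 1 j k * chain (var_a 2) (\<lambda>m. chain var_b (var_c l m) 0 ls') 0 ks'
       \<asymp> var_a 1 j l * chain (var_a 2) (\<lambda>m. chain var_b (var_c k m) 0 ls') 0 ks'"
      unfolding chain_mult
      by (intro chain_cong s' closed) (use * toric_relations(4)[of l k j] in \<open>auto simp: var_commute\<close>)
  qed auto
  finally show ?thesis .
qed

lemma normal_form_append_even:
  assumes "even (length js)" "even (length ks)" "even (length ls)"
  shows "normal_form (js @ js') (ks @ ks') (ls @ ls') =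
    normal_form js ks ls * normal_form js' ks' ls'"
proof -
  have ex: "\<exists>F. \<forall>a d e js'. chain a d e (js @ js') = F a * chain a d e js'" if "even (length js)"
    for js :: "nat list" and F :: "(nat \<Rightarrow> nat \<Rightarrow> (gen, complex) mpoly) \<Rightarrow> (gen, complex) mpoly"
    using chain_append_even[OF that] by (intro exI[of _ "\<lambda>a. chain a (\<lambda>_. 1) 1 js"]) blast
  obtain F1 :: "(nat \<Rightarrow> nat \<Rightarrow> (gen, complex) mpoly) \<Rightarrow> (gen, complex) mpoly"
    where F1: "\<And>a d e js'. chain a d e (js @ js') = F1 a * chain a d e js'"
    using ex[OF assms(1)] by blast
  obtain F2 :: "(nat \<Rightarrow> nat \<Rightarrow> (gen, complex) mpoly) \<Rightarrow> (gen, complex) mpoly"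
    where F2: "\<And>a d e js'. chain a d e (ks @ js') = F2 a * chain a d e js'"
    using ex[OF assms(2)] by blast
  obtain F3 :: "(nat \<Rightarrow> nat \<Rightarrow> (gen, complex) mpoly) \<Rightarrow> (gen, complex) mpoly"
    where F3: "\<And>a d e js'. chain a d e (ls @ js') = F3 a * chain a d e js'"
    using ex[OF assms(3)] by blast
  show ?thesis
    unfolding normal_form_def
    by (simp add: F1 F2 F3 F1[of _ _ _ "[]", simplified] F2[of _ _ _ "[]", simplified]
        F3[of _ _ _ "[]", simplified] chain_mult mult.assoc)
qed

text \<open>For words of odd length the normal form contains a generator \<open>c\<close> already, and the two are replaced by
\<open>a\<close>, \<open>a\<close>, \<open>b\<close> with the relation for \<open>c c\<close>.\<close>

lemma Gen_c_mult_normal_form: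
  assumes "even (length js) = even (length ks)" "even (length ks) = even (length ls)"
    and s: "set js \<subseteq> {1, 2}" "set ks \<subseteq> {1, 2}" "set ls \<subseteq> {1, 2}"
    and "i \<in> {1, 2}" "j \<in> {1, 2}" "k \<in> {1, 2}"
  shows "var_c i j k * normal_form js ks ls \<asymp> normal_form (js @ [i]) (ks @ [j]) (ls @ [k])"
proof (cases "even (length js)")
  case True
  then have "normal_form (js @ [i]) (ks @ [j]) (ls @ [k]) = normal_form js ks ls * normal_form [i] [j] [k]"
    using assms by (intro normal_form_append_even) auto
  then show ?thesis
    by (simp add: normal_form_def mult.commute)
next
  case False
  then obtain js0 i' ks0 j' ls0 k' where e: "js = js0 @ [i']" "ks = ks0 @ [j']" "ls = ls0 @ [k']"
    using assms by (metis even_zero list.size(3) rev_exhaust)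
  have ev: "even (length js0)" "even (length ks0)" "even (length ls0)"
    using False assms(1,2) by (auto simp: e)
  have "normal_form js ks ls = normal_form js0 ks0 ls0 * var_c i' j' k'"
    unfolding e using normal_form_append_even[OF ev, of "[i']" "[j']" "[k']"]
    by (simp add: normal_form_def)
  then have "var_c i j k * normal_form js ks ls = normal_form js0 ks0 ls0 * (var_c i' j' k' * var_c i j k)"
    by (simp add: ac_simps)
  also have "\<dots> \<asymp> normal_form js0 ks0 ls0 * (var_a 1 i' i * var_a 2 j' j * var_b k' k)"
    using s assms by (intro rel_cong_mult_left normal_form_in_polys toric_relations) (auto simp: e)
  also have "normal_form js0 ks0 ls0 * (var_a 1 i' i * var_a 2 j' j * var_b k' k)
      = normal_form (js @ [i]) (ks @ [j]) (ls @ [k])"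
    unfolding e using normal_form_append_even[OF ev, of "[i', i]" "[j', j]" "[k', k]"]
    by (simp add: normal_form_def ac_simps)
  finally show ?thesis .
qed

type_synonym trace_exponent = "nat multiset \<times> nat multiset \<times> nat multiset"

definition valid_exponents :: "trace_exponent set" where
  "valid_exponents = {(J, K, L). set_mset J \<subseteq> {1, 2} \<and> set_mset K \<subseteq> {1, 2} \<and> set_mset L \<subseteq> {1, 2} \<and>
     even (size J) = even (size K) \<and> even (size K) = even (size L)}"

definition normal_monom :: "trace_exponent \<Rightarrow> (gen, complex) mpoly" where
  "normal_monom = (\<lambda>(J, K, L). normal_form (sorted_list_of_multiset J)
      (sorted_list_of_multiset K) (sorted_list_of_multiset L))"

lemma normal_form_cong_normal_monom:
  assumes "set js \<subseteq> {1, 2}" "set ks \<subseteq> {1, 2}" "set ls \<subseteq> {1, 2}"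
  shows "normal_form js ks ls \<asymp> normal_monom (mset js, mset ks, mset ls)"
  unfolding normal_monom_def using assms by (auto intro!: normal_form_perm)

lemma normal_monom_in_polys:
  "e \<in> valid_exponents \<Longrightarrow> normal_monom e \<in> polys_in gens"
  by (auto simp: valid_exponents_def normal_monom_def intro!: normal_form_in_polys)

lemma Var_mult_normal_form:
  assumes "g \<in> gens" and js: "set js \<subseteq> {1, 2}" "set ks \<subseteq> {1, 2}" "set ls \<subseteq> {1, 2}"
    and "even (length js) = even (length ks)" "even (length ks) = even (length ls)"
  shows "\<exists>js' ks' ls'. set js' \<subseteq> {1, 2} \<and> set ks' \<subseteq> {1, 2} \<and> set ls' \<subseteq> {1, 2} \<and>
    even (length js') = even (length ks') \<and> even (length ks') = even (length ls') \<and>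
    Var g * normal_form js ks ls \<asymp> normal_form js' ks' ls'"
proof -
  have nf2: "normal_form [i, j] [] [] = var_a 1 i j" "normal_form [] [i, j] [] = var_a 2 i j"
    "normal_form [] [] [i, j] = var_b i j" for i j
    by (simp_all add: normal_form_def)
  consider i j where "g = Gen_a 1 i j" "i \<in> {1, 2}" "j \<in> {1, 2}" "i \<le> j"
    | i j where "g = Gen_a 2 i j" "i \<in> {1, 2}" "j \<in> {1, 2}" "i \<le> j"
    | i j where "g = Gen_b i j" "i \<in> {1, 2}" "j \<in> {1, 2}" "i \<le> j"
    | i j k where "g = Gen_c i j k" "i \<in> {1, 2}" "j \<in> {1, 2}" "k \<in> {1, 2}"
    using assms(1) unfolding gens_def by blast
  then show ?thesis
  proof cases
    case 1
    then have "Var g * normal_form js ks ls = normal_form ([i, j] @ js) ([] @ ks) ([] @ ls)"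
      by (subst normal_form_append_even) (auto simp: nf2 var_a_def min_def max_def)
    then show ?thesis
      using assms 1 by (intro exI[of _ "i # j # js"] exI[of _ ks] exI[of _ ls]) auto
  next
    case 2
    then have "Var g * normal_form js ks ls = normal_form ([] @ js) ([i, j] @ ks) ([] @ ls)"
      by (subst normal_form_append_even) (auto simp: nf2 var_a_def min_def max_def)
    then show ?thesis
      using assms 2 by (intro exI[of _ js] exI[of _ "i # j # ks"] exI[of _ ls]) auto
  next
    case 3
    then have "Var g * normal_form js ks ls = normal_form ([] @ js) ([] @ ks) ([i, j] @ ls)"
      by (subst normal_form_append_even) (auto simp: nf2 var_b_def min_def max_def)
    then show ?thesis
      using assms 3 by (intro exI[of _ js] exI[of _ ks] exI[of _ "i # j # ls"]) auto
  next
    case 4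
    then show ?thesis
      using assms Gen_c_mult_normal_form[of js ks ls i j k]
      by (intro exI[of _ "js @ [i]"] exI[of _ "ks @ [j]"] exI[of _ "ls @ [k]"])
        (auto simp: var_c_def)
  qed
qed

text \<open>Multiplication by a generator turns a normal form into a normal form (\<open>Var_mult_normal_form\<close>), so this
follows one variable at a time.\<close>

lemma monomial_cong_normal_form:
  assumes "Poly_Mapping.keys m \<subseteq> gens"
  shows "\<exists>e\<in>valid_exponents. Poly_Mapping.single m 1 \<asymp> normal_monom e"
proof -
  have "\<exists>js ks ls. set js \<subseteq> {1, 2} \<and> set ks \<subseteq> {1, 2} \<and> set ls \<subseteq> {1, 2} \<and>
    even (length js) = even (length ks) \<and> even (length ks) = even (length ls) \<and>
    Poly_Mapping.single m 1 \<asymp> normal_form js ks ls"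
    using assms
  proof (induction rule: monomial_induct)
    case one
    then show ?case
      by (intro exI[of _ "[]"]) (auto simp: normal_form_def)
  next
    case (Var g p)
    then obtain js ks ls where *: "set js \<subseteq> {1, 2}" "set ks \<subseteq> {1, 2}" "set ls \<subseteq> {1, 2}"
      "even (length js) = even (length ks)" "even (length ks) = even (length ls)"
      "p \<asymp> normal_form js ks ls" by blast
    have "Var g * p \<asymp> Var g * normal_form js ks ls"
      using Var * by (intro rel_cong_mult_left polys_in_Var)
    with Var_mult_normal_form[OF \<open>g \<in> gens\<close> *(1-5)] show ?case
      using rel_cong_trans by blast
  qed
  then obtain js ks ls where *: "set js \<subseteq> {1, 2}" "set ks \<subseteq> {1, 2}" "set ls \<subseteq> {1, 2}"
    "even (length js) = even (length ks)" "even (length ks) = even (length ls)"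
    "Poly_Mapping.single m 1 \<asymp> normal_form js ks ls" by blast
  then have "Poly_Mapping.single m 1 \<asymp> normal_monom (mset js, mset ks, mset ls)"
    using normal_form_cong_normal_monom rel_cong_trans by blast
  moreover have "(mset js, mset ks, mset ls) \<in> valid_exponents"
    using * by (auto simp: valid_exponents_def)
  ultimately show ?thesis by blast
qed

text \<open>The images of the generators as functions of the traces: \<open>X i j\<close> stands for \<open>\<tau>\<^sub>i\<^sub>,\<^sub>j\<close> if \<open>i\<close> is \<open>1\<close> or \<open>2\<close>, and
\<open>X 3 j\<close> for \<open>\<tau>\<^sub>1\<^sub>2\<^sub>,\<^sub>j\<close>.\<close>

fun gen_monom :: "(nat \<Rightarrow> nat \<Rightarrow> complex) \<Rightarrow> gen \<Rightarrow> complex" where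
  "gen_monom X (Gen_a i j k) = X i j * X i k"
| "gen_monom X (Gen_b j k) = X 3 j * X 3 k"
| "gen_monom X (Gen_c i j k) = X 1 i * X 2 j * X 3 k"

definition trace_monom :: "trace_exponent \<Rightarrow> (nat \<Rightarrow> nat \<Rightarrow> complex) \<Rightarrow> complex" where
  "trace_monom = (\<lambda>(J, K, L) X. (\<Prod>j\<in>#J. X 1 j) * (\<Prod>k\<in>#K. X 2 k) * (\<Prod>l\<in>#L. X 3 l))"

lemma eval_var:
  "mpoly_eval (gen_monom X) (var_a i j k) = X i j * X i k"
  "mpoly_eval (gen_monom X) (var_b j k) = X 3 j * X 3 k"
  "mpoly_eval (gen_monom X) (var_c i j k) = X 1 i * X 2 j * X 3 k"
  by (auto simp: var_a_def var_b_def var_c_def min_def max_def)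

lemma eval_chain:
  assumes "\<And>j k. mpoly_eval x (a j k) = f j * f k" "\<And>j. mpoly_eval x (d j) = f j * D"
  shows "mpoly_eval x (chain a d e js) =
    (\<Prod>j\<in>#mset js. f j) * (if even (length js) then mpoly_eval x e else D)"
  using assms(1,2) by (induction a d e js rule: chain.induct) (auto simp: mpoly_eval_mult ac_simps)

lemma eval_normal_form:
  assumes "even (length js) = even (length ks)" "even (length ks) = even (length ls)"
  shows "mpoly_eval (gen_monom X) (normal_form js ks ls) = trace_monom (mset js, mset ks, mset ls) X"
proof -
  let ?e = "mpoly_eval (gen_monom X)"
  have 1: "?e (chain var_b (\<lambda>l. var_c j k l) 0 ls) =
      (X 1 j * X 2 k) * ((\<Prod>l\<in>#mset ls. X 3 l) * (if even (length ls) then 0 else 1))" for j k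
    by (subst eval_chain[where f = "X 3" and D = "X 1 j * X 2 k"])
      (auto simp: eval_var)
  have 2: "?e (chain (var_a 2) (\<lambda>k. chain var_b (\<lambda>l. var_c j k l) 0 ls) 0 ks) =
     X 1 j * ((\<Prod>k\<in>#mset ks. X 2 k) * (if even (length ks) then 0 else
        (\<Prod>l\<in>#mset ls. X 3 l) * (if even (length ls) then 0 else 1)))" for j
    by (subst eval_chain[where f = "X 2" and
        D = "X 1 j * ((\<Prod>l\<in>#mset ls. X 3 l) * (if even (length ls) then 0 else 1))"])
      (auto simp: eval_var 1)
  have 3: "?e (chain var_b (\<lambda>_. 0) 1 ls) = (\<Prod>l\<in>#mset ls. X 3 l) * (if even (length ls) then 1 else 0)"
    by (subst eval_chain[where f = "X 3" and D = 0]) (auto simp: eval_var)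
  have 4: "?e (chain (var_a 2) (\<lambda>_. 0) (chain var_b (\<lambda>_. 0) 1 ls) ks) =
      (\<Prod>k\<in>#mset ks. X 2 k) * (if even (length ks) then
       (\<Prod>l\<in>#mset ls. X 3 l) * (if even (length ls) then 1 else 0) else 0)"
    by (subst eval_chain[where f = "X 2" and D = 0]) (auto simp: eval_var 3)
  show ?thesis
    unfolding normal_form_def
    by (subst eval_chain[where f = "X 1", OF eval_var(1) 2])
      (use assms in \<open>auto simp: 4 trace_monom_def\<close>)
qed

lemma eval_normal_monom:
  "e \<in> valid_exponents \<Longrightarrow> mpoly_eval (gen_monom X) (normal_monom e) = trace_monom e X"
  by (auto simp: valid_exponents_def normal_monom_def eval_normal_form simp flip: size_mset)

text \<open>Dedekind's argument: if \<open>\<kappa> e1\<close> and \<open>\<kappa> e0\<close> differ at \<open>y\<close>, then replacing \<open>x\<close> by \<open>mul x y\<close> in the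
relation and subtracting \<open>\<kappa> e0 y\<close> times the relation eliminates \<open>e0\<close> but keeps \<open>e1\<close>.  Applied to monomials,
which are multiplicative in their arguments, it shows that a polynomial is determined by its values.\<close>

lemma characters_independent:
  fixes \<kappa> :: "'e \<Rightarrow> 'x \<Rightarrow> 'a::idom"
  assumes "finite E"
    and mult: "\<And>e x y. \<kappa> e (mul x y) = \<kappa> e x * \<kappa> e y"
    and nonzero: "\<And>e. \<exists>x. \<kappa> e x \<noteq> 0"
    and distinct: "\<And>e e'. e \<noteq> e' \<Longrightarrow> \<exists>x. \<kappa> e x \<noteq> \<kappa> e' x"
    and zero: "\<And>x. (\<Sum>e\<in>E. c e * \<kappa> e x) = 0" and "e \<in> E"
  shows "c e = 0"
  using assms(1) zero \<open>e \<in> E\<close>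
proof (induction E arbitrary: c e rule: finite_induct)
  case (insert e0 E)
  have c: "c e1 = 0" if e1: "e1 \<in> E" for e1
  proof -
    obtain y where y: "\<kappa> e1 y \<noteq> \<kappa> e0 y"
      using distinct[of e1 e0] e1 insert.hyps by blast
    have "(\<Sum>e\<in>E. (c e * (\<kappa> e y - \<kappa> e0 y)) * \<kappa> e x) = 0" for x
    proof -
      have "(\<Sum>e\<in>E. (c e * (\<kappa> e y - \<kappa> e0 y)) * \<kappa> e x)
          = (\<Sum>e\<in>insert e0 E. (c e * (\<kappa> e y - \<kappa> e0 y)) * \<kappa> e x)"
        using insert.hyps by simp
      also have "\<dots> = (\<Sum>e\<in>insert e0 E. c e * \<kappa> e (mul x y)) - \<kappa> e0 y * (\<Sum>e\<in>insert e0 E. c e * \<kappa> e x)"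
        by (simp add: mult algebra_simps sum_distrib_left sum_subtractf del: sum.insert)
      also have "\<dots> = 0"
        by (simp only: insert.prems(1)) simp
      finally show ?thesis .
    qed
    then show ?thesis
      using insert.IH[of "\<lambda>e. c e * (\<kappa> e y - \<kappa> e0 y)", OF _ e1] y by auto
  qed
  obtain x where "\<kappa> e0 x \<noteq> 0"
    using nonzero by blast
  moreover have "c e0 * \<kappa> e0 x = 0"
    using insert.prems(1)[of x] insert.hyps c by simp
  ultimately show ?case
    using c insert.prems(2) by auto
qed simp

lemma prod_mset_indicator: "(\<Prod>j\<in>#J. if j = i then 2 else 1 :: complex) = 2 ^ count J i"
  by (induction J) auto

lemma power_2_inject: "(2::complex) ^ m = 2 ^ n \<longleftrightarrow> m = n"
proof -
  have "(2::complex) ^ m = 2 ^ n \<longleftrightarrow> of_nat (2 ^ m) = (of_nat (2 ^ n) :: complex)"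
    by simp
  then show ?thesis
    by (simp only: of_nat_eq_iff) simp
qed

text \<open>Setting one coordinate to \<open>2\<close> and the others to \<open>1\<close> makes the exponent of that coordinate visible.\<close>

lemma trace_monom_distinct:
  assumes "e \<noteq> e'" shows "\<exists>X. trace_monom e X \<noteq> trace_monom e' X"
proof -
  obtain J K L J' K' L' where e: "e = (J, K, L)" "e' = (J', K', L')"
    by (metis prod_cases3)
  have val: "trace_monom (J, K, L) (\<lambda>h j. if h = i \<and> j = l then 2 else 1)
    = (if i = 1 then 2 ^ count J l else if i = 2 then 2 ^ count K l
        else if i = 3 then 2 ^ count L l else 1)" for J K L i l
    by (auto simp: trace_monom_def prod_mset_indicator)
  from assms consider l where "count J l \<noteq> count J' l" | l where "count K l \<noteq> count K' l"
    | l where "count L l \<noteq> count L' l"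
    unfolding e by (auto simp: multiset_eq_iff)
  then show ?thesis
  proof cases
    case 1
    then show ?thesis
      by (intro exI[of _ "\<lambda>h j. if h = 1 \<and> j = l then 2 else 1"], unfold e val) (simp add: power_2_inject)
  next
    case 2
    then show ?thesis
      by (intro exI[of _ "\<lambda>h j. if h = 2 \<and> j = l then 2 else 1"], unfold e val) (simp add: power_2_inject)
  next
    case 3
    then show ?thesis
      by (intro exI[of _ "\<lambda>h j. if h = 3 \<and> j = l then 2 else 1"], unfold e val) (simp add: power_2_inject)
  qed
qed

lemma trace_monom_mult:
  "trace_monom e (\<lambda>i j. X i j * Y i j) = trace_monom e X * trace_monom e Y"
  by (cases e) (simp add: trace_monom_def prod_mset.distrib)

lemma rel_cong_eval:
  assumes "p \<asymp> q" shows "mpoly_eval (gen_monom X) p = mpoly_eval (gen_monom X) q"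
proof -
  let ?K = "{p \<in> polys_in gens. mpoly_eval (gen_monom X) p = 0}"
  have "ideal ?K (mpoly_ring gens)"
  proof (rule idealI)
    show "ring (mpoly_ring gens :: (gen, complex) mpoly ring)"
      by (rule gens_ring.ring_axioms)
    show "subgroup ?K (add_monoid (mpoly_ring gens))"
    proof
      fix p assume p: "p \<in> ?K"
      have "inv\<^bsub>add_monoid (mpoly_ring gens)\<^esub> p = - p"
        by (rule gens_ring.add.inv_equality[unfolded a_inv_def]) (use p in \<open>auto intro: polys_in_uminus\<close>)
      then show "inv\<^bsub>add_monoid (mpoly_ring gens)\<^esub> p \<in> ?K"
        using p by (auto simp: mpoly_eval_uminus intro: polys_in_uminus)
    qed (auto simp: mpoly_eval_add intro: polys_in_add)
  qed (auto simp: mpoly_eval_mult intro: polys_in_mult)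
  moreover have "relations \<subseteq> ?K"
  proof
    fix r assume r: "r \<in> relations"
    then have "mpoly_eval (gen_monom X) r = 0"
      unfolding relations_def
      by (elim UN_E insertE emptyE) (simp_all add: mpoly_eval_diff mpoly_eval_mult eval_var)
    then show "r \<in> ?K" using r relations_subset by blast
  qed
  ultimately have "relation_ideal \<subseteq> ?K"
    unfolding relation_ideal_def by (rule gens_ring.genideal_minimal)
  then show ?thesis
    using assms by (auto simp: rel_cong_def mpoly_eval_diff)
qed

text \<open>Replacing the monomials of \<open>p\<close> by their normal forms and collecting equal ones gives a combination of
different normal forms, whose values are different monomials in the traces.  If all values of
\<open>p\<close> are \<open>0\<close>, the collected coefficients vanish by \<open>characters_independent\<close>.\<close>

theorem kernel_eq_relation_ideal:
  assumes p: "p \<in> polys_in gens"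
  shows "p \<in> relation_ideal \<longleftrightarrow> (\<forall>X. mpoly_eval (gen_monom X) p = 0)"
proof
  assume "p \<in> relation_ideal"
  then show "\<forall>X. mpoly_eval (gen_monom X) p = 0"
    using rel_cong_eval[of p 0] by (simp add: rel_cong_def)
next
  assume zero: "\<forall>X. mpoly_eval (gen_monom X) p = 0"
  let ?c = "Poly_Mapping.lookup p" and ?M = "Poly_Mapping.keys p"
  obtain e where e: "\<And>m. m \<in> ?M \<Longrightarrow> e m \<in> valid_exponents"
      "\<And>m. m \<in> ?M \<Longrightarrow> Poly_Mapping.single m 1 \<asymp> normal_monom (e m)"
    using monomial_cong_normal_form p unfolding polys_in_iff by metis
  \<comment> \<open>the coefficients after collecting the monomials with equal normal forms\<close>
  define C where "C = (\<lambda>t. \<Sum>m\<in>{m \<in> ?M. e m = t}. ?c m)"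
  have Const_sum: "(\<Sum>i\<in>K. Const (f i)) = (Const (\<Sum>i\<in>K. f i) :: (gen, complex) mpoly)" for K f
    by (induction K rule: infinite_finite_induct) (auto simp: Const_def single_add)
  have "p = (\<Sum>m\<in>?M. Const (?c m) * Poly_Mapping.single m 1)"
    by (subst sum_monomials) (simp add: single_eq_Const_mult[symmetric])
  also have "\<dots> \<asymp> (\<Sum>m\<in>?M. Const (?c m) * normal_monom (e m))"
    using e by (intro rel_cong_sum rel_cong_mult_left) auto
  also have "(\<Sum>m\<in>?M. Const (?c m) * normal_monom (e m)) = (\<Sum>t\<in>e ` ?M. Const (C t) * normal_monom t)"
    by (subst sum.image_gen[OF finite_keys, of _ _ e])
      (simp add: C_def sum_distrib_right flip: Const_sum)
  finally have cong: "p \<asymp> (\<Sum>t\<in>e ` ?M. Const (C t) * normal_monom t)" .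
  have "C t = 0" if "t \<in> e ` ?M" for t
  proof (rule characters_independent[of "e ` ?M" trace_monom "\<lambda>X Y i j. X i j * Y i j"])
    show "(\<Sum>t\<in>e ` ?M. C t * trace_monom t X) = 0" for X
    proof -
      have "0 = mpoly_eval (gen_monom X) p" using zero by simp
      also have "\<dots> = (\<Sum>t\<in>e ` ?M. C t * mpoly_eval (gen_monom X) (normal_monom t))"
        by (simp add: rel_cong_eval[OF cong] mpoly_eval_sum mpoly_eval_mult)
      also have "\<dots> = (\<Sum>t\<in>e ` ?M. C t * trace_monom t X)"
        using e(1) by (intro sum.cong) (auto simp: eval_normal_monom)
      finally show ?thesis by simp
    qed
    show "\<exists>X. trace_monom t X \<noteq> 0" for t
      by (intro exI[of _ "\<lambda>_ _. 1"]) (cases t, simp add: trace_monom_def)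
  qed (use that trace_monom_distinct trace_monom_mult in auto)
  then have "p \<asymp> 0"
    using cong by (simp add: Const_def)
  then show "p \<in> relation_ideal"
    by (simp add: rel_cong_def)
qed

section \<open>Invariants of pairs of matrices in SL(2)\<close>

definition traces :: "2 rep \<Rightarrow> complex \<times> complex \<times> complex" where
  "traces \<rho> = (trace (fst \<rho>), trace (snd \<rho>), trace (fst \<rho> ** snd \<rho>))"

definition mat22 :: "complex \<Rightarrow> complex \<Rightarrow> complex \<Rightarrow> complex \<Rightarrow> complex^2^2" where
  "mat22 a b c d = vector [vector [a, b], vector [c, d]]"

lemma mat22_nth [simp]:
  "mat22 a b c d $ 1 $ 1 = a" "mat22 a b c d $ 1 $ 2 = b"
  "mat22 a b c d $ 2 $ 1 = c" "mat22 a b c d $ 2 $ 2 = d"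
  by (simp_all add: mat22_def)

lemma mat22_eq_iff: "A = B \<longleftrightarrow> A $ 1 $ 1 = B $ 1 $ 1 \<and> A $ 1 $ 2 = B $ 1 $ 2 \<and>
   A $ 2 $ 1 = B $ 2 $ 1 \<and> A $ 2 $ 2 = B $ 2 $ 2" for A B :: "complex^2^2"
  by (auto simp: vec_eq_iff forall_2)

lemma mult22_nth: "(A ** B) $ i $ j = A $ i $ 1 * B $ 1 $ j + A $ i $ 2 * B $ 2 $ j"
  for A B :: "complex^2^2"
  by (simp add: matrix_matrix_mult_def sum_2)

lemma trace22: "trace A = A $ 1 $ 1 + A $ 2 $ 2" for A :: "complex^2^2"
  by (simp add: trace_def sum_2)

lemma SL2_iff: "A \<in> SL2 \<longleftrightarrow> A $ 1 $ 1 * A $ 2 $ 2 - A $ 1 $ 2 * A $ 2 $ 1 = 1"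
  by (simp add: SL2_def det_2)

lemma SL2_mult: "A \<in> SL2 \<Longrightarrow> B \<in> SL2 \<Longrightarrow> A ** B \<in> SL2"
  by (simp add: SL2_def det_mul)

definition adj22 :: "complex^2^2 \<Rightarrow> complex^2^2" where
  "adj22 A = mat22 (A $ 2 $ 2) (- A $ 1 $ 2) (- A $ 2 $ 1) (A $ 1 $ 1)"

lemma adj22_inverse:
  assumes "A \<in> SL2"
  shows "A ** adj22 A = mat 1" "adj22 A ** A = mat 1"
  using assms by (simp_all add: mat22_eq_iff mult22_nth adj22_def SL2_iff mat_def algebra_simps)

lemma matrix_inv_unique:
  fixes A :: "'a::semiring_1^'n^'m"
  assumes "A ** B = mat 1" "B ** A = mat 1"
  shows "matrix_inv A = B"
proof -
  have "A ** matrix_inv A = mat 1 \<and> matrix_inv A ** A = mat 1"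
    unfolding matrix_inv_def by (rule someI[of _ B]) (use assms in blast)
  then show ?thesis
    by (metis assms matrix_mul_assoc matrix_mul_lid matrix_mul_rid)
qed

lemma matrix_inv_SL2: "A \<in> SL2 \<Longrightarrow> matrix_inv A = adj22 A"
  using adj22_inverse matrix_inv_unique by blast

lemma adj22_SL2: "A \<in> SL2 \<Longrightarrow> adj22 A \<in> SL2"
  by (simp add: SL2_iff adj22_def algebra_simps)

lemma conjugate_SL2:
  assumes "g \<in> SL2"
  shows "conjugate g \<rho> = (g ** fst \<rho> ** adj22 g, g ** snd \<rho> ** adj22 g)"
  by (simp add: conjugate_def matrix_inv_SL2 assms)

lemma conjugate_in_SL2:
  assumes "g \<in> SL2" "\<rho> \<in> SL2 \<times> SL2" shows "conjugate g \<rho> \<in> SL2 \<times> SL2"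
  using assms by (auto simp: conjugate_SL2 intro!: SL2_mult adj22_SL2)

lemma trace_conjugate:
  assumes "g \<in> SL2" shows "trace (g ** A ** adj22 g) = trace A"
  by (metis assms adj22_inverse(2) matrix_mul_assoc matrix_mul_lid trace_mul_sym)

lemma traces_conjugate:
  assumes "g \<in> SL2" shows "traces (conjugate g \<rho>) = traces \<rho>"
proof -
  have "(g ** fst \<rho> ** adj22 g) ** (g ** snd \<rho> ** adj22 g)
      = g ** fst \<rho> ** (adj22 g ** g) ** snd \<rho> ** adj22 g"
    by (simp add: matrix_mul_assoc)
  also have "\<dots> = g ** (fst \<rho> ** snd \<rho>) ** adj22 g"
    by (simp add: adj22_inverse assms matrix_mul_assoc)
  finally show ?thesis
    using assms by (simp add: traces_def conjugate_SL2 trace_conjugate)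
qed

text \<open>Vogt's normal form.  In it \<open>e\<^sub>1\<close> is an eigenvector of \<open>A B\<close> for the eigenvalue \<open>- \<zeta>\<close>, and \<open>B e\<^sub>1 = \<zeta> e\<^sub>2\<close>.
For \<open>\<zeta>\<^sup>2 + z \<zeta> + 1 = 0\<close> the entry \<open>z + \<zeta>\<close> is \<open>- 1 / \<zeta>\<close>; written this way, all entries are polynomials.\<close>

definition vogt_pair :: "complex \<Rightarrow> complex \<Rightarrow> complex \<Rightarrow> complex \<Rightarrow> 2 rep" where
  "vogt_pair x y z \<zeta> = (mat22 x (-1) 1 0, mat22 0 (z + \<zeta>) \<zeta> y)"

lemma quadratic_root: "\<exists>\<zeta>::complex. \<zeta>\<^sup>2 + z * \<zeta> + 1 = 0"
proof -
  define s where "s = csqrt (z\<^sup>2 - 4)"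
  have "s\<^sup>2 = z\<^sup>2 - 4" by (simp add: s_def)
  moreover have "((s - z) / 2)\<^sup>2 + z * ((s - z) / 2) + 1 = (s\<^sup>2 - z\<^sup>2 + 4) / 4"
    by (simp add: power2_eq_square field_simps)
  ultimately have "((s - z) / 2)\<^sup>2 + z * ((s - z) / 2) + 1 = 0"
    by simp
  then show ?thesis by blast
qed

lemma vogt_pair_SL2:
  assumes "\<zeta>\<^sup>2 + z * \<zeta> + 1 = 0"
  shows "vogt_pair x y z \<zeta> \<in> SL2 \<times> SL2" "traces (vogt_pair x y z \<zeta>) = (x, y, z)"
proof -
  have "\<zeta> * \<zeta> = - (z * \<zeta> + 1)"
    using assms by (simp add: eq_neg_iff_add_eq_0 power2_eq_square add.assoc del: minus_add_distrib)
  then show "vogt_pair x y z \<zeta> \<in> SL2 \<times> SL2" "traces (vogt_pair x y z \<zeta>) = (x, y, z)"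
    by (auto simp: vogt_pair_def SL2_iff traces_def trace22 mult22_nth algebra_simps)
qed

lemma traces_surj: "\<exists>\<rho>\<in>SL2 \<times> SL2. traces \<rho> = t"
  by (metis quadratic_root vogt_pair_SL2 prod_cases3)

text \<open>Any eigenvector \<open>v\<close> of \<open>A B\<close> for \<open>- \<zeta>\<close> gives rise to the normal form in the basis \<open>v\<close>, \<open>B v / \<zeta>\<close>; the
remaining entries are forced by the Cayley-Hamilton theorem for \<open>A\<close> and \<open>B\<close>.  The two vectors
are independent because a common eigenvector of \<open>A\<close> and \<open>B\<close> would lie in the kernel of
\<open>A B - B A\<close>.\<close>

lemma conjugate_to_vogt_pair:
  assumes "A \<in> SL2" "B \<in> SL2" and x: "traces (A, B) = (x, y, z)" and \<zeta>: "\<zeta>\<^sup>2 + z * \<zeta> + 1 = 0"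
    and ind: "det (A ** B - B ** A) \<noteq> 0"
  shows "\<exists>g\<in>SL2. (A, B) = conjugate g (vogt_pair x y z \<zeta>)"
proof -
  have "\<zeta> \<noteq> 0" using \<zeta> by auto
  let ?M = "A ** B"
  have trM: "trace ?M = z" and trA: "trace A = x" and trB: "trace B = y"
    using x by (auto simp: traces_def)
  have detM: "det ?M = 1"
    using assms(1,2) by (simp add: det_mul SL2_def)
  \<comment> \<open>\<open>- \<zeta>\<close> is a root of the characteristic polynomial of \<open>A ** B\<close>\<close>
  have "det (?M + mat \<zeta>) = \<zeta>\<^sup>2 + trace ?M * \<zeta> + det ?M"
    by (simp add: det_2 trace22 mat_def power2_eq_square algebra_simps)
  then have "det (?M + mat \<zeta>) = 0"
    using \<zeta> by (simp add: trM detM)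
  then have "\<not> invertible (?M + mat \<zeta>)"
    by (simp add: invertible_det_nz)
  then have "\<not> (\<exists>N. N ** (?M + mat \<zeta>) = mat 1)"
    using invertible_left_inverse by blast
  then obtain v where v: "v \<noteq> 0" "(?M + mat \<zeta>) *v v = 0"
    unfolding matrix_left_invertible_ker by blast
  have "?M *v v + mat \<zeta> *v v = 0"
    using v(2) by (simp add: matrix_vector_mult_add_rdistrib)
  moreover have "mat \<zeta> *v v = \<zeta> *s v"
    by (simp add: vec_eq_iff forall_2 matrix_vector_mult_def sum_2 mat_def)
  ultimately have "?M *v v = - (\<zeta> *s v)"
    by (simp add: eq_neg_iff_add_eq_0)
  then have Mv: "A *v (B *v v) = - \<zeta> *s v"
    by (simp add: matrix_vector_mul_assoc vec_eq_iff)
  define w where "w = (1 / \<zeta>) *s (B *v v)"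
  have Bv: "B *v v = \<zeta> *s w"
    using \<open>\<zeta> \<noteq> 0\<close> by (simp add: w_def)
  have minus: "N *v (- u) = - (N *v u)" for N :: "complex^2^2" and u
    by (metis vector_scalar_commute vector_sneg_minus1)
  have "\<zeta> *s (A *v w) = \<zeta> *s (- v)"
    using Mv by (simp add: Bv vector_scalar_commute vec_eq_iff)
  then have Aw: "A *v w = - v"
    using \<open>\<zeta> \<noteq> 0\<close> vector_mul_lcancel by blast
  define \<delta> where "\<delta> = v $ 1 * w $ 2 - v $ 2 * w $ 1"
  have "\<delta> \<noteq> 0"
  proof
    assume "\<delta> = 0"
    \<comment> \<open>then \<open>v\<close> is a common eigenvector of \<open>A\<close> and \<open>B\<close>, so the commutator of \<open>A\<close> and \<open>B\<close> kills it\<close>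
    have "\<exists>\<beta>. w = \<beta> *s v"
    proof (cases "v $ 1 = 0")
      case True
      then have "v $ 2 \<noteq> 0" using v(1) by (auto simp: vec_eq_iff forall_2)
      then show ?thesis using True \<open>\<delta> = 0\<close>
        by (intro exI[of _ "w $ 2 / v $ 2"]) (auto simp: vec_eq_iff forall_2 \<delta>_def)
    next
      case False
      then show ?thesis using \<open>\<delta> = 0\<close>
        by (intro exI[of _ "w $ 1 / v $ 1"]) (auto simp: vec_eq_iff forall_2 \<delta>_def field_simps)
    qed
    then obtain \<beta> where \<beta>: "w = \<beta> *s v" by blast
    have A: "\<beta> *s (A *v v) = - v"
      using Aw by (simp add: \<beta> vector_scalar_commute)
    then have "\<beta> \<noteq> 0" using v(1) by auto
    have "\<beta> *s (A *v (B *v v)) = - (\<zeta> *s w)"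
      by (simp add: Mv \<beta> vec_eq_iff)
    moreover have "\<beta> *s (B *v (A *v v)) = - (\<zeta> *s w)"
      using A Bv by (metis minus vector_scalar_commute)
    ultimately have "\<beta> *s ((A ** B - B ** A) *v v) = 0"
      by (simp add: matrix_vector_mult_diff_rdistrib vector_ssub_ldistrib flip: matrix_vector_mul_assoc)
    then have "(A ** B - B ** A) *v v = 0"
      using \<open>\<beta> \<noteq> 0\<close> by (simp add: vec_eq_iff)
    then have "\<not> invertible (A ** B - B ** A)"
      using v(1) matrix_left_invertible_ker invertible_def by metis
    then show False
      using ind by (simp add: invertible_det_nz)
  qed
  have cayley_hamilton: "N *v (N *v u) = trace N *s (N *v u) - u" if "N \<in> SL2" for N :: "complex^2^2" and u
  proof -
    have "N *v (N *v u) = trace N *s (N *v u) - (N $ 1 $ 1 * N $ 2 $ 2 - N $ 1 $ 2 * N $ 2 $ 1) *s u"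
      by (simp add: vec_eq_iff forall_2 matrix_vector_mult_def sum_2 trace22 algebra_simps)
    moreover have "N $ 1 $ 1 * N $ 2 $ 2 - N $ 1 $ 2 * N $ 2 $ 1 = 1"
      using that by (simp add: SL2_iff)
    ultimately show ?thesis by (simp only: vector_smult_lid)
  qed
  have Av: "A *v v = x *s v + w"
    using cayley_hamilton[OF assms(1), of w] by (simp add: Aw trA minus vec_eq_iff algebra_simps)
  \<comment> \<open>\<open>B v = \<zeta> w\<close> turns the Cayley-Hamilton identity for \<open>B\<close> at \<open>v\<close> into a formula for \<open>B w\<close>\<close>
  have "\<zeta> *s (B *v w) = \<zeta> *s (y *s w) - v"
    using cayley_hamilton[OF assms(2), of v] by (simp add: Bv trB vector_scalar_commute vec_eq_iff algebra_simps)
  also have "\<dots> = \<zeta> *s (y *s w + (z + \<zeta>) *s v)"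
  proof -
    have "\<zeta> * (z + \<zeta>) + 1 = 0"
      using \<zeta> by (simp add: power2_eq_square algebra_simps)
    then have "- (1::complex) = \<zeta> * (z + \<zeta>)"
      by (simp only: eq_neg_iff_add_eq_0 eq_commute[of "- 1"])
    then have "- v = (\<zeta> * (z + \<zeta>)) *s v" by (metis vector_sneg_minus1)
    then have "\<zeta> *s (y *s w) - v = \<zeta> *s (y *s w) + (\<zeta> * (z + \<zeta>)) *s v"
      by (metis diff_conv_add_uminus)
    then show ?thesis by (simp add: vec_eq_iff algebra_simps)
  qed
  finally have Bw: "B *v w = y *s w + (z + \<zeta>) *s v"
    using \<open>\<zeta> \<noteq> 0\<close> vector_mul_lcancel by blast
  \<comment> \<open>rescaling the basis so that its determinant becomes \<open>1\<close>\<close>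
  define s where "s = csqrt \<delta>"
  have s: "s * s = \<delta>" "s \<noteq> 0"
    using \<open>\<delta> \<noteq> 0\<close> power2_csqrt[of \<delta>] by (auto simp: s_def power2_eq_square)
  define g where "g = mat22 (v $ 1 / s) (w $ 1 / s) (v $ 2 / s) (w $ 2 / s)"
  have g: "g \<in> SL2"
    using s \<open>\<delta> \<noteq> 0\<close> by (simp add: g_def SL2_iff \<delta>_def field_simps)
  have comps: "A $ i $ 1 * v $ 1 + A $ i $ 2 * v $ 2 = x * v $ i + w $ i"
    "A $ i $ 1 * w $ 1 + A $ i $ 2 * w $ 2 = - v $ i"
    "B $ i $ 1 * v $ 1 + B $ i $ 2 * v $ 2 = \<zeta> * w $ i"
    "B $ i $ 1 * w $ 1 + B $ i $ 2 * w $ 2 = y * w $ i + (z + \<zeta>) * v $ i" for i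
    using Av Aw Bv Bw by (simp_all add: vec_eq_iff matrix_vector_mult_def sum_2 distrib_right)
  have "A ** g = g ** mat22 x (-1) 1 0" "B ** g = g ** mat22 0 (z + \<zeta>) \<zeta> y"
    using s(2) comps[of 1] comps[of 2] unfolding mat22_eq_iff
    by (simp_all add: mult22_nth g_def field_simps)
  then have "(A ** g) ** adj22 g = fst (conjugate g (vogt_pair x y z \<zeta>))"
    "(B ** g) ** adj22 g = snd (conjugate g (vogt_pair x y z \<zeta>))"
    by (simp_all add: conjugate_SL2 g vogt_pair_def)
  then have "A = fst (conjugate g (vogt_pair x y z \<zeta>))" "B = snd (conjugate g (vogt_pair x y z \<zeta>))"
    by (simp_all add: adj22_inverse g flip: matrix_mul_assoc)
  then show ?thesis
    using g by (metis prod.collapse)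
qed

definition entry_functions :: "('n::finite rep \<Rightarrow> complex) set" where
  "entry_functions = range (\<lambda>e \<rho>. entry \<rho> e)"

lemma entry_eq:
  "entry \<rho> (Inl (i, j)) = fst \<rho> $ i $ j" "entry \<rho> (Inr (i, j)) = snd \<rho> $ i $ j"
  by (cases \<rho>; simp)+

lemma entry_in_alg:
  fixes i j :: "'n::finite"
  shows "(\<lambda>\<rho>. fst \<rho> $ i $ j) \<in> alg entry_functions" "(\<lambda>\<rho>. snd \<rho> $ i $ j) \<in> alg entry_functions"
proof -
  have "(\<lambda>\<rho>. entry \<rho> e) \<in> alg entry_functions" for e :: "('n \<times> 'n) + ('n \<times> 'n)"
    by (rule alg.gen) (simp add: entry_functions_def)
  from this[of "Inl (i, j)"] this[of "Inr (i, j)"]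
  show "(\<lambda>\<rho>. fst \<rho> $ i $ j) \<in> alg entry_functions" "(\<lambda>\<rho>. snd \<rho> $ i $ j) \<in> alg entry_functions"
    by (simp_all add: entry_eq)
qed

lemma entry_functions_cases:
  assumes "f \<in> entry_functions"
  obtains i j where "f = (\<lambda>\<rho>. fst \<rho> $ i $ j)" | i j where "f = (\<lambda>\<rho>. snd \<rho> $ i $ j)"
proof -
  obtain e where e: "f = (\<lambda>\<rho>. entry \<rho> e)"
    using assms by (auto simp: entry_functions_def)
  show thesis
  proof (cases e)
    case (Inl ij)
    then have "f = (\<lambda>\<rho>. fst \<rho> $ fst ij $ snd ij)" by (cases ij) (auto simp: e fun_eq_iff)
    then show ?thesis using that by blast
  next
    case (Inr ij)
    then have "f = (\<lambda>\<rho>. snd \<rho> $ fst ij $ snd ij)" by (cases ij) (auto simp: e fun_eq_iff)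
    then show ?thesis using that by blast
  qed
qed

text \<open>Polynomial functions on \<open>X\<close> with coefficients in functions of a parameter.  The parameter is what makes it
possible to treat the two factors of a product separately.\<close>

definition with_params :: "('x \<Rightarrow> complex) set \<Rightarrow> ('w \<Rightarrow> complex) set \<Rightarrow> ('x \<times> 'w \<Rightarrow> complex) set" where
  "with_params S D = (\<lambda>f. f \<circ> fst) ` S \<union> (\<lambda>d. d \<circ> snd) ` D"

definition coordinates3 :: "(complex \<times> complex \<times> complex \<Rightarrow> complex) set" where
  "coordinates3 = {fst, fst \<circ> snd, snd \<circ> snd}"

lemma alg_with_params_fst:
  assumes "f \<in> alg S" shows "(\<lambda>x. f (fst x)) \<in> alg (with_params S D)"
  using assms by (rule alg_compose) (rule alg.gen, auto simp: with_params_def o_def)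

lemma alg_with_params_snd:
  assumes "d \<in> alg D" shows "(\<lambda>x. d (snd x)) \<in> alg (with_params S D)"
  using assms by (rule alg_compose) (rule alg.gen, auto simp: with_params_def o_def)

lemma coordinates3_in_alg:
  "fst \<in> alg coordinates3" "(\<lambda>t. fst (snd t)) \<in> alg coordinates3" "(\<lambda>t. snd (snd t)) \<in> alg coordinates3"
  by (rule alg.gen, simp add: coordinates3_def o_def)+

text \<open>The functions of the form \<open>U + V \<zeta>\<close> contain the entries of the normal form and are closed under
products, as \<open>\<zeta>\<^sup>2 = - z \<zeta> - 1\<close>.\<close>

lemma vogt_pair_function:
  assumes "F \<in> alg (with_params entry_functions D)"
  shows "\<exists>U\<in>alg (with_params coordinates3 D). \<exists>V\<in>alg (with_params coordinates3 D).
     \<forall>x y z \<zeta> w. \<zeta>\<^sup>2 + z * \<zeta> + 1 = 0 \<longrightarrow>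
       F (vogt_pair x y z \<zeta>, w) = U ((x, y, z), w) + V ((x, y, z), w) * \<zeta>"
  using assms
proof induction
  case (const c)
  show ?case
    by (intro bexI[of _ "\<lambda>_. c"] bexI[of _ "\<lambda>_. 0"]) (auto intro: alg.const)
next
  case (gen f)
  note coords = coordinates3_in_alg[THEN alg_with_params_fst]
  consider h where "h \<in> entry_functions" "f = h \<circ> fst" | d where "d \<in> D" "f = d \<circ> snd"
    using gen by (auto simp: with_params_def)
  then show ?case
  proof cases
    case 1
    have *: ?thesis if "\<And>x y z \<zeta>. h (vogt_pair x y z \<zeta>) = U (x, y, z) + c * \<zeta>" "U \<in> alg coordinates3"
      for U c
      using that 1(2) alg_with_params_fst[OF that(2), of D]
      by (intro bexI[of _ "\<lambda>x. U (fst x)"] bexI[of _ "\<lambda>_. c"]) (auto intro: alg.const)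
    have c: "i = 1 \<or> i = 2" for i :: 2 by (rule exhaust_2)
    from 1(1) show ?thesis
    proof (cases rule: entry_functions_cases)
      case (1 i j)
      show ?thesis
        using c[of i] c[of j]
        by (elim disjE; intro *[of "if i = 1 \<and> j = 1 then fst else if i = 1 \<and> j = 2 then (\<lambda>_. -1)
              else if i = 2 \<and> j = 1 then (\<lambda>_. 1) else (\<lambda>_. 0)" 0])
          (auto simp: 1 vogt_pair_def intro: coordinates3_in_alg alg.const)
    next
      case (2 i j)
      show ?thesis
        using c[of i] c[of j]
        by (elim disjE; intro *[of "if i = 1 \<and> j = 2 then (\<lambda>t. snd (snd t)) else
              if i = 2 \<and> j = 2 then (\<lambda>t. fst (snd t)) else (\<lambda>_. 0)" "if i = j then 0 else 1"])
          (auto simp: 2 vogt_pair_def intro: coordinates3_in_alg alg.const)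
    qed
  next
    case 2
    then show ?thesis
      using alg_with_params_snd[OF alg.gen[OF 2(1)], of coordinates3]
      by (intro bexI[of _ "\<lambda>x. d (snd x)"] bexI[of _ "\<lambda>_. 0"]) (auto intro: alg.const)
  qed
next
  case (add f g)
  then obtain U V U' V' where *: "U \<in> alg (with_params coordinates3 D)" "V \<in> alg (with_params coordinates3 D)"
    "U' \<in> alg (with_params coordinates3 D)" "V' \<in> alg (with_params coordinates3 D)"
    "\<forall>x y z \<zeta> w. \<zeta>\<^sup>2 + z * \<zeta> + 1 = 0 \<longrightarrow>
       f (vogt_pair x y z \<zeta>, w) = U ((x, y, z), w) + V ((x, y, z), w) * \<zeta>"
    "\<forall>x y z \<zeta> w. \<zeta>\<^sup>2 + z * \<zeta> + 1 = 0 \<longrightarrow>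
       g (vogt_pair x y z \<zeta>, w) = U' ((x, y, z), w) + V' ((x, y, z), w) * \<zeta>" by blast
  show ?case
    by (rule bexI[of _ "\<lambda>x. U x + U' x"], rule bexI[of _ "\<lambda>x. V x + V' x"])
      (use * in \<open>auto intro: alg_intros simp: algebra_simps\<close>)
next
  case (mult f g)
  then obtain U V U' V' where *: "U \<in> alg (with_params coordinates3 D)" "V \<in> alg (with_params coordinates3 D)"
    "U' \<in> alg (with_params coordinates3 D)" "V' \<in> alg (with_params coordinates3 D)"
    "\<forall>x y z \<zeta> w. \<zeta>\<^sup>2 + z * \<zeta> + 1 = 0 \<longrightarrow>
       f (vogt_pair x y z \<zeta>, w) = U ((x, y, z), w) + V ((x, y, z), w) * \<zeta>"
    "\<forall>x y z \<zeta> w. \<zeta>\<^sup>2 + z * \<zeta> + 1 = 0 \<longrightarrow>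
       g (vogt_pair x y z \<zeta>, w) = U' ((x, y, z), w) + V' ((x, y, z), w) * \<zeta>" by blast
  have z: "(\<lambda>x. snd (snd (fst x))) \<in> alg (with_params coordinates3 D)"
    by (rule alg_with_params_fst[OF coordinates3_in_alg(3)])
  have red: "(u + v * \<zeta>) * (u' + v' * \<zeta>) = (u * u' - v * v') + (u * v' + u' * v - z * (v * v')) * \<zeta>"
    if "\<zeta>\<^sup>2 + z * \<zeta> + 1 = 0" for u v u' v' z \<zeta> :: complex
  proof -
    have "(u + v * \<zeta>) * (u' + v' * \<zeta>) - ((u * u' - v * v') + (u * v' + u' * v - z * (v * v')) * \<zeta>)
      = v * v' * (\<zeta>\<^sup>2 + z * \<zeta> + 1)"
      by (simp add: power2_eq_square algebra_simps)
    then show ?thesis using that by simp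
  qed
  show ?case
    by (rule bexI[of _ "\<lambda>x. U x * U' x - V x * V' x"],
        rule bexI[of _ "\<lambda>x. U x * V' x + U' x * V x - snd (snd (fst x)) * (V x * V' x)"])
      (use * z in \<open>auto intro!: alg_intros simp: red\<close>)
qed

text \<open>The product of four elementary matrices, alternately lower and upper triangular; it
exhibits SL(2) as a polynomial image of an affine space.\<close>

definition sl2_param :: "complex \<Rightarrow> complex \<Rightarrow> complex \<Rightarrow> complex \<Rightarrow> complex^2^2" where
  "sl2_param p q r s = mat22 1 q p (1 + p * q) ** mat22 1 s r (1 + r * s)"

lemma sl2_param_in_SL2: "sl2_param p q r s \<in> SL2"
  unfolding sl2_param_def by (intro SL2_mult) (simp_all add: SL2_iff algebra_simps)

lemma sl2_param_surj:
  assumes "A \<in> SL2" shows "\<exists>p q r s. A = sl2_param p q r s"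
proof (cases "A $ 2 $ 1 = 0")
  case False
  then show ?thesis
    using assms
    by (intro exI[of _ 0] exI[of _ "(A $ 1 $ 1 - 1) / A $ 2 $ 1"] exI[of _ "A $ 2 $ 1"]
        exI[of _ "(A $ 2 $ 2 - 1) / A $ 2 $ 1"])
      (simp add: sl2_param_def mat22_eq_iff mult22_nth SL2_iff field_simps)
next
  case True
  then have a: "A $ 1 $ 1 \<noteq> 0" using assms by (auto simp: SL2_iff)
  then show ?thesis
    using assms True
    by (intro exI[of _ 1] exI[of _ "(1 - A $ 1 $ 1) / A $ 1 $ 1"] exI[of _ "- A $ 1 $ 1"]
        exI[of _ "(1 + A $ 1 $ 2 - A $ 2 $ 2) / A $ 1 $ 1"])
      (simp add: sl2_param_def mat22_eq_iff mult22_nth SL2_iff field_simps)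
qed

lemma alg_id_eq_poly:
  assumes "f \<in> alg {\<lambda>t. t}" shows "\<exists>p. f = poly p"
  using assms
proof induction
  case (const c)
  then show ?case by (intro exI[of _ "[:c:]"]) auto
next
  case (gen f)
  then show ?case by (intro exI[of _ "[:0, 1:]"]) auto
next
  case (add f g)
  then show ?case by (metis poly_add ext)
next
  case (mult f g)
  then show ?case by (metis poly_mult ext)
qed

text \<open>The pairs \<open>\<rho>\<close> and \<open>\<sigma>\<close> lie on a curve in \<open>SL2 \<times> SL2\<close> that is the image of a line under \<open>sl2_param\<close>.
Along it \<open>\<Phi>\<close> and \<open>\<Psi>\<close> are polynomials in one variable with product zero, and \<open>\<Psi>\<close> is not the zero
polynomial.\<close>

lemma SL2_pairs_irreducible:
  assumes \<Phi>: "\<Phi> \<in> alg entry_functions" and \<Psi>: "\<Psi> \<in> alg entry_functions"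
    and zero: "\<And>\<rho>. \<rho> \<in> SL2 \<times> SL2 \<Longrightarrow> \<Phi> \<rho> * \<Psi> \<rho> = 0"
    and \<sigma>: "\<sigma> \<in> SL2 \<times> SL2" "\<Psi> \<sigma> \<noteq> 0" and \<rho>: "\<rho> \<in> SL2 \<times> SL2"
  shows "\<Phi> \<rho> = 0"
proof -
  have line: "\<exists>\<gamma>. (\<forall>t. \<gamma> t \<in> SL2) \<and> \<gamma> 0 = A \<and> \<gamma> 1 = B \<and> (\<forall>i j. (\<lambda>t. \<gamma> t $ i $ j) \<in> alg {\<lambda>t. t})"
    if AB: "A \<in> SL2" "B \<in> SL2" for A B
  proof -
    obtain p q r s where A: "A = sl2_param p q r s" using AB sl2_param_surj by blast
    obtain p' q' r' s' where B: "B = sl2_param p' q' r' s'" using AB sl2_param_surj by blast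
    define l where "l = (\<lambda>(a::complex) b t. a + t * (b - a))"
    have l: "l a b \<in> alg {\<lambda>t. t}" for a b
      unfolding l_def by (intro alg_intros alg.gen) simp
    define \<gamma> where "\<gamma> = (\<lambda>t. sl2_param (l p p' t) (l q q' t) (l r r' t) (l s s' t))"
    have "(\<lambda>t. \<gamma> t $ i $ j) \<in> alg {\<lambda>t. t}" for i j
      using exhaust_2[of i] exhaust_2[of j] unfolding \<gamma>_def sl2_param_def
      by (elim disjE; simp add: mult22_nth; intro alg_intros l)
    moreover have "\<gamma> 0 = A" "\<gamma> 1 = B"
      by (simp_all add: \<gamma>_def A B l_def)
    moreover have "\<gamma> t \<in> SL2" for t
      by (simp add: \<gamma>_def sl2_param_in_SL2)
    ultimately show ?thesis
      by (intro exI[of _ \<gamma>]) auto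
  qed
  obtain \<gamma> where \<gamma>: "\<And>t. \<gamma> t \<in> SL2" "\<gamma> 0 = fst \<rho>" "\<gamma> 1 = fst \<sigma>"
    "\<And>i j. (\<lambda>t. \<gamma> t $ i $ j) \<in> alg {\<lambda>t. t}"
    using line[of "fst \<rho>" "fst \<sigma>"] \<rho> \<sigma> by (auto simp: mem_Times_iff)
  obtain \<gamma>' where \<gamma>': "\<And>t. \<gamma>' t \<in> SL2" "\<gamma>' 0 = snd \<rho>" "\<gamma>' 1 = snd \<sigma>"
    "\<And>i j. (\<lambda>t. \<gamma>' t $ i $ j) \<in> alg {\<lambda>t. t}"
    using line[of "snd \<rho>" "snd \<sigma>"] \<rho> \<sigma> by (auto simp: mem_Times_iff)
  have poly: "\<exists>p. (\<lambda>t. f (\<gamma> t, \<gamma>' t)) = poly p" if "f \<in> alg entry_functions" for f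
  proof (rule alg_id_eq_poly, rule alg_compose[OF that])
    fix s :: "2 rep \<Rightarrow> complex" assume "s \<in> entry_functions"
    then show "(\<lambda>t. s (\<gamma> t, \<gamma>' t)) \<in> alg {\<lambda>t. t}"
      by (cases rule: entry_functions_cases) (auto intro: \<gamma> \<gamma>')
  qed
  obtain p q where pq: "(\<lambda>t. \<Phi> (\<gamma> t, \<gamma>' t)) = poly p" "(\<lambda>t. \<Psi> (\<gamma> t, \<gamma>' t)) = poly q"
    using poly[OF \<Phi>] poly[OF \<Psi>] by blast
  have "poly (p * q) t = poly 0 t" for t
    using zero[of "(\<gamma> t, \<gamma>' t)"] \<gamma>(1) \<gamma>'(1) fun_cong[OF pq(1), of t] fun_cong[OF pq(2), of t] by simp
  then have "p * q = 0"
    using poly_eq_poly_eq_iff[of "p * q" 0] by blast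
  moreover have "poly q 1 \<noteq> 0"
    using \<sigma>(2) fun_cong[OF pq(2), of 1] \<gamma>(3) \<gamma>'(3) by simp
  ultimately have "p = 0" by auto
  then show ?thesis
    using fun_cong[OF pq(1), of 0] \<gamma>(2) \<gamma>'(2) by simp
qed

lemma traces_in_alg:
  assumes "U \<in> alg coordinates3"
  shows "(\<lambda>\<rho>. U (traces \<rho>)) \<in> alg entry_functions"
  using assms
proof (rule alg_compose)
  fix s assume "s \<in> coordinates3"
  then show "(\<lambda>\<rho>. s (traces \<rho>)) \<in> alg entry_functions"
    by (auto simp: coordinates3_def traces_def trace22 mult22_nth intro!: alg_intros entry_in_alg)
qed

text \<open>The function \<open>\<Psi>\<close> in the proof vanishes where \<open>A\<close> and \<open>B\<close> may have a common eigenvector or where the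
two roots \<open>\<zeta>\<close> coincide.  Elsewhere both roots give conjugates of the same pair, so the coefficient of
\<open>\<zeta>\<close> is zero.\<close>

theorem fricke_vogt:
  assumes F: "F \<in> alg (with_params entry_functions D)"
    and inv: "\<And>g \<rho> w. g \<in> SL2 \<Longrightarrow> \<rho> \<in> SL2 \<times> SL2 \<Longrightarrow> w \<in> W \<Longrightarrow> F (conjugate g \<rho>, w) = F (\<rho>, w)"
  shows "\<exists>U\<in>alg (with_params coordinates3 D). \<forall>\<rho>\<in>SL2 \<times> SL2. \<forall>w\<in>W. F (\<rho>, w) = U (traces \<rho>, w)"
proof -
  obtain U V where UV: "U \<in> alg (with_params coordinates3 D)" "V \<in> alg (with_params coordinates3 D)"
    and FUV: "\<And>x y z \<zeta> w. \<zeta>\<^sup>2 + z * \<zeta> + 1 = 0 \<Longrightarrow>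
       F (vogt_pair x y z \<zeta>, w) = U ((x, y, z), w) + V ((x, y, z), w) * \<zeta>"
    using vogt_pair_function[OF F] by blast
  define \<Psi> :: "2 rep \<Rightarrow> complex" where
    "\<Psi> = (\<lambda>\<rho>. det (fst \<rho> ** snd \<rho> - snd \<rho> ** fst \<rho>) * ((trace (fst \<rho> ** snd \<rho>))\<^sup>2 - 4))"
  have \<Psi>: "\<Psi> \<in> alg entry_functions"
    unfolding \<Psi>_def
    by (simp add: det_2 trace22 mult22_nth power2_eq_square) (intro alg_intros entry_in_alg)
  have "F (\<rho>, w) - U (traces \<rho>, w) = 0" if \<rho>: "\<rho> \<in> SL2 \<times> SL2" and w: "w \<in> W" for \<rho> w
  proof (rule SL2_pairs_irreducible[OF _ \<Psi> _ _ _ \<rho>])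
    have sp: "(\<lambda>\<rho>. G (\<rho>, w)) \<in> alg S" if "G \<in> alg (with_params S D)" for G and S :: "('q \<Rightarrow> complex) set"
      using that by (rule alg_compose) (auto simp: with_params_def intro: alg.gen alg.const)
    show "(\<lambda>\<rho>. F (\<rho>, w) - U (traces \<rho>, w)) \<in> alg entry_functions"
      by (intro alg_diff sp[OF F] traces_in_alg[OF sp[OF UV(1)]])
  next
    fix \<rho> :: "2 rep" assume \<rho>: "\<rho> \<in> SL2 \<times> SL2"
    show "(F (\<rho>, w) - U (traces \<rho>, w)) * \<Psi> \<rho> = 0"
    proof (cases "\<Psi> \<rho> = 0")
      case False
      obtain x y z where t: "traces \<rho> = (x, y, z)" by (metis prod_cases3)
      have z: "z\<^sup>2 \<noteq> 4" and c: "det (fst \<rho> ** snd \<rho> - snd \<rho> ** fst \<rho>) \<noteq> 0"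
        using False t by (auto simp: \<Psi>_def traces_def)
      have F_eq: "F (\<rho>, w) = U ((x, y, z), w) + V ((x, y, z), w) * \<zeta>" if \<zeta>: "\<zeta>\<^sup>2 + z * \<zeta> + 1 = 0" for \<zeta>
      proof -
        obtain g where "g \<in> SL2" "\<rho> = conjugate g (vogt_pair x y z \<zeta>)"
          using conjugate_to_vogt_pair[of "fst \<rho>" "snd \<rho>" x y z \<zeta>] \<rho> t \<zeta> c by (auto simp: mem_Times_iff)
        then show ?thesis
          using inv vogt_pair_SL2(1)[OF \<zeta>] w FUV[OF \<zeta>] by metis
      qed
      obtain \<zeta> where \<zeta>: "\<zeta>\<^sup>2 + z * \<zeta> + 1 = 0" using quadratic_root by blast
      have \<zeta>': "(- z - \<zeta>)\<^sup>2 + z * (- z - \<zeta>) + 1 = 0"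
        using \<zeta> by (simp add: power2_eq_square algebra_simps)
      have "\<zeta> \<noteq> - z - \<zeta>"
      proof
        assume "\<zeta> = - z - \<zeta>"
        then have "z = - 2 * \<zeta>" by (simp add: algebra_simps eq_neg_iff_add_eq_0)
        then show False using \<zeta> z by (simp add: power2_eq_square algebra_simps)
      qed
      then have "V ((x, y, z), w) = 0"
        using F_eq[OF \<zeta>] F_eq[OF \<zeta>'] by auto
      then show ?thesis using F_eq[OF \<zeta>] t by simp
    qed simp
  next
    \<comment> \<open>a pair with \<open>tr (A B) = 3\<close> and \<open>A B - B A = diag (1, -1)\<close>\<close>
    show "(mat22 1 1 0 1, mat22 1 0 1 1) \<in> SL2 \<times> SL2"
      by (simp add: SL2_iff)
    show "\<Psi> (mat22 1 1 0 1, mat22 1 0 1 1) \<noteq> 0"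
      by (simp add: \<Psi>_def det_2 trace22 mult22_nth)
  qed
  then show ?thesis
    using UV(1) by (intro bexI[of _ U]) auto
qed

text \<open>The second pair is the parameter at first.  The resulting function of the traces of the first pair is invariant in the
second pair, because every triple of traces occurs; now these traces are the parameter.\<close>

theorem fricke_vogt_product:
  assumes F: "F \<in> alg (with_params entry_functions entry_functions)"
    and inv1: "\<And>g \<rho> \<sigma>. g \<in> SL2 \<Longrightarrow> \<rho> \<in> SL2 \<times> SL2 \<Longrightarrow> \<sigma> \<in> SL2 \<times> SL2 \<Longrightarrow> F (conjugate g \<rho>, \<sigma>) = F (\<rho>, \<sigma>)"
    and inv2: "\<And>g \<rho> \<sigma>. g \<in> SL2 \<Longrightarrow> \<rho> \<in> SL2 \<times> SL2 \<Longrightarrow> \<sigma> \<in> SL2 \<times> SL2 \<Longrightarrow> F (\<rho>, conjugate g \<sigma>) = F (\<rho>, \<sigma>)"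
  shows "\<exists>V\<in>alg (with_params coordinates3 coordinates3).
     \<forall>\<rho>\<in>SL2 \<times> SL2. \<forall>\<sigma>\<in>SL2 \<times> SL2. F (\<rho>, \<sigma>) = V (traces \<rho>, traces \<sigma>)"
proof -
  have swap: "(\<lambda>x. G (prod.swap x)) \<in> alg (with_params T S)" if "G \<in> alg (with_params S T)"
    for G and S :: "('x \<Rightarrow> complex) set" and T :: "('y \<Rightarrow> complex) set"
    using that
  proof (rule alg_compose)
    fix s assume "s \<in> with_params S T"
    then show "(\<lambda>x. s (prod.swap x)) \<in> alg (with_params T S)"
      by (intro alg.gen) (auto simp: with_params_def o_def)
  qed
  obtain U where U: "U \<in> alg (with_params coordinates3 entry_functions)"
    "\<And>\<rho> \<sigma>. \<rho> \<in> SL2 \<times> SL2 \<Longrightarrow> \<sigma> \<in> SL2 \<times> SL2 \<Longrightarrow> F (\<rho>, \<sigma>) = U (traces \<rho>, \<sigma>)"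
    using fricke_vogt[OF F, of "SL2 \<times> SL2"] inv1 by blast
  have inv: "U (t, conjugate g \<sigma>) = U (t, \<sigma>)" if "g \<in> SL2" "\<sigma> \<in> SL2 \<times> SL2" for g \<sigma> t
    using traces_surj[of t] U(2) inv2 that conjugate_in_SL2 by metis
  obtain V where V: "V \<in> alg (with_params coordinates3 coordinates3)"
    "\<And>\<sigma> t. \<sigma> \<in> SL2 \<times> SL2 \<Longrightarrow> U (t, \<sigma>) = V (traces \<sigma>, t)"
    using fricke_vogt[OF swap[OF U(1)], of UNIV] inv by auto
  show ?thesis
    using swap[OF V(1)] U(2) V(2) by (intro bexI[of _ "\<lambda>x. V (prod.swap x)"]) auto
qed

section \<open>The epimorphism onto SO(4)\<close>

lemma sum_mult_matrix_vector:
  fixes M :: "'a::comm_semiring_1^'n^'m"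
  shows "(\<Sum>i\<in>UNIV. (M *v x) $ i * (M *v y) $ i)
     = (\<Sum>j\<in>UNIV. \<Sum>k\<in>UNIV. (transpose M ** M) $ j $ k * (x $ j * y $ k))"
proof -
  have "(\<Sum>i\<in>UNIV. (M *v x) $ i * (M *v y) $ i)
      = (\<Sum>i\<in>UNIV. \<Sum>j\<in>UNIV. \<Sum>k\<in>UNIV. M $ i $ j * M $ i $ k * (x $ j * y $ k))"
    by (simp add: matrix_vector_mult_def sum_product ac_simps)
  also have "\<dots> = (\<Sum>j\<in>UNIV. \<Sum>k\<in>UNIV. \<Sum>i\<in>UNIV. M $ i $ j * M $ i $ k * (x $ j * y $ k))"
    by (subst sum.swap) (intro sum.cong refl, rule sum.swap)
  finally show ?thesis
    by (simp add: matrix_matrix_mult_def transpose_def sum_distrib_right)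
qed

lemma orthogonal_matrix_iff_dot:
  fixes M :: "'a::field^'n^'n"
  shows "orthogonal_matrix M \<longleftrightarrow>
    (\<forall>x y. (\<Sum>i\<in>UNIV. (M *v x) $ i * (M *v y) $ i) = (\<Sum>i\<in>UNIV. x $ i * y $ i))"
proof
  assume M: "orthogonal_matrix M"
  have "(\<Sum>k\<in>UNIV. (mat 1 :: 'a^'n^'n) $ j $ k * (x $ j * y $ k)) = x $ j * y $ j" for x y j
    by (simp add: mat_def if_distrib[where f = "\<lambda>a. a * _"] cong: if_cong)
  with M show "\<forall>x y. (\<Sum>i\<in>UNIV. (M *v x) $ i * (M *v y) $ i) = (\<Sum>i\<in>UNIV. x $ i * y $ i)"
    by (simp add: sum_mult_matrix_vector orthogonal_matrix_def)
next
  assume *: "\<forall>x y. (\<Sum>i\<in>UNIV. (M *v x) $ i * (M *v y) $ i) = (\<Sum>i\<in>UNIV. x $ i * y $ i)"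
  have "(transpose M ** M) $ j $ k = mat 1 $ j $ k" for j k
    using *[rule_format, of "axis j 1" "axis k 1"]
    by (simp add: sum_mult_matrix_vector axis_def mat_def if_distrib[where f = "\<lambda>a. _ * a"]
        if_distrib[where f = "\<lambda>a. a * _"] cong: if_cong)
  then have "transpose M ** M = mat 1"
    by (simp add: vec_eq_iff)
  then show "orthogonal_matrix M"
    using matrix_left_right_inverse by (auto simp: orthogonal_matrix_def)
qed

lemma det_orthogonal_squared:
  fixes M :: "'a::comm_ring_1^'n^'n"
  assumes "orthogonal_matrix M" shows "det M * det M = 1"
  using assms by (metis det_I det_mul det_transpose orthogonal_matrix_def)

definition inv_sqrt_2 :: complex where
  "inv_sqrt_2 = 1 / csqrt 2"

lemma inv_sqrt_2_squared: "inv_sqrt_2 * inv_sqrt_2 = 1 / 2"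
proof -
  have "csqrt 2 * csqrt 2 = 2"
    using power2_csqrt[of 2] by (simp only: power2_eq_square)
  then show ?thesis
    by (simp only: inv_sqrt_2_def times_divide_times_eq mult_1)
qed

text \<open>An explicit isometry, to which any other one reduces by an orthogonal matrix
(\<open>tensor_isometry_eq_std\<close>); with it inverses and determinants can be computed.\<close>

definition std_isometry :: "complex^4^(2 \<times> 2)" where
  "std_isometry = (\<chi> p. inv_sqrt_2 *s
       (if p = (1, 1) then vector [1, \<i>, 0, 0]
        else if p = (1, 2) then vector [0, 0, 1, \<i>]
        else if p = (2, 1) then vector [0, 0, - 1, \<i>]
        else vector [1, - \<i>, 0, 0]))"

definition std_isometry_inv :: "complex^(2 \<times> 2)^4" where
  "std_isometry_inv = transpose (\<chi> p. inv_sqrt_2 *s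
       (if p = (1, 1) then vector [1, - \<i>, 0, 0]
        else if p = (1, 2) then vector [0, 0, 1, - \<i>]
        else if p = (2, 1) then vector [0, 0, - 1, - \<i>]
        else vector [1, \<i>, 0, 0]))"

lemma vector_4_nth:
  "(vector [a, b, c, d] :: 'a::zero^4) $ 1 = a" "(vector [a, b, c, d] :: 'a^4) $ 2 = b"
  "(vector [a, b, c, d] :: 'a^4) $ 3 = c" "(vector [a, b, c, d] :: 'a^4) $ 4 = d"
  by (simp_all add: vector_def)

lemma vec_eq_2x2:
  fixes x y :: "'a^(2 \<times> 2)"
  shows "x = y \<longleftrightarrow> x $ (1, 1) = y $ (1, 1) \<and> x $ (1, 2) = y $ (1, 2) \<and>
     x $ (2, 1) = y $ (2, 1) \<and> x $ (2, 2) = y $ (2, 2)"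
  by (auto simp: vec_eq_iff forall_2)

lemma vec_eq_4:
  fixes x y :: "'a^4"
  shows "x = y \<longleftrightarrow> x $ 1 = y $ 1 \<and> x $ 2 = y $ 2 \<and> x $ 3 = y $ 3 \<and> x $ 4 = y $ 4"
  by (auto simp: vec_eq_iff forall_4)

lemma tensor_isometry_std: "tensor_isometry std_isometry"
proof -
  have "tensor_form (std_isometry *v x) (std_isometry *v y)
      = 2 * (inv_sqrt_2 * inv_sqrt_2) * (\<Sum>i\<in>UNIV. x $ i * y $ i)" for x y
    by (simp add: tensor_form_eq std_isometry_def matrix_vector_mult_def sum_4 vector_4_nth
        algebra_simps)
  then show ?thesis
    by (simp add: tensor_isometry_def inv_sqrt_2_squared)
qed

lemma std_isometry_inverse:
  "std_isometry ** std_isometry_inv = mat 1" "std_isometry_inv ** std_isometry = mat 1"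
proof -
  let ?s = inv_sqrt_2
  note s = inv_sqrt_2_squared
  have s': "?s * (?s * c) = c / 2" for c using s by (simp flip: mult.assoc)
  have i: "?s * \<i> * (?s * \<i>) = - 1 / 2"
  proof -
    have "?s * \<i> * (?s * \<i>) = (?s * ?s) * (\<i> * \<i>)" by (simp only: ac_simps)
    then show ?thesis by (simp add: s)
  qed
  show "std_isometry ** std_isometry_inv = mat 1" 
    by (simp add: vec_eq_2x2 std_isometry_def std_isometry_inv_def matrix_matrix_mult_def
        sum_4 vector_4_nth transpose_def mat_def s s' i)
  show "std_isometry_inv ** std_isometry = mat 1" 
    by (simp add: vec_eq_4 std_isometry_def std_isometry_inv_def matrix_matrix_mult_def
        sum_2x2 vector_4_nth transpose_def mat_def s s' i)
qed

lemma tensor_isometry_eq_std: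
  assumes "tensor_isometry P"
  obtains U where "orthogonal_matrix U" "P = std_isometry ** U"
proof
  define U where "U = std_isometry_inv ** P"
  show P: "P = std_isometry ** U"
    by (simp add: U_def std_isometry_inverse matrix_mul_assoc)
  show "orthogonal_matrix U"
    unfolding orthogonal_matrix_iff_dot
  proof (intro allI)
    fix x y
    have "(\<Sum>i\<in>UNIV. (U *v x) $ i * (U *v y) $ i) = tensor_form (P *v x) (P *v y)"
      using tensor_isometry_std by (simp add: tensor_isometry_def P flip: matrix_vector_mul_assoc)
    then show "(\<Sum>i\<in>UNIV. (U *v x) $ i * (U *v y) $ i) = (\<Sum>i\<in>UNIV. x $ i * y $ i)"
      using assms by (simp add: tensor_isometry_def)
  qed
qed

lemma tensor_isometry_inverse:
  assumes "tensor_isometry P"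
  shows "P ** matrix_inv P = mat 1" "matrix_inv P ** P = mat 1"
proof -
  obtain U where U: "orthogonal_matrix U" "P = std_isometry ** U"
    using assms by (rule tensor_isometry_eq_std)
  let ?Q = "transpose U ** std_isometry_inv"
  have "P ** ?Q = std_isometry ** (U ** transpose U) ** std_isometry_inv"
    by (simp add: U(2) matrix_mul_assoc)
  then have 1: "P ** ?Q = mat 1"
    using U(1) by (simp add: orthogonal_matrix_def std_isometry_inverse)
  have "?Q ** P = transpose U ** (std_isometry_inv ** std_isometry) ** U"
    by (simp add: U(2) matrix_mul_assoc)
  then have 2: "?Q ** P = mat 1"
    using U(1) by (simp add: orthogonal_matrix_def std_isometry_inverse)
  show "P ** matrix_inv P = mat 1" "matrix_inv P ** P = mat 1"
    using 1 2 matrix_inv_unique[OF 1 2] by simp_all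
qed

lemma kronecker_mult: "kronecker A B ** kronecker A' B' = kronecker (A ** A') (B ** B')"
  by (simp add: vec_eq_2x2 kronecker_def matrix_matrix_mult_def sum_2x2 sum_2 algebra_simps)

lemma kronecker_one: "kronecker (mat 1) (mat 1) = mat 1"
  by (simp add: vec_eq_2x2 kronecker_def mat_def)

lemma tensor_form_kronecker:
  assumes "A \<in> SL2" "B \<in> SL2"
  shows "tensor_form (kronecker A B *v x) (kronecker A B *v y) = tensor_form x y"
proof -
  have left: "tensor_form (kronecker A (mat 1) *v x) (kronecker A (mat 1) *v y) = tensor_form x y" for x y
  proof -
    have "tensor_form (kronecker A (mat 1) *v x) (kronecker A (mat 1) *v y)
       = (A $ 1 $ 1 * A $ 2 $ 2 - A $ 1 $ 2 * A $ 2 $ 1) * tensor_form x y"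
      by (simp add: tensor_form_eq kronecker_def mat_def matrix_vector_mult_def sum_2x2 algebra_simps)
    then show ?thesis using assms by (simp add: SL2_iff)
  qed
  have right: "tensor_form (kronecker (mat 1) B *v x) (kronecker (mat 1) B *v y) = tensor_form x y" for x y
  proof -
    have "tensor_form (kronecker (mat 1) B *v x) (kronecker (mat 1) B *v y)
       = (B $ 1 $ 1 * B $ 2 $ 2 - B $ 1 $ 2 * B $ 2 $ 1) * tensor_form x y"
      by (simp add: tensor_form_eq kronecker_def mat_def matrix_vector_mult_def sum_2x2 algebra_simps)
    then show ?thesis using assms by (simp add: SL2_iff)
  qed
  have "kronecker A B = kronecker A (mat 1) ** kronecker (mat 1) B"
    by (simp add: kronecker_mult)
  then show ?thesis
    by (simp only: matrix_vector_mul_assoc[symmetric] left right)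
qed

lemma mat_1_SL2: "mat 1 \<in> SL2"
  by (simp add: SL2_def)

text \<open>By the Cayley-Hamilton theorem \<open>(A + 1)\<^sup>2 = (tr A + 2) A\<close>, so \<open>A\<close> is a square unless \<open>tr A = -2\<close>; then \<open>- A\<close> is a
square, and so is \<open>- 1\<close>.  This serves to show that \<open>tensor_hom\<close> has determinant \<open>1\<close> and not just \<open>\<plusminus>1\<close>.\<close>

lemma SL2_product_of_squares:
  assumes "A \<in> SL2" shows "\<exists>S\<in>SL2. \<exists>T\<in>SL2. A = (S ** S) ** (T ** T)"
proof -
  have square: "\<exists>S\<in>SL2. A = S ** S" if A: "A \<in> SL2" and t: "trace A \<noteq> -2" for A
  proof -
    define r where "r = csqrt (trace A + 2)"
    have r: "r * r = A $ 1 $ 1 + A $ 2 $ 2 + 2"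
      using power2_csqrt[of "trace A + 2"] by (simp add: r_def power2_eq_square trace22)
    moreover have "r \<noteq> 0"
      using t by (simp add: r_def add_eq_0_iff2)
    ultimately have r': "A $ 1 $ 1 + A $ 2 $ 2 + 2 \<noteq> 0" by (metis mult_eq_0_iff)
    define S where "S = mat22 ((A $ 1 $ 1 + 1) / r) (A $ 1 $ 2 / r) (A $ 2 $ 1 / r) ((A $ 2 $ 2 + 1) / r)"
    have det: "A $ 1 $ 2 * A $ 2 $ 1 = A $ 1 $ 1 * A $ 2 $ 2 - 1"
      using A by (simp add: SL2_iff algebra_simps)
    have "S \<in> SL2"
      unfolding SL2_iff by (simp add: S_def r det r' divide_simps) (simp add: algebra_simps det)
    moreover have "A = S ** S"
      unfolding mat22_eq_iff mult22_nth
      by (simp add: S_def r r' divide_simps)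
        (use det in \<open>simp add: algebra_simps\<close>)
    ultimately show ?thesis by blast
  qed
  show ?thesis
  proof (cases "trace A = -2")
    case False
    then obtain S where "S \<in> SL2" "A = S ** S" using square assms by blast
    then show ?thesis
      by (intro bexI[of _ S] bexI[of _ "mat 1"]) (simp_all add: mat_1_SL2)
  next
    case True
    have "trace (- A) = - trace A"
      by (simp add: trace22)
    then have "- A \<in> SL2" "trace (- A) \<noteq> -2"
      using assms True by (simp_all add: SL2_iff)
    then obtain S where S: "S \<in> SL2" "- A = S ** S" using square by blast
    have "A = (S ** S) ** (mat22 \<i> 0 0 (-\<i>) ** mat22 \<i> 0 0 (-\<i>))"
      unfolding S(2)[symmetric] by (simp add: mat22_eq_iff mult22_nth)
    then show ?thesis
      using S(1) by (intro bexI[of _ S] bexI[of _ "mat22 \<i> 0 0 (-\<i>)"]) (simp_all add: SL2_iff)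
  qed
qed

context
  fixes P :: "complex^4^(2 \<times> 2)"
  assumes P: "tensor_isometry P"
begin

lemma tensor_hom_mult: "tensor_hom P A B ** tensor_hom P A' B' = tensor_hom P (A ** A') (B ** B')"
proof -
  have "tensor_hom P A B ** tensor_hom P A' B'
      = matrix_inv P ** (kronecker A B ** (P ** matrix_inv P) ** kronecker A' B') ** P"
    by (simp add: tensor_hom_def matrix_mul_assoc)
  then show ?thesis
    by (simp add: tensor_isometry_inverse[OF P] kronecker_mult tensor_hom_def)
qed

lemma tensor_hom_one: "tensor_hom P (mat 1) (mat 1) = mat 1"
  by (simp add: tensor_hom_def kronecker_one tensor_isometry_inverse[OF P])

lemma isometry_tensor_hom: "P ** tensor_hom P A B = kronecker A B ** P"
proof -
  have "P ** tensor_hom P A B = (P ** matrix_inv P) ** kronecker A B ** P"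
    by (simp add: tensor_hom_def matrix_mul_assoc)
  then show ?thesis by (simp add: tensor_isometry_inverse[OF P])
qed

lemma orthogonal_tensor_hom:
  assumes "A \<in> SL2" "B \<in> SL2" shows "orthogonal_matrix (tensor_hom P A B)"
  unfolding orthogonal_matrix_iff_dot
proof (intro allI)
  fix x y
  let ?M = "tensor_hom P A B"
  have "(\<Sum>i\<in>UNIV. (?M *v x) $ i * (?M *v y) $ i) = tensor_form (P *v (?M *v x)) (P *v (?M *v y))"
    using P by (simp add: tensor_isometry_def)
  also have "\<dots> = tensor_form (P *v x) (P *v y)"
    using assms by (simp add: matrix_vector_mul_assoc isometry_tensor_hom)
      (simp add: tensor_form_kronecker flip: matrix_vector_mul_assoc)
  also have "\<dots> = (\<Sum>i\<in>UNIV. x $ i * y $ i)"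
    using P by (simp add: tensor_isometry_def)
  finally show "(\<Sum>i\<in>UNIV. (?M *v x) $ i * (?M *v y) $ i) = (\<Sum>i\<in>UNIV. x $ i * y $ i)" .
qed

lemma tensor_hom_in_SO4:
  assumes A: "A \<in> SL2" and B: "B \<in> SL2" shows "tensor_hom P A B \<in> SO4"
proof -
  have sq: "det (tensor_hom P (S ** S) (T ** T)) = 1" if "S \<in> SL2" "T \<in> SL2" for S T
    using det_orthogonal_squared[OF orthogonal_tensor_hom[OF that]]
    by (simp add: det_mul flip: tensor_hom_mult)
  obtain S T where ST: "S \<in> SL2" "T \<in> SL2" "A = (S ** S) ** (T ** T)"
    using SL2_product_of_squares[OF A] by blast
  obtain S' T' where ST': "S' \<in> SL2" "T' \<in> SL2" "B = (S' ** S') ** (T' ** T')"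
    using SL2_product_of_squares[OF B] by blast
  have "tensor_hom P A B = tensor_hom P (S ** S) (S' ** S') ** tensor_hom P (T ** T) (T' ** T')"
    by (simp only: ST ST' tensor_hom_mult)
  then have "det (tensor_hom P A B) = 1"
    using ST ST' by (simp add: det_mul sq)
  then show ?thesis
    using orthogonal_tensor_hom[OF A B] by (simp add: SO4_def rotation_matrix_def)
qed

lemma matrix_inv_tensor_hom:
  assumes "A \<in> SL2" "B \<in> SL2"
  shows "matrix_inv (tensor_hom P A B) = tensor_hom P (adj22 A) (adj22 B)"
  by (rule matrix_inv_unique) (simp_all add: tensor_hom_mult adj22_inverse assms tensor_hom_one)

end

text \<open>The quadratic form is twice the determinant of a \<open>2 \<times> 2\<close> matrix, and isotropic vectors are matrices
of rank at most one.\<close>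

lemma tensor_of_isotropic:
  assumes "tensor_form z z = 0" obtains u v where "z = tensor u v"
proof -
  have z: "z $ (1, 1) * z $ (2, 2) = z $ (1, 2) * z $ (2, 1)"
    using assms by (simp add: tensor_form_eq algebra_simps)
  have eq: "z = tensor u v" if "z $ (1, 1) = u $ 1 * v $ 1" "z $ (1, 2) = u $ 1 * v $ 2"
    "z $ (2, 1) = u $ 2 * v $ 1" "z $ (2, 2) = u $ 2 * v $ 2" for u v
    using that by (simp add: vec_eq_2x2 tensor_def)
  show thesis
  proof (cases "z $ (1, 1) = 0")
    case False
    then show ?thesis
      using z by (intro that[of "vector [z $ (1, 1), z $ (2, 1)]" "vector [1, z $ (1, 2) / z $ (1, 1)]"] eq)
        (simp_all add: field_simps)
  next
    case True
    then consider "z $ (1, 2) = 0" | "z $ (2, 1) = 0" using z by auto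
    then show ?thesis
    proof cases
      case 1
      then show ?thesis
        using True by (intro that[of "vector [0, 1]" "vector [z $ (2, 1), z $ (2, 2)]"] eq) simp_all
    next
      case 2
      then show ?thesis
        using True by (intro that[of "vector [z $ (1, 2), z $ (2, 2)]" "vector [0, 1]"] eq) simp_all
    qed
  qed
qed

lemma det2_expand:
  assumes "det2 u u' = 1" shows "s = det2 s u' *s u + det2 u s *s u'"
proof -
  have d: "u $ 1 * u' $ 2 - u $ 2 * u' $ 1 = 1" using assms by (simp add: det2_eq)
  have "(u $ 1 * u' $ 2 - u $ 2 * u' $ 1) *s s = det2 s u' *s u + det2 u s *s u'"
    by (simp add: vec_eq_iff forall_2 det2_eq algebra_simps)
  then show ?thesis by (simp only: d vector_smult_lid)
qed

lemma det2_swap: "det2 v u = - det2 u v"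
  by (simp add: det2_eq)

lemma det2_basis:
  assumes "det2 u u' = 1"
  shows "det2 u s = 0 \<Longrightarrow> \<exists>c. s = c *s u" and "det2 u' s = 0 \<Longrightarrow> \<exists>c. s = c *s u'"
    and "det2 u s = 0 \<Longrightarrow> det2 u' s = 0 \<Longrightarrow> s = 0"
proof -
  note s = det2_expand[OF assms, of s]
  show "\<exists>c. s = c *s u" if "det2 u s = 0"
    using s unfolding that by (metis add.right_neutral vector_smult_lzero)
  show "\<exists>c. s = c *s u'" if "det2 u' s = 0"
  proof -
    have "det2 s u' = 0" using that det2_swap[of s u'] by simp
    then show ?thesis using s by (metis add.left_neutral vector_smult_lzero)
  qed
  show "s = 0" if "det2 u s = 0" "det2 u' s = 0"
  proof -
    have "det2 s u' = 0" using that det2_swap[of s u'] by simp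
    then show ?thesis using s that(1) by (metis add.left_neutral vector_smult_lzero)
  qed
qed

lemma tensor_scale: "tensor (a *s u) (b *s v) = (a * b) *s tensor u v"
  by (simp add: vec_eq_iff tensor_def)

lemma tensor_form_scale: "tensor_form (a *s x) (b *s y) = a * b * tensor_form x y"
  by (simp add: tensor_form_eq algebra_simps)

lemma det2_scale: "det2 (a *s u) (b *s v) = a * b * det2 u v"
  by (simp add: det2_eq algebra_simps)

lemma tensor_form_commute: "tensor_form x y = tensor_form y x"
  by (simp add: tensor_form_eq algebra_simps)

lemma det2_self: "det2 u u = 0"
  by (simp add: det2_eq)

text \<open>The images of the basis vectors \<open>e\<^sub>i \<otimes> e\<^sub>j\<close> under an isometry.  All are pure tensors; orthogonal pure tensors
have the left or the right factors proportional.  So \<open>x12\<close> and \<open>x21\<close> lie on the lines of \<open>a1 \<otimes> b2\<close> and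
\<open>a2 \<otimes> b1\<close>, in one of two orders; the scalars are absorbed into the vectors.\<close>

lemma hyperbolic_basis:
  assumes iso: "tensor_form x11 x11 = 0" "tensor_form x12 x12 = 0" "tensor_form x21 x21 = 0"
      "tensor_form x22 x22 = 0"
    and orth: "tensor_form x11 x12 = 0" "tensor_form x11 x21 = 0" "tensor_form x22 x12 = 0"
      "tensor_form x22 x21 = 0"
    and dual: "tensor_form x11 x22 = 1" "tensor_form x12 x21 = -1"
  shows "\<exists>a1 a2 b1 b2. det2 a1 a2 = 1 \<and> det2 b1 b2 = 1 \<and> x11 = tensor a1 b1 \<and> x22 = tensor a2 b2 \<and>
     (x12 = tensor a1 b2 \<and> x21 = tensor a2 b1 \<or> x21 = tensor a1 b2 \<and> x12 = tensor a2 b1)"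
proof -
  obtain u v where x11: "x11 = tensor u v" using iso(1) tensor_of_isotropic by blast
  obtain u0 v0 where x22': "x22 = tensor u0 v0" using iso(4) tensor_of_isotropic by blast
  define d where "d = det2 u u0"
  have "d * det2 v v0 = 1"
    using dual(1) by (simp add: x11 x22' tensor_form_tensor d_def)
  then have d: "d \<noteq> 0" "det2 v v0 = 1 / d"
    by (auto simp: eq_divide_eq mult.commute)
  \<comment> \<open>\<open>u0\<close> and \<open>v0\<close> are rescaled inversely, so that both determinants become \<open>1\<close>\<close>
  define u' v' where "u' = (1 / d) *s u0" and "v' = d *s v0"
  have uu': "det2 u u' = 1"
    using det2_scale[of 1 u "1 / d" u0] d by (simp add: u'_def d_def[symmetric])
  have vv': "det2 v v' = 1"
    using det2_scale[of 1 v d v0] d by (simp add: v'_def)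
  have x22: "x22 = tensor u' v'"
    using d by (simp add: u'_def v'_def x22' tensor_scale)
  \<comment> \<open>an isotropic vector orthogonal to both lies on one of the two remaining lines\<close>
  have lines: "(\<exists>c. x = c *s tensor u v') \<or> (\<exists>c. x = c *s tensor u' v)"
    if x: "tensor_form x x = 0" "tensor_form x11 x = 0" "tensor_form x22 x = 0" for x
  proof -
    obtain s t where st: "x = tensor s t" using x(1) tensor_of_isotropic by blast
    have "det2 u s = 0 \<or> det2 v t = 0" "det2 u' s = 0 \<or> det2 v' t = 0"
      using x by (auto simp: st x11 x22 tensor_form_tensor)
    then consider "det2 u s = 0" "det2 v' t = 0" | "det2 v t = 0" "det2 u' s = 0"
      | "det2 u s = 0" "det2 u' s = 0" | "det2 v t = 0" "det2 v' t = 0" by blast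
    then show ?thesis
    proof cases
      case 1
      then show ?thesis unfolding st
        using det2_basis(1)[OF uu', of s] det2_basis(2)[OF vv', of t] by (metis tensor_scale)
    next
      case 2
      then show ?thesis unfolding st
        using det2_basis(2)[OF uu', of s] det2_basis(1)[OF vv', of t] by (metis tensor_scale)
    next
      case 3
      then have "s = 0" by (rule det2_basis(3)[OF uu'])
      then have "x = 0 *s tensor u v'" by (simp add: st tensor_def vec_eq_iff)
      then show ?thesis by blast
    next
      case 4
      then have "t = 0" by (rule det2_basis(3)[OF vv'])
      then have "x = 0 *s tensor u v'" by (simp add: st tensor_def vec_eq_iff)
      then show ?thesis by blast
    qed
  qed
  have main: "\<exists>a1 a2 b1 b2. det2 a1 a2 = 1 \<and> det2 b1 b2 = 1 \<and> x11 = tensor a1 b1 \<and> x22 = tensor a2 b2 \<and>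
     x = tensor a1 b2 \<and> y = tensor a2 b1"
    if x: "x = c *s tensor u v'" and y: "y = c' *s tensor u' v" and xy: "tensor_form x y = -1" for x y c c'
  proof -
    have "c * c' = 1"
      using xy uu' vv' det2_swap[of v' v] by (simp add: x y tensor_form_scale tensor_form_tensor)
    \<comment> \<open>a square root of \<open>c\<close> spreads the scalars \<open>c\<close> and \<open>1 / c\<close> evenly over the four vectors\<close>
    define l where "l = csqrt c"
    have l: "l * l = c" "l \<noteq> 0"
      using \<open>c * c' = 1\<close> power2_csqrt[of c] by (auto simp: l_def power2_eq_square)
    have c': "c' = 1 / l * (1 / l)"
      using \<open>c * c' = 1\<close> l by (auto simp: field_simps)
    show ?thesis
      using l by (intro exI[of _ "l *s u"] exI[of _ "(1 / l) *s u'"] exI[of _ "(1 / l) *s v"] exI[of _ "l *s v'"])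
        (simp add: det2_scale uu' vv' tensor_scale x11 x22 x y c')
  qed
  from lines[OF iso(2) orth(1,3)] lines[OF iso(3) orth(2,4)]
  consider c c' where "x12 = c *s tensor u v'" "x21 = c' *s tensor u' v"
    | c c' where "x21 = c *s tensor u v'" "x12 = c' *s tensor u' v"
    | c c' where "x12 = c *s tensor u v'" "x21 = c' *s tensor u v'"
    | c c' where "x12 = c *s tensor u' v" "x21 = c' *s tensor u' v" by blast
  then show ?thesis
  proof cases
    case 1
    then show ?thesis using main[OF 1 dual(2)] by blast
  next
    case 2
    then show ?thesis using main[OF 2] dual(2) tensor_form_commute[of x12] by metis
  qed (use dual(2) in \<open>simp_all add: tensor_form_scale tensor_form_tensor det2_self\<close>)
qed

definition swap_factors :: "complex^(2 \<times> 2)^(2 \<times> 2)" where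
  "swap_factors = (\<chi> p q. if p = prod.swap q then 1 else 0)"

text \<open>In the orthonormal basis given by \<open>std_isometry\<close>, exchanging the tensor factors is the reflection in the third
coordinate.\<close>

lemma det_conj_swap_factors:
  assumes "tensor_isometry P" shows "det (matrix_inv P ** swap_factors ** P) = -1"
proof -
  obtain U where U: "orthogonal_matrix U" "P = std_isometry ** U"
    using assms by (rule tensor_isometry_eq_std)
  define D :: "complex^4^4" where "D = (\<chi> i j. if i = j then if i = 3 then -1 else 1 else 0)"
  have D: "swap_factors ** std_isometry = std_isometry ** D"
    by (simp add: vec_eq_2x2 vec_eq_4 swap_factors_def std_isometry_def D_def matrix_matrix_mult_def
        sum_2x2 sum_4 vector_4_nth)
  have "matrix_inv P ** swap_factors ** P = matrix_inv P ** (swap_factors ** std_isometry) ** U"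
    by (simp add: U(2) matrix_mul_assoc)
  also have "\<dots> = (matrix_inv P ** std_isometry) ** D ** U"
    by (simp add: D matrix_mul_assoc)
  finally have "det (matrix_inv P ** swap_factors ** P) = det (matrix_inv P ** std_isometry) * det D * det U"
    by (simp add: det_mul)
  moreover have "det (matrix_inv P ** std_isometry) * det U = 1"
    proof -
    have "matrix_inv P ** std_isometry ** U = mat 1"
      using tensor_isometry_inverse(2)[OF assms] U(2) by (simp only: matrix_mul_assoc)
    then show ?thesis by (metis det_I det_mul)
  qed
  moreover have "det D = -1"
  proof -
    have "det D = (\<Prod>i\<in>UNIV. D $ i $ i)"
      by (rule det_diagonal) (simp add: D_def)
    also have "\<dots> = (\<Prod>i\<in>{1, 2, 3, 4}. D $ i $ i)"
      by (simp only: UNIV_4)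
    also have "\<dots> = -1"
      by (simp add: D_def)
    finally show ?thesis .
  qed
  ultimately show ?thesis by (simp add: algebra_simps)
qed

text \<open>An isometry maps the standard basis to a basis as in \<open>hyperbolic_basis\<close>, hence is \<open>A \<otimes> B\<close> or \<open>A \<otimes> B\<close> after the
exchange of the factors; the latter has determinant \<open>- 1\<close>.\<close>

theorem tensor_hom_surj:
  assumes P: "tensor_isometry P" and M: "M \<in> SO4"
  shows "\<exists>A\<in>SL2. \<exists>B\<in>SL2. M = tensor_hom P A B"
proof -
  let ?Q = "matrix_inv P"
  note inv = tensor_isometry_inverse[OF P]
  define N where "N = P ** M ** ?Q"
  have QNP: "?Q ** N ** P = M"
  proof -
    have "?Q ** N ** P = (?Q ** P) ** M ** (?Q ** P)"
      by (simp only: N_def matrix_mul_assoc)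
    then show ?thesis by (simp add: inv)
  qed
  have form: "tensor_form (N *v x) (N *v y) = tensor_form x y" for x y
  proof -
    have "tensor_form (N *v x) (N *v y) = (\<Sum>i\<in>UNIV. (M *v (?Q *v x)) $ i * (M *v (?Q *v y)) $ i)"
      using P by (simp add: N_def tensor_isometry_def flip: matrix_vector_mul_assoc)
    also have "\<dots> = (\<Sum>i\<in>UNIV. (?Q *v x) $ i * (?Q *v y) $ i)"
      using M by (simp add: SO4_def rotation_matrix_def orthogonal_matrix_iff_dot)
    also have "\<dots> = tensor_form (P *v (?Q *v x)) (P *v (?Q *v y))"
      using P by (simp add: tensor_isometry_def)
    finally show ?thesis by (simp add: matrix_vector_mul_assoc inv)
  qed
  define x where "x k l = N *v axis (k, l) 1" for k l
  have x_nth: "x k l $ p = N $ p $ (k, l)" for k l p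
    by (simp add: x_def matrix_vector_mult_def axis_def if_distrib[where f = "\<lambda>a. _ * a"] cong: if_cong)
  have gram: "tensor_form (x k l) (x k' l') = tensor_form (axis (k, l) 1) (axis (k', l') 1)" for k l k' l'
    by (simp add: x_def form)
  obtain a1 a2 b1 b2 where ab: "det2 a1 a2 = 1" "det2 b1 b2 = 1" "x 1 1 = tensor a1 b1" "x 2 2 = tensor a2 b2"
     "x 1 2 = tensor a1 b2 \<and> x 2 1 = tensor a2 b1 \<or> x 2 1 = tensor a1 b2 \<and> x 1 2 = tensor a2 b1"
  proof -
    have "tensor_form (x 1 1) (x 1 1) = 0" "tensor_form (x 1 2) (x 1 2) = 0"
      "tensor_form (x 2 1) (x 2 1) = 0" "tensor_form (x 2 2) (x 2 2) = 0"
      "tensor_form (x 1 1) (x 1 2) = 0" "tensor_form (x 1 1) (x 2 1) = 0"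
      "tensor_form (x 2 2) (x 1 2) = 0" "tensor_form (x 2 2) (x 2 1) = 0"
      "tensor_form (x 1 1) (x 2 2) = 1" "tensor_form (x 1 2) (x 2 1) = -1"
      unfolding gram by (simp_all add: tensor_form_eq axis_def)
    from hyperbolic_basis[OF this] show thesis
      using that by blast
  qed
  define A where "A = mat22 (a1 $ 1) (a2 $ 1) (a1 $ 2) (a2 $ 2)"
  define B where "B = mat22 (b1 $ 1) (b2 $ 1) (b1 $ 2) (b2 $ 2)"
  have AB: "A \<in> SL2" "B \<in> SL2"
    using ab(1,2) by (simp_all add: A_def B_def SL2_iff det2_eq algebra_simps)
  from ab(5) show ?thesis
  proof
    assume "x 1 2 = tensor a1 b2 \<and> x 2 1 = tensor a2 b1"
    then have "N = kronecker A B"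
      using ab(3,4) by (simp add: vec_eq_2x2 kronecker_def x_nth tensor_def A_def B_def)
    then show ?thesis
      using AB QNP by (auto simp: tensor_hom_def)
  next
    assume "x 2 1 = tensor a1 b2 \<and> x 1 2 = tensor a2 b1"
    then have N: "N = kronecker A B ** swap_factors"
      using ab(3,4) by (simp add: vec_eq_2x2 kronecker_def x_nth tensor_def A_def B_def
          matrix_matrix_mult_def sum_2x2 swap_factors_def)
    then have "M = tensor_hom P A B ** (?Q ** swap_factors ** P)"
    proof -
      have "tensor_hom P A B ** (?Q ** swap_factors ** P) =
          ?Q ** (kronecker A B ** (P ** ?Q) ** swap_factors) ** P"
        by (simp only: tensor_hom_def matrix_mul_assoc)
      then show ?thesis
        using QNP by (simp add: inv N)
    qed
    then have "det M = -1"
      using tensor_hom_in_SO4[OF P AB] det_conj_swap_factors[OF P]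
      by (simp add: det_mul SO4_def rotation_matrix_def)
    then show ?thesis
      using M by (simp add: SO4_def rotation_matrix_def)
  qed
qed

section \<open>The generators as functions on SO(4)\<close>

lemma alg_sum: "(\<And>i. i \<in> K \<Longrightarrow> f i \<in> alg S) \<Longrightarrow> (\<lambda>x. \<Sum>i\<in>K. f i x) \<in> alg S"
  by (induction K rule: infinite_finite_induct) (auto intro: alg.const alg.add)

definition SL2_reps :: "(nat \<Rightarrow> 2 rep) set" where
  "SL2_reps = {\<rho>. \<forall>j\<in>{1, 2}. \<rho> j \<in> SL2 \<times> SL2}"

text \<open>\<open>F\<close>, a function of two pairs in SL(2), comes from a regular function on pairs in SO(4).\<close>

definition descends :: "complex^4^(2 \<times> 2) \<Rightarrow> ((nat \<Rightarrow> 2 rep) \<Rightarrow> complex) \<Rightarrow> bool" where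
  "descends P F \<longleftrightarrow> (\<exists>q\<in>alg entry_functions. \<forall>\<rho>\<in>SL2_reps. F \<rho> = q (induced_rep P \<rho>))"

lemma descends_cong: "descends P F \<Longrightarrow> (\<And>\<rho>. \<rho> \<in> SL2_reps \<Longrightarrow> F \<rho> = F' \<rho>) \<Longrightarrow> descends P F'"
  unfolding descends_def by metis

lemma descends_mult: "descends P F \<Longrightarrow> descends P F' \<Longrightarrow> descends P (\<lambda>\<rho>. F \<rho> * F' \<rho>)"
  unfolding descends_def
  by (elim bexE, rename_tac q q', rule_tac x = "\<lambda>\<sigma>. q \<sigma> * q' \<sigma>" in bexI) (auto intro: alg.mult)

lemma descends_diff: "descends P F \<Longrightarrow> descends P F' \<Longrightarrow> descends P (\<lambda>\<rho>. F \<rho> - F' \<rho>)"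
  unfolding descends_def
  by (elim bexE, rename_tac q q', rule_tac x = "\<lambda>\<sigma>. q \<sigma> - q' \<sigma>" in bexI) (auto intro: alg_diff)

lemma descends_sum:
  assumes "\<And>i. descends P (F i)" shows "descends P (\<lambda>\<rho>. \<Sum>i\<in>K. F i \<rho>)"
proof -
  obtain q where "\<And>i. q i \<in> alg entry_functions" "\<And>i \<rho>. \<rho> \<in> SL2_reps \<Longrightarrow> F i \<rho> = q i (induced_rep P \<rho>)"
    using assms unfolding descends_def by metis
  then show ?thesis
    unfolding descends_def by (intro bexI[of _ "\<lambda>\<sigma>. \<Sum>i\<in>K. q i \<sigma>"]) (auto intro: alg_sum)
qed

lemma kronecker_entries_descend:
  assumes P: "tensor_isometry P"
  shows "descends P (\<lambda>\<rho>. fst (\<rho> 1) $ a $ b * fst (\<rho> 2) $ c $ d)" (is ?fst)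
    and "descends P (\<lambda>\<rho>. snd (\<rho> 1) $ a $ b * snd (\<rho> 2) $ c $ d)" (is ?snd)
proof -
  have "kronecker A B = P ** tensor_hom P A B ** matrix_inv P" for A B
    by (simp add: isometry_tensor_hom[OF P] tensor_isometry_inverse[OF P] flip: matrix_mul_assoc)
  then have "kronecker A B $ (a, c) $ (b, d) = (P ** tensor_hom P A B ** matrix_inv P) $ (a, c) $ (b, d)" for A B
    by metis
  then have *: "A $ a $ b * B $ c $ d = (\<Sum>j\<in>UNIV. (\<Sum>i\<in>UNIV. P $ (a, c) $ i * tensor_hom P A B $ i $ j)
      * matrix_inv P $ j $ (b, d))" for A B
    by (simp add: kronecker_def matrix_matrix_mult_def)
  show ?fst
    unfolding descends_def
    by (rule bexI[of _ "\<lambda>\<sigma>. \<Sum>j\<in>UNIV. (\<Sum>i\<in>UNIV. P $ (a, c) $ i * fst \<sigma> $ i $ j) * matrix_inv P $ j $ (b, d)"])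
      (auto simp: induced_rep_def * intro!: alg_intros alg_sum entry_in_alg)
  show ?snd
    unfolding descends_def
    by (rule bexI[of _ "\<lambda>\<sigma>. \<Sum>j\<in>UNIV. (\<Sum>i\<in>UNIV. P $ (a, c) $ i * snd \<sigma> $ i $ j) * matrix_inv P $ j $ (b, d)"])
      (auto simp: induced_rep_def * intro!: alg_intros alg_sum entry_in_alg)
qed

text \<open>For \<open>j = k\<close> the product is multiplied by the determinant of the matrix in the other factor, which is
\<open>1\<close>.  Every term is then a product of two mixed ones.\<close>

lemma same_letter_products_descend:
  assumes mixed: "\<And>a b c d. descends P (\<lambda>\<rho>. M (\<rho> 1) $ a $ b * M (\<rho> 2) $ c $ d)"
    and SL2: "\<And>\<rho>. \<rho> \<in> SL2 \<times> SL2 \<Longrightarrow> M \<rho> \<in> SL2"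
    and jk: "j \<in> {1, 2}" "k \<in> {1, 2}"
  shows "descends P (\<lambda>\<rho>. M (\<rho> j) $ a $ b * M (\<rho> k) $ c $ d)"
proof -
  have det: "M (\<rho> j) $ 1 $ 1 * M (\<rho> j) $ 2 $ 2 - M (\<rho> j) $ 1 $ 2 * M (\<rho> j) $ 2 $ 1 = 1"
    if "\<rho> \<in> SL2_reps" "j \<in> {1, 2}" for \<rho> j
    using that SL2 by (auto simp: SL2_reps_def simp flip: SL2_iff)
  have expand: "x * y = (x * p) * (y * s) - (x * q) * (y * r)" if "p * s - q * r = 1"
    for x y p q r s :: complex
  proof -
    have "(x * p) * (y * s) - (x * q) * (y * r) = x * y * (p * s - q * r)"
      by (simp add: algebra_simps)
    then show ?thesis using that by simp
  qed
  consider "j = 1" "k = 2" | "j = 2" "k = 1" | "j = 1" "k = 1" | "j = 2" "k = 2"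
    using jk by auto
  then show ?thesis
  proof cases
    case 1
    then show ?thesis using mixed by simp
  next
    case 2
    then show ?thesis using mixed[of c d a b] by (simp add: mult.commute)
  next
    case 3
    show ?thesis
      unfolding 3
    proof (rule descends_cong)
      show "descends P (\<lambda>\<rho>. (M (\<rho> 1) $ a $ b * M (\<rho> 2) $ 1 $ 1) * (M (\<rho> 1) $ c $ d * M (\<rho> 2) $ 2 $ 2)
          - (M (\<rho> 1) $ a $ b * M (\<rho> 2) $ 1 $ 2) * (M (\<rho> 1) $ c $ d * M (\<rho> 2) $ 2 $ 1))"
        by (intro descends_diff descends_mult mixed)
    qed (rule expand[symmetric], rule det, auto)
  next
    case 4
    show ?thesis
      unfolding 4
    proof (rule descends_cong)
      show "descends P (\<lambda>\<rho>. (M (\<rho> 1) $ 1 $ 1 * M (\<rho> 2) $ a $ b) * (M (\<rho> 1) $ 2 $ 2 * M (\<rho> 2) $ c $ d)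
          - (M (\<rho> 1) $ 1 $ 2 * M (\<rho> 2) $ a $ b) * (M (\<rho> 1) $ 2 $ 1 * M (\<rho> 2) $ c $ d))"
        by (intro descends_diff descends_mult mixed)
    next
      fix \<rho> assume "\<rho> \<in> SL2_reps"
      from expand[OF det[OF this, of 1], of "M (\<rho> 2) $ a $ b" "M (\<rho> 2) $ c $ d"]
      show "(M (\<rho> 1) $ 1 $ 1 * M (\<rho> 2) $ a $ b) * (M (\<rho> 1) $ 2 $ 2 * M (\<rho> 2) $ c $ d)
          - (M (\<rho> 1) $ 1 $ 2 * M (\<rho> 2) $ a $ b) * (M (\<rho> 1) $ 2 $ 1 * M (\<rho> 2) $ c $ d)
          = M (\<rho> 2) $ a $ b * M (\<rho> 2) $ c $ d"
        by (simp add: mult.commute)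
    qed
  qed
qed

text \<open>Expanded in the matrix entries, each generator has degree zero or two in each of the two
letters, so that \<open>same_letter_products_descend\<close> applies to the entries of each letter.\<close>

lemma gen_value_descends:
  assumes P: "tensor_isometry P" and g: "g \<in> gens"
  shows "descends P (gen_value g)"
proof -
  have A: "descends P (\<lambda>\<rho>. fst (\<rho> j) $ a $ b * fst (\<rho> k) $ c $ d)"
    if "j \<in> {1, 2}" "k \<in> {1, 2}" for j k a b c d
    by (rule same_letter_products_descend[where M = fst, OF kronecker_entries_descend(1)[OF P]]) (use that in auto)
  have B: "descends P (\<lambda>\<rho>. snd (\<rho> j) $ a $ b * snd (\<rho> k) $ c $ d)"
    if "j \<in> {1, 2}" "k \<in> {1, 2}" for j k a b c d
    by (rule same_letter_products_descend[where M = snd, OF kronecker_entries_descend(2)[OF P]]) (use that in auto)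
  from g consider j k where "g = Gen_a 1 j k" "j \<in> {1, 2}" "k \<in> {1, 2}"
    | j k where "g = Gen_a 2 j k" "j \<in> {1, 2}" "k \<in> {1, 2}"
    | j k where "g = Gen_b j k" "j \<in> {1, 2}" "k \<in> {1, 2}"
    | i j k where "g = Gen_c i j k" "i \<in> {1, 2}" "j \<in> {1, 2}" "k \<in> {1, 2}"
    unfolding gens_def by blast
  then show ?thesis
  proof cases
    case 1
    have "gen_value g = (\<lambda>\<rho>. \<Sum>p\<in>UNIV. \<Sum>q\<in>UNIV. fst (\<rho> j) $ p $ p * fst (\<rho> k) $ q $ q)"
      by (rule ext) (simp add: 1(1) tau_def trace_def sum_product)
    then show ?thesis
      using 1 by (simp only:) (intro descends_sum A)
  next
    case 2
    have "gen_value g = (\<lambda>\<rho>. \<Sum>p\<in>UNIV. \<Sum>q\<in>UNIV. snd (\<rho> j) $ p $ p * snd (\<rho> k) $ q $ q)"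
      by (rule ext) (simp add: 2(1) tau_def trace_def sum_product)
    then show ?thesis
      using 2 by (simp only:) (intro descends_sum B)
  next
    case 3
    have "gen_value g = (\<lambda>\<rho>. \<Sum>p\<in>UNIV. \<Sum>r\<in>UNIV. \<Sum>q\<in>UNIV. \<Sum>s\<in>UNIV.
        (fst (\<rho> j) $ p $ q * fst (\<rho> k) $ r $ s) * (snd (\<rho> j) $ q $ p * snd (\<rho> k) $ s $ r))"
      by (rule ext) (simp add: 3(1) tau12_def trace_def matrix_matrix_mult_def sum_product ac_simps)
    then show ?thesis
      using 3 by (simp only:) (intro descends_sum descends_mult A B)
  next
    case 4
    have "gen_value g = (\<lambda>\<rho>. \<Sum>p\<in>UNIV. \<Sum>r\<in>UNIV. \<Sum>q\<in>UNIV. \<Sum>s\<in>UNIV.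
        (fst (\<rho> i) $ p $ p * fst (\<rho> k) $ r $ s) * (snd (\<rho> j) $ q $ q * snd (\<rho> k) $ s $ r))"
      by (rule ext) (simp add: 4(1) tau_def tau12_def trace_def matrix_matrix_mult_def sum_product ac_simps)
    then show ?thesis
      using 4 by (simp only:) (intro descends_sum descends_mult A B)
  qed
qed

section \<open>Invariants of the sign changes\<close>

inductive_set linspan :: "('x \<Rightarrow> complex) set \<Rightarrow> ('x \<Rightarrow> complex) set" for M where
  zero: "(\<lambda>_. 0) \<in> linspan M"
| add: "f \<in> M \<Longrightarrow> g \<in> linspan M \<Longrightarrow> (\<lambda>x. c * f x + g x) \<in> linspan M"

lemma alg_subset_linspan:
  assumes one: "(\<lambda>_. 1) \<in> M" and mult: "\<And>f g. f \<in> M \<Longrightarrow> g \<in> M \<Longrightarrow> (\<lambda>x. f x * g x) \<in> M"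
    and f: "f \<in> alg M"
  shows "f \<in> linspan M"
proof -
  have add: "(\<lambda>x. f x + g x) \<in> linspan M" if "f \<in> linspan M" "g \<in> linspan M" for f g
    using that by induction (auto simp: add.assoc intro: linspan.add)
  have M_mult: "(\<lambda>x. c * m x * g x) \<in> linspan M" if "g \<in> linspan M" "m \<in> M" for m g c
    using that
  proof induction
    case zero
    then show ?case by (simp add: linspan.zero)
  next
    case (add f g d)
    then have "(\<lambda>x. (c * d) * (m x * f x) + c * m x * g x) \<in> linspan M"
      by (intro linspan.add mult)
    then show ?case by (simp add: algebra_simps)
  qed
  have mult': "(\<lambda>x. f x * g x) \<in> linspan M" if "f \<in> linspan M" "g \<in> linspan M" for f g
    using that
  proof induction
    case zero
    then show ?case by (simp add: linspan.zero)
  next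
    case (add m f c)
    then show ?case
      using M_mult[of g m c] \<open>\<And>f g. f \<in> linspan M \<Longrightarrow> g \<in> linspan M \<Longrightarrow> (\<lambda>x. f x + g x) \<in> linspan M\<close>
      by (simp add: distrib_right)
  qed
  show ?thesis
    using f
  proof induction
    case (const c)
    show ?case using linspan.add[OF one linspan.zero, of c] by simp
  next
    case (gen f)
    then show ?case using linspan.add[OF gen linspan.zero, of 1] by simp
  qed (auto intro: add mult')
qed

definition trace_coordinates :: "((nat \<Rightarrow> nat \<Rightarrow> complex) \<Rightarrow> complex) set" where
  "trace_coordinates = {\<lambda>X. X i j |i j. i \<in> {1, 2, 3} \<and> j \<in> {1, 2}}"

definition trace_monoms :: "((nat \<Rightarrow> nat \<Rightarrow> complex) \<Rightarrow> complex) set" where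
  "trace_monoms = {trace_monom (J, K, L) |J K L.
     set_mset J \<subseteq> {1, 2} \<and> set_mset K \<subseteq> {1, 2} \<and> set_mset L \<subseteq> {1, 2}}"

lemma alg_trace_coordinates_linspan:
  assumes "f \<in> alg trace_coordinates" shows "f \<in> linspan trace_monoms"
proof (rule alg_subset_linspan)
  show "(\<lambda>_. 1) \<in> trace_monoms"
    unfolding trace_monoms_def
    by (intro CollectI exI[of _ "{#}"]) (auto simp: trace_monom_def)
  show "(\<lambda>X. f X * g X) \<in> trace_monoms" if fg: "f \<in> trace_monoms" "g \<in> trace_monoms" for f g
  proof -
    obtain J K L where f: "f = trace_monom (J, K, L)" "set_mset (J + K + L) \<subseteq> {1, 2}"
      using fg(1) unfolding trace_monoms_def by auto
    obtain J' K' L' where g: "g = trace_monom (J', K', L')" "set_mset (J' + K' + L') \<subseteq> {1, 2}"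
      using fg(2) unfolding trace_monoms_def by auto
    have "(\<lambda>X. f X * g X) = trace_monom (J + J', K + K', L + L')"
      by (simp add: f g trace_monom_def fun_eq_iff)
    then show ?thesis
      using f(2) g(2) unfolding trace_monoms_def
      by (intro CollectI exI[of _ "J + J'"] exI[of _ "K + K'"] exI[of _ "L + L'"]) auto
  qed
  have "(\<lambda>X. X i j) \<in> trace_monoms" if ij: "i \<in> {1, 2, 3}" "j \<in> {1, 2}" for i j :: nat
  proof -
    have "(\<lambda>X. X i j) = trace_monom (if i = 1 then {#j#} else {#}, if i = 2 then {#j#} else {#},
        if i = 3 then {#j#} else {#})"
      using ij by (auto simp: trace_monom_def fun_eq_iff)
    then show ?thesis
      using ij unfolding trace_monoms_def by fastforce
  qed
  then have "trace_coordinates \<subseteq> trace_monoms"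
    unfolding trace_coordinates_def by blast
  then show "f \<in> alg trace_monoms"
    using alg_compose[OF assms, where \<phi> = "\<lambda>X. X"] by (blast intro: alg.gen)
qed

text \<open>The effect on the traces of multiplying the images of \<open>\<gamma>\<^sub>1\<close> and \<open>\<gamma>\<^sub>2\<close> by the signs \<open>s\<close> and \<open>t\<close>.\<close>

definition sign_change :: "complex \<Rightarrow> complex \<Rightarrow> (nat \<Rightarrow> nat \<Rightarrow> complex) \<Rightarrow> (nat \<Rightarrow> nat \<Rightarrow> complex)" where
  "sign_change s t X = (\<lambda>i j. (if i = 1 then s else if i = 2 then t else s * t) * X i j)"

definition sign_average :: "((nat \<Rightarrow> nat \<Rightarrow> complex) \<Rightarrow> complex) \<Rightarrow> (nat \<Rightarrow> nat \<Rightarrow> complex) \<Rightarrow> complex" where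
  "sign_average f X = (f X + f (sign_change (-1) 1 X) + f (sign_change 1 (-1) X)
     + f (sign_change (-1) (-1) X)) / 4"

lemma trace_monom_sign_change:
  "trace_monom (J, K, L) (sign_change s t X) =
     s ^ size J * t ^ size K * (s * t) ^ size L * trace_monom (J, K, L) X"
proof -
  have c: "(\<Prod>j\<in>#A. c) = c ^ size A" for A :: "nat multiset" and c :: complex
    by (induction A) auto
  have "trace_monom (J, K, L) (sign_change s t X)
     = trace_monom (J, K, L) (\<lambda>i j. if i = 1 then s else if i = 2 then t else s * t) * trace_monom (J, K, L) X"
    unfolding sign_change_def by (rule trace_monom_mult)
  then show ?thesis
    by (simp add: trace_monom_def c)
qed

lemma sign_average_trace_monom:
  assumes "set_mset J \<subseteq> {1, 2}" "set_mset K \<subseteq> {1, 2}" "set_mset L \<subseteq> {1, 2}"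
  shows "sign_average (trace_monom (J, K, L)) X =
    (if (J, K, L) \<in> valid_exponents then trace_monom (J, K, L) X else 0)"
  unfolding sign_average_def trace_monom_sign_change valid_exponents_def
  using assms by (auto simp: minus_one_power_iff)

text \<open>Averaging over the four sign changes projects the span of all monomials onto the span of those that
are values of normal forms.\<close>

lemma sign_average_in_image:
  assumes "f \<in> linspan trace_monoms"
  shows "\<exists>p\<in>polys_in gens. \<forall>X. mpoly_eval (gen_monom X) p = sign_average f X"
  using assms
proof induction
  case zero
  show ?case by (intro bexI[of _ 0]) (auto simp: sign_average_def)
next
  case (add f g c)
  then obtain p where p: "p \<in> polys_in gens" "\<And>X. mpoly_eval (gen_monom X) p = sign_average g X"
    by blast
  obtain J K L where f: "f = trace_monom (J, K, L)" "set_mset J \<subseteq> {1, 2}" "set_mset K \<subseteq> {1, 2}" "set_mset L \<subseteq> {1, 2}"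
    using add.hyps(1) unfolding trace_monoms_def by blast
  let ?q = "if (J, K, L) \<in> valid_exponents then normal_monom (J, K, L) else 0"
  have "sign_average (\<lambda>x. c * f x + g x) X = c * sign_average f X + sign_average g X" for X
    by (simp add: sign_average_def field_simps)
  then have "mpoly_eval (gen_monom X) (Const c * ?q + p) = sign_average (\<lambda>x. c * f x + g x) X" for X
    by (simp add: p f(1) sign_average_trace_monom[OF f(2-4)] mpoly_eval_add mpoly_eval_mult eval_normal_monom)
  moreover have "Const c * ?q + p \<in> polys_in gens"
    by (intro polys_in_add polys_in_mult p) (auto intro: normal_monom_in_polys)
  ultimately show ?case by blast
qed

theorem sign_invariants:
  assumes "f \<in> alg trace_coordinates"
    and "\<And>X s t. s \<in> {1, -1} \<Longrightarrow> t \<in> {1, -1} \<Longrightarrow> f (sign_change s t X) = f X"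
  shows "\<exists>p\<in>polys_in gens. \<forall>X. mpoly_eval (gen_monom X) p = f X"
proof -
  have "sign_average f X = f X" for X
    by (simp add: sign_average_def assms(2))
  then show ?thesis
    using sign_average_in_image[OF alg_trace_coordinates_linspan[OF assms(1)]] by simp
qed

section \<open>The character ring of SO(4)\<close>

lemma regular_functions_eq_alg:
  "regular_functions X = (\<lambda>f. restrict f X) ` alg entry_functions"
proof -
  have "(\<lambda>\<rho>. mpoly_eval (entry \<rho>) p) \<in> alg entry_functions" for p :: "(('a \<times> 'a) + ('a \<times> 'a), complex) mpoly"
    by (rule mpoly_eval_in_alg[of p UNIV]) (auto simp: polys_in_iff entry_functions_def intro: alg.gen)
  moreover have "\<exists>p. f = (\<lambda>\<rho>. mpoly_eval (entry \<rho>) p)" if "f \<in> alg entry_functions" for f :: "'a rep \<Rightarrow> complex"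
    using alg_eq_mpoly_eval[OF that, of UNIV entry] by (auto simp: entry_functions_def)
  ultimately show ?thesis
    unfolding regular_functions_def by blast
qed

lemma character_ring_simps [simp]:
  "mult (character_ring G) = (\<lambda>f h. restrict (\<lambda>\<rho>. f \<rho> * h \<rho>) (G \<times> G))"
  "one (character_ring G) = restrict (\<lambda>\<rho>. 1) (G \<times> G)"
  "zero (character_ring G) = restrict (\<lambda>\<rho>. 0) (G \<times> G)"
  "add (character_ring G) = (\<lambda>f h. restrict (\<lambda>\<rho>. f \<rho> + h \<rho>) (G \<times> G))"
  by (simp_all add: character_ring_def)

lemma in_character_ring:
  "f \<in> carrier (character_ring G) \<longleftrightarrow> f \<in> regular_functions (G \<times> G) \<and>
     (\<forall>g\<in>G. \<forall>\<rho>\<in>G \<times> G. f (conjugate g \<rho>) = f \<rho>)"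
  by (simp add: character_ring_def)

lemma restrict_in_character_ring:
  assumes "f \<in> alg entry_functions"
    and closed: "\<And>g \<rho>. g \<in> G \<Longrightarrow> \<rho> \<in> G \<times> G \<Longrightarrow> conjugate g \<rho> \<in> G \<times> G"
    and "\<And>g \<rho>. g \<in> G \<Longrightarrow> \<rho> \<in> G \<times> G \<Longrightarrow> f (conjugate g \<rho>) = f \<rho>"
  shows "restrict f (G \<times> G) \<in> carrier (character_ring G)"
  using assms unfolding in_character_ring regular_functions_eq_alg
  by (auto simp del: mem_Sigma_iff split_paired_Ball_Sigma)

lemma character_ring_cases:
  assumes "f \<in> carrier (character_ring G)"
    and closed: "\<And>g \<rho>. g \<in> G \<Longrightarrow> \<rho> \<in> G \<times> G \<Longrightarrow> conjugate g \<rho> \<in> G \<times> G"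
  obtains F where "F \<in> alg entry_functions" "f = restrict F (G \<times> G)"
    "\<And>g \<rho>. g \<in> G \<Longrightarrow> \<rho> \<in> G \<times> G \<Longrightarrow> F (conjugate g \<rho>) = F \<rho>"
proof -
  obtain F where F: "F \<in> alg entry_functions" "f = restrict F (G \<times> G)"
    using assms(1) unfolding in_character_ring regular_functions_eq_alg by blast
  have "F (conjugate g \<rho>) = F \<rho>" if "g \<in> G" "\<rho> \<in> G \<times> G" for g \<rho>
    using assms(1) closed[OF that] that unfolding in_character_ring F(2) restrict_def by (metis (no_types, lifting))
  with F that show thesis by blast
qed

lemma cring_character_ring:
  fixes G :: "(complex^'n^'n) set"
  assumes closed: "\<And>g \<rho>. g \<in> G \<Longrightarrow> \<rho> \<in> G \<times> G \<Longrightarrow> conjugate g \<rho> \<in> G \<times> G"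
  shows "cring (character_ring G)"
proof -
  let ?R = "character_ring G"
  have ext: "restrict f (G \<times> G) = f" if "f \<in> carrier ?R" for f
    using that by (auto simp: in_character_ring regular_functions_def)
  have comb: "restrict (\<lambda>\<rho>. h (f \<rho>) (f' \<rho>)) (G \<times> G) \<in> carrier ?R"
    if f: "f \<in> carrier ?R" "f' \<in> carrier ?R"
      and h: "\<And>F F' :: 'n rep \<Rightarrow> complex. F \<in> alg entry_functions \<Longrightarrow> F' \<in> alg entry_functions \<Longrightarrow>
        (\<lambda>\<rho>. h (F \<rho>) (F' \<rho>)) \<in> alg entry_functions" for f f' h
  proof -
    obtain F where F: "F \<in> alg entry_functions" "f = restrict F (G \<times> G)"
      "\<And>g \<rho>. g \<in> G \<Longrightarrow> \<rho> \<in> G \<times> G \<Longrightarrow> F (conjugate g \<rho>) = F \<rho>"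
      using character_ring_cases[OF f(1) closed] by blast
    obtain F' where F': "F' \<in> alg entry_functions" "f' = restrict F' (G \<times> G)"
      "\<And>g \<rho>. g \<in> G \<Longrightarrow> \<rho> \<in> G \<times> G \<Longrightarrow> F' (conjugate g \<rho>) = F' \<rho>"
      using character_ring_cases[OF f(2) closed] by blast
    have "restrict (\<lambda>\<rho>. h (F \<rho>) (F' \<rho>)) (G \<times> G) \<in> carrier ?R"
      by (rule restrict_in_character_ring[OF h[OF F(1) F'(1)] closed]) (simp_all add: F(3) F'(3))
    moreover have "restrict (\<lambda>\<rho>. h (F \<rho>) (F' \<rho>)) (G \<times> G) = restrict (\<lambda>\<rho>. h (f \<rho>) (f' \<rho>)) (G \<times> G)"
      by (rule restrict_ext) (simp add: F(2) F'(2))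
    ultimately show ?thesis by simp
  qed
  have const: "restrict (\<lambda>\<rho>. c) (G \<times> G) \<in> carrier ?R" for c
    by (rule restrict_in_character_ring[OF alg.const closed]) auto
  have eq: "f = f'" if "f \<in> extensional (G \<times> G)" "f' \<in> extensional (G \<times> G)"
    "\<And>\<rho>. \<rho> \<in> G \<times> G \<Longrightarrow> f \<rho> = f' \<rho>" for f f' :: "'n rep \<Rightarrow> complex"
    using that by (rule extensionalityI)
  have e: "f \<in> extensional (G \<times> G)" if "f \<in> carrier ?R" for f
    using ext[OF that] by (metis restrict_extensional)
  show ?thesis
  proof (rule cringI)
    show "abelian_group ?R"
    proof (rule abelian_groupI)
      fix f assume f: "f \<in> carrier ?R"
      have "restrict (\<lambda>\<rho>. - f \<rho>) (G \<times> G) \<in> carrier ?R"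
        by (rule comb[OF f f, where h = "\<lambda>a b. - a"]) (rule alg_uminus)
      then show "\<exists>f'\<in>carrier ?R. f' \<oplus>\<^bsub>?R\<^esub> f = \<zero>\<^bsub>?R\<^esub>"
        by (intro bexI[of _ "restrict (\<lambda>\<rho>. - f \<rho>) (G \<times> G)"]) (auto intro!: restrict_ext)
      show "\<zero>\<^bsub>?R\<^esub> \<oplus>\<^bsub>?R\<^esub> f = f"
        by (rule eq) (simp_all add: e f)
    next
      fix f f' assume f: "f \<in> carrier ?R" "f' \<in> carrier ?R"
      show "f \<oplus>\<^bsub>?R\<^esub> f' \<in> carrier ?R"
        unfolding character_ring_simps by (rule comb[OF f, where h = "(+)"]) (rule alg.add)
      show "f \<oplus>\<^bsub>?R\<^esub> f' = f' \<oplus>\<^bsub>?R\<^esub> f"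
        by (simp add: add.commute)
    next
      fix f f' f'' assume f: "f \<in> carrier ?R" "f' \<in> carrier ?R" "f'' \<in> carrier ?R"
      show "f \<oplus>\<^bsub>?R\<^esub> f' \<oplus>\<^bsub>?R\<^esub> f'' = f \<oplus>\<^bsub>?R\<^esub> (f' \<oplus>\<^bsub>?R\<^esub> f'')"
        by (rule eq) (simp_all add: add.assoc)
    next
      show "\<zero>\<^bsub>?R\<^esub> \<in> carrier ?R" using const by simp
    qed
    show "Group.comm_monoid ?R"
    proof (rule comm_monoidI)
      fix f assume f: "f \<in> carrier ?R"
      show "\<one>\<^bsub>?R\<^esub> \<otimes>\<^bsub>?R\<^esub> f = f"
        by (rule eq) (simp_all add: e f)
    next
      fix f f' assume f: "f \<in> carrier ?R" "f' \<in> carrier ?R"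
      show "f \<otimes>\<^bsub>?R\<^esub> f' \<in> carrier ?R"
        unfolding character_ring_simps by (rule comb[OF f, where h = "(*)"]) (rule alg.mult)
      show "f \<otimes>\<^bsub>?R\<^esub> f' = f' \<otimes>\<^bsub>?R\<^esub> f"
        by (simp add: mult.commute)
    next
      fix f f' f'' assume f: "f \<in> carrier ?R" "f' \<in> carrier ?R" "f'' \<in> carrier ?R"
      show "f \<otimes>\<^bsub>?R\<^esub> f' \<otimes>\<^bsub>?R\<^esub> f'' = f \<otimes>\<^bsub>?R\<^esub> (f' \<otimes>\<^bsub>?R\<^esub> f'')"
        by (rule eq) (simp_all add: mult.assoc)
    next
      show "\<one>\<^bsub>?R\<^esub> \<in> carrier ?R" using const by simp
    qed
    fix f f' f'' assume f: "f \<in> carrier ?R" "f' \<in> carrier ?R" "f'' \<in> carrier ?R"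
    show "(f \<oplus>\<^bsub>?R\<^esub> f') \<otimes>\<^bsub>?R\<^esub> f'' = f \<otimes>\<^bsub>?R\<^esub> f'' \<oplus>\<^bsub>?R\<^esub> f' \<otimes>\<^bsub>?R\<^esub> f''"
      by (rule eq) (simp_all add: distrib_right)
  qed
qed

lemma mpoly_eval_cong:
  assumes "p \<in> polys_in V" "\<And>v. v \<in> V \<Longrightarrow> x v = y v"
  shows "mpoly_eval x p = mpoly_eval y p"
  using assms(1) by (induction rule: polys_in_induct) (auto simp: mpoly_eval_add mpoly_eval_mult assms(2))

definition trace_coords :: "(nat \<Rightarrow> 2 rep) \<Rightarrow> nat \<Rightarrow> nat \<Rightarrow> complex" where
  "trace_coords \<rho> i j = (if i = 1 then fst (traces (\<rho> j)) else if i = 2 then fst (snd (traces (\<rho> j)))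
     else snd (snd (traces (\<rho> j))))"

lemma gen_value_eq_gen_monom: "g \<in> gens \<Longrightarrow> gen_value g \<rho> = gen_monom (trace_coords \<rho>) g"
  by (auto simp: gens_def tau_def tau12_def trace_coords_def traces_def)

text \<open>The six traces of two pairs in SL(2) take arbitrary values, so identities between functions of them can be
checked on representations.\<close>

lemma trace_coords_surj:
  "\<exists>\<rho>\<in>SL2_reps. \<forall>i\<in>{1, 2, 3}. \<forall>j. trace_coords \<rho> i j = X i j"
proof -
  have "\<exists>r. \<forall>j. r j \<in> SL2 \<times> SL2 \<and> traces (r j) = (X 1 j, X 2 j, X 3 j)"
    using traces_surj by (intro choice) blast
  then obtain r where "\<And>j. r j \<in> SL2 \<times> SL2" "\<And>j. traces (r j) = (X 1 j, X 2 j, X 3 j)"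
    by blast
  then show ?thesis
    by (intro bexI[of _ r]) (auto simp: SL2_reps_def trace_coords_def)
qed

lemma gen_monom_cong:
  assumes "g \<in> gens" "\<And>i j. i \<in> {1, 2, 3} \<Longrightarrow> j \<in> {1, 2} \<Longrightarrow> X i j = Y i j"
  shows "gen_monom X g = gen_monom Y g"
  using assms(1) by (auto simp: gens_def assms(2))

lemma conjugate_SL2_reps:
  assumes "C \<in> SL2" "D \<in> SL2" "\<rho> \<in> SL2_reps"
  shows "(\<lambda>j. conjugate (if j = 1 then C else D) (\<rho> j)) \<in> SL2_reps"
  using assms conjugate_in_SL2 by (auto simp: SL2_reps_def simp del: mem_Sigma_iff)

lemma trace_coords_conjugate:
  assumes "C \<in> SL2" "D \<in> SL2"
  shows "trace_coords (\<lambda>j. conjugate (if j = 1 then C else D) (\<rho> j)) = trace_coords \<rho>"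
  by (simp add: trace_coords_def fun_eq_iff traces_conjugate assms)

context
  fixes P :: "complex^4^(2 \<times> 2)"
  assumes P: "tensor_isometry P"
begin

lemma induced_rep_in_SO4: "\<rho> \<in> SL2_reps \<Longrightarrow> induced_rep P \<rho> \<in> SO4 \<times> SO4"
  by (auto simp: SL2_reps_def induced_rep_def intro!: tensor_hom_in_SO4[OF P])

lemma induced_rep_surj:
  assumes "\<sigma> \<in> SO4 \<times> SO4" obtains \<rho> where "\<rho> \<in> SL2_reps" "\<sigma> = induced_rep P \<rho>"
proof -
  obtain A B where AB: "A \<in> SL2" "B \<in> SL2" "fst \<sigma> = tensor_hom P A B"
    using tensor_hom_surj[OF P, of "fst \<sigma>"] assms by auto
  obtain A' B' where AB': "A' \<in> SL2" "B' \<in> SL2" "snd \<sigma> = tensor_hom P A' B'"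
    using tensor_hom_surj[OF P, of "snd \<sigma>"] assms by auto
  show thesis
    using AB AB' by (intro that[of "\<lambda>j. if j = 1 then (A, A') else (B, B')"])
      (auto simp: SL2_reps_def induced_rep_def prod_eq_iff)
qed

lemma conjugate_induced_rep:
  assumes "C \<in> SL2" "D \<in> SL2"
  shows "conjugate (tensor_hom P C D) (induced_rep P \<rho>) =
    induced_rep P (\<lambda>j. conjugate (if j = 1 then C else D) (\<rho> j))"
  by (simp add: conjugate_def[of "tensor_hom P C D"] induced_rep_def conjugate_SL2 assms
      matrix_inv_tensor_hom[OF P] tensor_hom_mult[OF P])

lemma conjugate_in_SO4:
  assumes "g \<in> SO4" "\<sigma> \<in> SO4 \<times> SO4" shows "conjugate g \<sigma> \<in> SO4 \<times> SO4"
proof -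
  obtain C D where CD: "C \<in> SL2" "D \<in> SL2" "g = tensor_hom P C D"
    using tensor_hom_surj[OF P assms(1)] by blast
  obtain \<rho> where \<rho>: "\<rho> \<in> SL2_reps" "\<sigma> = induced_rep P \<rho>"
    using induced_rep_surj[OF assms(2)] .
  show ?thesis
    unfolding CD(3) \<rho>(2) conjugate_induced_rep[OF CD(1,2)]
    by (intro induced_rep_in_SO4 conjugate_SL2_reps CD \<rho>)
qed

text \<open>Here the two invariances combine: conjugation by \<open>tensor_hom P C D\<close> conjugates the two pairs independently,
which gives a polynomial \<open>W\<close> in the six traces, and a sign change of both
pairs leaves the representation into SO(4) as it is, which makes \<open>W\<close> invariant under the signs.\<close>

theorem invariant_eq_gen_polynomial:
  assumes F: "F \<in> alg entry_functions"
    and inv: "\<And>g \<sigma>. g \<in> SO4 \<Longrightarrow> \<sigma> \<in> SO4 \<times> SO4 \<Longrightarrow> F (conjugate g \<sigma>) = F \<sigma>"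
  shows "\<exists>p\<in>polys_in gens. \<forall>\<rho>\<in>SL2_reps. F (induced_rep P \<rho>) = mpoly_eval (gen_monom (trace_coords \<rho>)) p"
proof -
  define pair :: "2 rep \<times> 2 rep \<Rightarrow> nat \<Rightarrow> 2 rep" where
    "pair = (\<lambda>x j. if j = 1 then fst x else snd x)"
  define F' where "F' = (\<lambda>x. F (induced_rep P (pair x)))"
  have pair_reps: "pair x \<in> SL2_reps \<longleftrightarrow> fst x \<in> SL2 \<times> SL2 \<and> snd x \<in> SL2 \<times> SL2" for x
    by (auto simp: pair_def SL2_reps_def)
  have pair_ind: "induced_rep P \<rho> = induced_rep P (pair (\<rho> 1, \<rho> 2))" for \<rho>
    by (simp add: induced_rep_def pair_def)
  have F'_alg: "F' \<in> alg (with_params entry_functions entry_functions)"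
    unfolding F'_def
  proof (rule alg_compose[OF F])
    fix s :: "4 rep \<Rightarrow> complex" assume "s \<in> entry_functions"
    then show "(\<lambda>x. s (induced_rep P (pair x))) \<in> alg (with_params entry_functions entry_functions)"
      by (cases rule: entry_functions_cases)
        (auto simp: induced_rep_def pair_def tensor_hom_def matrix_matrix_mult_def kronecker_def
          intro!: alg_sum alg_intros alg_with_params_fst entry_in_alg
            alg_with_params_fst[OF entry_in_alg(1)] alg_with_params_fst[OF entry_in_alg(2)]
            alg_with_params_snd[OF entry_in_alg(1)] alg_with_params_snd[OF entry_in_alg(2)])
  qed
  have F'_conj: "F' (conjugate C \<rho>, conjugate D \<sigma>) = F' (\<rho>, \<sigma>)"
    if "C \<in> SL2" "D \<in> SL2" "\<rho> \<in> SL2 \<times> SL2" "\<sigma> \<in> SL2 \<times> SL2" for C D \<rho> \<sigma>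
  proof -
    have "(\<lambda>j. conjugate (if j = 1 then C else D) (pair (\<rho>, \<sigma>) j)) = pair (conjugate C \<rho>, conjugate D \<sigma>)"
      by (simp add: pair_def fun_eq_iff)
    then have "F' (conjugate C \<rho>, conjugate D \<sigma>)
        = F (conjugate (tensor_hom P C D) (induced_rep P (pair (\<rho>, \<sigma>))))"
      by (simp only: F'_def conjugate_induced_rep[OF that(1,2)])
    also have "\<dots> = F' (\<rho>, \<sigma>)"
      unfolding F'_def by (intro inv tensor_hom_in_SO4[OF P] induced_rep_in_SO4) (use that in \<open>auto simp: pair_reps\<close>)
    finally show ?thesis .
  qed
  have one: "mat 1 \<in> SL2"
    by (simp add: SL2_def)
  have conj_one: "conjugate (mat 1) \<rho> = \<rho>" for \<rho> :: "2 rep"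
  proof -
    have "adj22 (mat 1) = mat 1"
      by (simp add: adj22_def mat22_eq_iff mat_def)
    then show ?thesis by (simp add: conjugate_SL2 one)
  qed
  have "F' (conjugate g \<rho>, \<sigma>) = F' (\<rho>, \<sigma>)" "F' (\<rho>, conjugate g \<sigma>) = F' (\<rho>, \<sigma>)"
    if "g \<in> SL2" "\<rho> \<in> SL2 \<times> SL2" "\<sigma> \<in> SL2 \<times> SL2" for g \<rho> \<sigma>
    using F'_conj[OF that(1) one that(2,3)] F'_conj[OF one that] by (simp_all only: conj_one)
  from fricke_vogt_product[OF F'_alg this]
  obtain V where V: "V \<in> alg (with_params coordinates3 coordinates3)"
    "\<And>\<rho> \<sigma>. \<rho> \<in> SL2 \<times> SL2 \<Longrightarrow> \<sigma> \<in> SL2 \<times> SL2 \<Longrightarrow> F' (\<rho>, \<sigma>) = V (traces \<rho>, traces \<sigma>)"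
    by blast
  define W where "W = (\<lambda>X :: nat \<Rightarrow> nat \<Rightarrow> complex. V ((X 1 1, X 2 1, X 3 1), (X 1 2, X 2 2, X 3 2)))"
  have W: "F (induced_rep P \<rho>) = W (trace_coords \<rho>)" if "\<rho> \<in> SL2_reps" for \<rho>
  proof -
    have "F (induced_rep P \<rho>) = F' (\<rho> 1, \<rho> 2)"
      by (subst pair_ind) (simp add: F'_def)
    also have "\<dots> = V (traces (\<rho> 1), traces (\<rho> 2))"
      using that by (intro V(2)) (auto simp: SL2_reps_def)
    also have "\<dots> = W (trace_coords \<rho>)"
      by (simp add: W_def trace_coords_def)
    finally show ?thesis .
  qed
  have W_cong: "W X = W Y" if "\<And>i j. i \<in> {1, 2, 3} \<Longrightarrow> X i j = Y i j" for X Y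
    by (simp add: W_def that)
  have W_alg: "W \<in> alg trace_coordinates"
    unfolding W_def
  proof (rule alg_compose[OF V(1)])
    have c: "(\<lambda>X. X i j) \<in> alg trace_coordinates" if "i \<in> {1, 2, 3}" "j \<in> {1, 2}" for i j
      using that by (intro alg.gen) (auto simp: trace_coordinates_def)
    fix s assume "s \<in> with_params coordinates3 coordinates3"
    then show "(\<lambda>X. s ((X 1 1, X 2 1, X 3 1), X 1 2, X 2 2, X 3 2)) \<in> alg trace_coordinates"
      by (auto simp: with_params_def coordinates3_def intro!: c)
  qed
  have W_sign: "W (sign_change s t X) = W X" if st: "s \<in> {1, -1}" "t \<in> {1, -1}" for X s t
  proof -
    obtain \<rho> where \<rho>: "\<rho> \<in> SL2_reps" "\<And>i j. i \<in> {1, 2, 3} \<Longrightarrow> trace_coords \<rho> i j = X i j"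
      using trace_coords_surj[of X] by blast
    \<comment> \<open>a sign change of both pairs, which the tensor product does not see\<close>
  define \<rho>' where "\<rho>' = (\<lambda>j. (if s = 1 then fst (\<rho> j) else - fst (\<rho> j), if t = 1 then snd (\<rho> j) else - snd (\<rho> j)))"
    have \<rho>': "\<rho>' \<in> SL2_reps"
      using \<rho>(1) by (auto simp: SL2_reps_def \<rho>'_def SL2_iff mem_Times_iff)
    have "kronecker (- A) (- B) = kronecker A B" for A B
      by (simp add: kronecker_def)
    then have ind: "induced_rep P \<rho>' = induced_rep P \<rho>"
      by (cases "s = 1"; cases "t = 1") (simp_all add: induced_rep_def \<rho>'_def tensor_hom_def)
    have tc: "trace_coords \<rho>' i j = sign_change s t (trace_coords \<rho>) i j" for i j
    proof -
      have "trace (fst (\<rho>' j)) = s * trace (fst (\<rho> j))" "trace (snd (\<rho>' j)) = t * trace (snd (\<rho> j))"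
        "trace (fst (\<rho>' j) ** snd (\<rho>' j)) = s * t * trace (fst (\<rho> j) ** snd (\<rho> j))"
        using st by (auto simp: \<rho>'_def trace22 mult22_nth)
      then show ?thesis
        by (simp add: trace_coords_def sign_change_def traces_def)
    qed
    have "W (sign_change s t X) = W (trace_coords \<rho>')"
      by (rule W_cong) (simp only: tc sign_change_def \<rho>(2))
    also have "\<dots> = W (trace_coords \<rho>)"
      using W[OF \<rho>'] W[OF \<rho>(1)] by (simp only: ind)
    also have "\<dots> = W X"
      by (rule W_cong) (rule \<rho>(2))
    finally show ?thesis .
  qed
  obtain p where "p \<in> polys_in gens" "\<And>X. mpoly_eval (gen_monom X) p = W X"
    using sign_invariants[OF W_alg W_sign] by blast
  then show ?thesis
    using W by (intro bexI[of _ p]) auto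
qed

end

text \<open>The isomorphism is induced by evaluation \<open>\<Phi>\<close> at the regular functions \<open>G g\<close> that represent the
generators.  Its kernel is given by \<open>kernel_eq_relation_ideal\<close>, since the traces take all
values, and its image by \<open>invariant_eq_gen_polynomial\<close>.\<close>

theorem proposition20:
  fixes P :: "complex^4^(2 \<times> 2)"
  assumes "tensor_isometry P"
  shows "\<exists>h. h \<in> ring_iso (mpoly_ring gens Quot relation_ideal) (character_ring SO4) \<and>
             (\<forall>c. h (relation_ideal +>\<^bsub>mpoly_ring gens\<^esub> Const c) =
                   restrict (\<lambda>_. c) (SO4 \<times> SO4)) \<and>
             (\<forall>v\<in>gens. \<forall>\<rho>. (\<forall>j\<in>{1, 2}. \<rho> j \<in> SL2 \<times> SL2) \<longrightarrow>
                h (relation_ideal +>\<^bsub>mpoly_ring gens\<^esub> Var v) (induced_rep P \<rho>) = gen_value v \<rho>)"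
proof -
  note P = assms
  note closed = conjugate_in_SO4[OF P]
  obtain G where G: "\<And>g. g \<in> gens \<Longrightarrow> G g \<in> alg entry_functions"
    "\<And>g \<rho>. g \<in> gens \<Longrightarrow> \<rho> \<in> SL2_reps \<Longrightarrow> gen_value g \<rho> = G g (induced_rep P \<rho>)"
    using gen_value_descends[OF P] unfolding descends_def by metis
  define \<Phi> where "\<Phi> p = restrict (\<lambda>\<sigma>. mpoly_eval (\<lambda>g. G g \<sigma>) p) (SO4 \<times> SO4)" for p
  have \<Phi>_eq: "mpoly_eval (\<lambda>g. G g (induced_rep P \<rho>)) p = mpoly_eval (gen_monom (trace_coords \<rho>)) p"
    if "p \<in> polys_in gens" "\<rho> \<in> SL2_reps" for p \<rho>
    using that(1) by (rule mpoly_eval_cong) (simp add: G(2)[symmetric] that(2) gen_value_eq_gen_monom)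
  have \<Phi>_carrier: "\<Phi> p \<in> carrier (character_ring SO4)" if p: "p \<in> polys_in gens" for p
    unfolding \<Phi>_def
  proof (rule restrict_in_character_ring[OF _ closed])
    show "(\<lambda>\<sigma>. mpoly_eval (\<lambda>g. G g \<sigma>) p) \<in> alg entry_functions"
      using p by (rule mpoly_eval_in_alg) (rule G(1))
    fix g \<sigma> assume g: "g \<in> SO4" and \<sigma>: "\<sigma> \<in> SO4 \<times> SO4"
    obtain C D where CD: "C \<in> SL2" "D \<in> SL2" "g = tensor_hom P C D"
      using tensor_hom_surj[OF P g] by blast
    obtain \<rho> where \<rho>: "\<rho> \<in> SL2_reps" "\<sigma> = induced_rep P \<rho>"
      using induced_rep_surj[OF P \<sigma>] .
    show "mpoly_eval (\<lambda>h. G h (conjugate g \<sigma>)) p = mpoly_eval (\<lambda>h. G h \<sigma>) p"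
      unfolding CD(3) \<rho>(2) conjugate_induced_rep[OF P CD(1,2)]
      using \<Phi>_eq[OF p] conjugate_SL2_reps[OF CD(1,2) \<rho>(1)] \<rho>(1) trace_coords_conjugate[OF CD(1,2)]
      by simp
  qed
  have "ring_hom_ring (mpoly_ring gens) (character_ring SO4) \<Phi>"
  proof (rule ring_hom_ringI)
    show "ring (mpoly_ring gens :: (gen, complex) mpoly ring)" "ring (character_ring SO4)"
      using cring_mpoly_ring cring_character_ring[of SO4] closed by (auto intro: cring.axioms)
  qed (erule \<Phi>_carrier, auto simp: \<Phi>_def mpoly_eval_add mpoly_eval_mult intro!: restrict_ext)
  then interpret \<Phi>: ring_hom_ring "mpoly_ring gens" "character_ring SO4" \<Phi> .
  have zero_iff: "\<Phi> p = restrict (\<lambda>_. 0) (SO4 \<times> SO4) \<longleftrightarrow> (\<forall>X. mpoly_eval (gen_monom X) p = 0)"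
    if p: "p \<in> polys_in gens" for p
  proof
    assume zero: "\<Phi> p = restrict (\<lambda>_. 0) (SO4 \<times> SO4)"
    show "\<forall>X. mpoly_eval (gen_monom X) p = 0"
    proof
      fix X
      obtain \<rho> where \<rho>: "\<rho> \<in> SL2_reps" "\<And>i j. i \<in> {1, 2, 3} \<Longrightarrow> trace_coords \<rho> i j = X i j"
        using trace_coords_surj[of X] by blast
      have "mpoly_eval (gen_monom X) p = mpoly_eval (gen_monom (trace_coords \<rho>)) p"
        using p by (rule mpoly_eval_cong) (rule gen_monom_cong, auto simp: \<rho>(2))
      also have "\<dots> = \<Phi> p (induced_rep P \<rho>)"
        using induced_rep_in_SO4[OF P \<rho>(1)] \<Phi>_eq[OF p \<rho>(1)] by (simp add: \<Phi>_def)
      also have "\<dots> = 0"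
        using induced_rep_in_SO4[OF P \<rho>(1)] by (simp add: zero)
      finally show "mpoly_eval (gen_monom X) p = 0" .
    qed
  next
    assume zero: "\<forall>X. mpoly_eval (gen_monom X) p = 0"
    show "\<Phi> p = restrict (\<lambda>_. 0) (SO4 \<times> SO4)"
      unfolding \<Phi>_def
    proof (rule restrict_ext)
      fix \<sigma> assume "\<sigma> \<in> SO4 \<times> SO4"
      then obtain \<rho> where "\<rho> \<in> SL2_reps" "\<sigma> = induced_rep P \<rho>"
        by (rule induced_rep_surj[OF P])
      then show "mpoly_eval (\<lambda>g. G g \<sigma>) p = 0"
        using \<Phi>_eq[OF p] zero by simp
    qed
  qed
  have kernel: "a_kernel (mpoly_ring gens) (character_ring SO4) \<Phi> = relation_ideal"
  proof -
    have "relation_ideal \<subseteq> polys_in gens"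
      using additive_subgroup.a_subset[OF ideal.axioms(1)[OF ideal_relation_ideal]] .
    then show ?thesis
      unfolding a_kernel_def' using zero_iff kernel_eq_relation_ideal by auto
  qed
  have surj: "\<Phi> ` polys_in gens = carrier (character_ring SO4)"
  proof
    show "\<Phi> ` polys_in gens \<subseteq> carrier (character_ring SO4)"
      using \<Phi>_carrier by blast
    show "carrier (character_ring SO4) \<subseteq> \<Phi> ` polys_in gens"
    proof
      fix f assume "f \<in> carrier (character_ring SO4)"
      then obtain F where F: "F \<in> alg entry_functions" "f = restrict F (SO4 \<times> SO4)"
        "\<And>g \<rho>. g \<in> SO4 \<Longrightarrow> \<rho> \<in> SO4 \<times> SO4 \<Longrightarrow> F (conjugate g \<rho>) = F \<rho>"
        using character_ring_cases closed by blast
      obtain p where p: "p \<in> polys_in gens"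
        "\<And>\<rho>. \<rho> \<in> SL2_reps \<Longrightarrow> F (induced_rep P \<rho>) = mpoly_eval (gen_monom (trace_coords \<rho>)) p"
        using invariant_eq_gen_polynomial[OF P F(1,3)] by blast
      have "f = \<Phi> p"
        unfolding F(2) \<Phi>_def
      proof (rule restrict_ext)
        fix \<sigma> assume "\<sigma> \<in> SO4 \<times> SO4"
        then obtain \<rho> where "\<rho> \<in> SL2_reps" "\<sigma> = induced_rep P \<rho>"
          by (rule induced_rep_surj[OF P])
        then show "F \<sigma> = mpoly_eval (\<lambda>g. G g \<sigma>) p"
          using \<Phi>_eq[OF p(1)] p(2) by simp
      qed
      then show "f \<in> \<Phi> ` polys_in gens"
        using p(1) by blast
    qed
  qed
  have coset: "the_elem (\<Phi> ` (relation_ideal +>\<^bsub>mpoly_ring gens\<^esub> p)) = \<Phi> p"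
    if "p \<in> polys_in gens" for p
    using \<Phi>.the_elem_simp[OF that] by (simp only: kernel)
  show ?thesis
  proof (intro exI[of _ "\<lambda>X. the_elem (\<Phi> ` X)"] conjI allI ballI impI)
    show "(\<lambda>X. the_elem (\<Phi> ` X)) \<in> ring_iso (mpoly_ring gens Quot relation_ideal) (character_ring SO4)"
      using \<Phi>.FactRing_iso_set[OF surj] by (simp only: kernel)
    show "the_elem (\<Phi> ` (relation_ideal +>\<^bsub>mpoly_ring gens\<^esub> Const c)) = restrict (\<lambda>_. c) (SO4 \<times> SO4)" for c
      unfolding coset[OF polys_in_Const] by (simp add: \<Phi>_def)
    show "the_elem (\<Phi> ` (relation_ideal +>\<^bsub>mpoly_ring gens\<^esub> Var v)) (induced_rep P \<rho>) = gen_value v \<rho>"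
      if "v \<in> gens" "\<forall>j\<in>{1, 2}. \<rho> j \<in> SL2 \<times> SL2" for v \<rho>
    proof -
      have "\<rho> \<in> SL2_reps" using that(2) by (simp add: SL2_reps_def)
      then show ?thesis
        unfolding coset[OF polys_in_Var[OF that(1)]]
        using that(1) induced_rep_in_SO4[OF P] by (simp add: \<Phi>_def G(2))
    qed
  qed
qed

end
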